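(* Consider a Jackson network with $d=2$ queues satisfying Assumption (J) (see context), with queue length process $(X(t))$ on $\mathbb{Z}_+^2$. If the Markov process $(X(t))$ is ergodic (positive recurrent), then $$\log r^*_e \;=\; -\inf_{i\in\{1,2\}} L_{\{i\}}(0) \;=\; -(1-p_{12}p_{21})\,\min\bigl\{(\sqrt{\mu_1}-\sqrt{\nu_1})^2,\ (\sqrt{\mu_2}-\sqrt{\nu_2})^2\bigr\}.$$ Otherwise, $$\log r^*_e \;=\; -\inf_{i\in\{1,2\}} L_{\{i\}}(0) \;=\; \log r^* \;=\; -L_\emptyset(0).$$
   Context: **Jackson network.** For $d$ queues, with arrival rates $\lambda_i\ge0$, service rates $\mu_i>0$, routing probabilities $p_{ij}$ ($i,j\in\{1,\dots,d\}$, $p_{ii}=0$), $p_{i0}=1-\sum_{j=1}^dp_{ij}\ge0$ the probability of leaving the network from queue $i$, and $p_{00}=1$, $p_{0i}=0$ for $i\neq0$. The queue length process $X(t)=(X_1(t),\dots,X_d(t))$ is the continuous time Markov chain on $\mathbb{Z}_+^d$ with generator $\mathcal{G}f(x)=\sum_{y\in\mathbb{Z}_+^d}q(x,y)(f(y)-f(x))$, where $q(x,y)=\lambda_i$ if $y-x=\epsilon_i$; $q(x,y)=\mu_ip_{i0}$ if $y-x=-\epsilon_i$; $q(x,y)=\mu_ip_{ij}$ if $y-x=\epsilon_j-\epsilon_i$, $i\ne j$; $q(x,y)=0$ otherwise ($x,y\in\mathbb{Z}_+^d$; $\epsilon_i$ is the $i$-th unit vector). **Assumption (J).** 1) The spectral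 radius of the matrix $(p_{ij};i,j=1,\dots,d)$ is strictly less than $1$. 2) For any $1\le i\le d$ there exist $n\in\mathbb{N}$ and $1\le j\le d$ with $\lambda_jp_{ji}^{(n)}>0$, where $p_{ji}^{(n)}$ are the $n$-step transition probabilities of the Markov chain with stochastic matrix $(p_{ij};i,j=0,\dots,d)$. Under (J), $(X(t))$ is irreducible and the traffic equations $\nu_i=\lambda_i+\sum_{j=1}^d\nu_jp_{ji}$, $i=1,\dots,d$, have a unique solution $(\nu_i)$; $(X(t))$ is ergodic if and only if $\nu_i<\mu_i$ for all $i$. **Spectral radii.** $r^*=\inf\{r>0:\int_0^\infty r^{-t}\mathbb{P}_x(X(t)=y)\,dt<+\infty\ \ \forall x,y\in\mathbb{Z}_+^d\}$. $r^*_e$ is the infimum of all $r>0$ for which there is a finite set $K\subset\mathbb{Z}_+^d$ such that $\int_0^\infty r^{-t}\mathbb{P}_x(X(t)=y,\ \tau(K)>t)\,dt<+\infty$ for all $x,y\in\mathbb{Z}_+^d\setminus K$, where $\tau(K)$ is the first hitting time of $K$. **Functions $R$, $L_\Lambda$.** For $\alpha\in\mathbb{R}^d$, $$R(\alpha)=\sum_{i=1}^d\mu_i\Bigl(\sum_{j\neq i}p_{ij}e^{\alpha_j-\alpha_i}+p_{i0}e^{-\alpha_i}-1\Bigr)+\sum_{i=1}^d\lambda_i(e^{\alpha_i}-1)$$ (inner sum over $j\in\{1,\dots,d\}$). For $\Lambda\subset\{1,\dots,d\}$, $\mathcal{B}_\Lambda$ is the set of all $\alpha\in\mathbb{R}^d$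 with $\alpha_i\le\log\bigl(\sum_{j=1}^dp_{ij}e^{\alpha_j}+p_{i0}\bigr)$ for all $i\notin\Lambda$, and $L_\Lambda(v)=\sup_{\alpha\in\mathcal{B}_\Lambda}(\langle\alpha,v\rangle-R(\alpha))$ for $v\in\mathbb{R}^d$. *)

theory Defs
  imports "HOL-Probability.Probability"
begin

section \<open>Continuous-time Markov chains on a discrete state space\<close>

definition generator :: "('s \<Rightarrow> 's \<Rightarrow> real) \<Rightarrow> ('s \<Rightarrow> real) \<Rightarrow> 's \<Rightarrow> real" where
  "generator q f x = (\<Sum>\<^sub>\<infinity>y. q x y * (f y - f x))"

text \<open>
  The family \<open>P x\<close> gives the law of the process \<open>(X t)\<close>, \<open>t \<ge> 0\<close>, started at \<open>x\<close>. The fourth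
  clause is right-continuity of the paths for the discrete topology; the fifth is the
  time-homogeneous Markov property, \<open>T\<close> being a finite set of observation times before
  \<open>s\<close>; the last says that the process has generator \<open>generator q\<close> (on bounded functions).
\<close>
definition markov_chain_with_rates ::
    "('s \<Rightarrow> 's \<Rightarrow> real) \<Rightarrow> ('s \<Rightarrow> 'w measure) \<Rightarrow> (real \<Rightarrow> 'w \<Rightarrow> 's) \<Rightarrow> bool" where
  "markov_chain_with_rates q P X \<longleftrightarrow>
     (\<forall>x. prob_space (P x)) \<and> (\<forall>x y. sets (P x) = sets (P y)) \<and>
     (\<forall>x. \<forall>t\<ge>0. X t \<in> measurable (P x) (count_space UNIV)) \<and>
     (\<forall>x. \<forall>\<omega>\<in>space (P x). \<forall>t\<ge>0. \<exists>\<epsilon>>0. \<forall>s\<in>{t..<t+\<epsilon>}. X s \<omega> = X t \<omega>) \<and>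
     (\<forall>x. measure (P x) {\<omega> \<in> space (P x). X 0 \<omega> = x} = 1) \<and>
     (\<forall>x y z s t T f. 0 \<le> s \<longrightarrow> 0 \<le> t \<longrightarrow> finite T \<longrightarrow> T \<subseteq> {0..s} \<longrightarrow>
        measure (P x) {\<omega> \<in> space (P x). (\<forall>r\<in>T. X r \<omega> = f r) \<and> X s \<omega> = y \<and> X (s + t) \<omega> = z} =
        measure (P x) {\<omega> \<in> space (P x). (\<forall>r\<in>T. X r \<omega> = f r) \<and> X s \<omega> = y} *
        measure (P y) {\<omega> \<in> space (P y). X t \<omega> = z}) \<and>
     (\<forall>f x. bounded (range f) \<longrightarrow>
        ((\<lambda>t. ((\<integral>\<omega>. f (X t \<omega>) \<partial>P x) - f x) / t) \<longlongrightarrow> generator q f x) (at_right 0))"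

definition hitting_time :: "(real \<Rightarrow> 'w \<Rightarrow> 's) \<Rightarrow> 's set \<Rightarrow> 'w \<Rightarrow> ennreal" where
  "hitting_time X K \<omega> = Inf (ennreal ` {t. 0 \<le> t \<and> X t \<omega> \<in> K})"

text \<open>The first time at which the path is in \<open>x\<close> after having been away from \<open>x\<close>.\<close>
definition return_time :: "(real \<Rightarrow> 'w \<Rightarrow> 's) \<Rightarrow> 's \<Rightarrow> 'w \<Rightarrow> ennreal" where
  "return_time X x \<omega> = Inf (ennreal ` {t. 0 \<le> t \<and> X t \<omega> = x \<and> (\<exists>s\<in>{0..t}. X s \<omega> \<noteq> x)})"

definition positive_recurrent :: "('s \<Rightarrow> 'w measure) \<Rightarrow> (real \<Rightarrow> 'w \<Rightarrow> 's) \<Rightarrow> bool" where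
  "positive_recurrent P X \<longleftrightarrow> (\<forall>x. (\<integral>\<^sup>+\<omega>. return_time X x \<omega> \<partial>P x) < \<infinity>)"

text \<open>
  The infima below are taken over subsets of the positive reals that contain every \<open>r > 1\<close>,
  so the infimum in the reals is the intended one.
\<close>
definition spectral_radius_chain :: "('s \<Rightarrow> 'w measure) \<Rightarrow> (real \<Rightarrow> 'w \<Rightarrow> 's) \<Rightarrow> real" where
  "spectral_radius_chain P X = Inf {r. r > 0 \<and>
     (\<forall>x y. (\<integral>\<^sup>+t\<in>{0..}. ennreal (r powr (- t) *
        measure (P x) {\<omega> \<in> space (P x). X t \<omega> = y}) \<partial>lborel) < \<infinity>)}"

definition essential_spectral_radius_chain ::
    "('s \<Rightarrow> 'w measure) \<Rightarrow> (real \<Rightarrow> 'w \<Rightarrow> 's) \<Rightarrow> real" where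
  "essential_spectral_radius_chain P X = Inf {r. r > 0 \<and> (\<exists>K. finite K \<and>
     (\<forall>x\<in>- K. \<forall>y\<in>- K. (\<integral>\<^sup>+t\<in>{0..}. ennreal (r powr (- t) *
        measure (P x) {\<omega> \<in> space (P x). X t \<omega> = y \<and> hitting_time X K \<omega> > ennreal t})
        \<partial>lborel) < \<infinity>))}"


section \<open>Jackson networks\<close>

definition exit_prob :: "real^'n^'n \<Rightarrow> 'n::finite \<Rightarrow> real" where
  "exit_prob p i = 1 - (\<Sum>j\<in>UNIV. p $ i $ j)"

definition jackson_network :: "real^'n \<Rightarrow> real^'n \<Rightarrow> real^'n^'n::finite \<Rightarrow> bool" where
  "jackson_network lam mu p \<longleftrightarrow>
     (\<forall>i. lam $ i \<ge> 0) \<and> (\<forall>i. mu $ i > 0) \<and> (\<forall>i j. p $ i $ j \<ge> 0) \<and>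
     (\<forall>i. p $ i $ i = 0) \<and> (\<forall>i. exit_prob p i \<ge> 0)"

text \<open>
  For given \<open>x\<close> and \<open>y\<close> at most one summand is nonzero. The conditions are
  \<open>y - x = \<epsilon>\<^sub>i\<close>, \<open>y - x = - \<epsilon>\<^sub>i\<close> and \<open>y - x = \<epsilon>\<^sub>j - \<epsilon>\<^sub>i\<close>, written without subtraction because
  subtraction of natural numbers truncates.
\<close>
definition jackson_rate ::
    "real^'n \<Rightarrow> real^'n \<Rightarrow> real^'n^'n \<Rightarrow> nat^'n \<Rightarrow> nat^'n::finite \<Rightarrow> real" where
  "jackson_rate lam mu p x y =
     (\<Sum>i\<in>UNIV. if y = x + axis i 1 then lam $ i else 0) +
     (\<Sum>i\<in>UNIV. if y + axis i 1 = x then mu $ i * exit_prob p i else 0) +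
     (\<Sum>i\<in>UNIV. \<Sum>j\<in>UNIV - {i}. if y + axis i 1 = x + axis j 1 then mu $ i * p $ i $ j else 0)"

definition spectral_radius_matrix :: "real^'n^'n::finite \<Rightarrow> real" where
  "spectral_radius_matrix A =
     Sup {cmod c | c v. v \<noteq> 0 \<and> (\<chi> i j. complex_of_real (A $ i $ j)) *v v = c *s v}"

text \<open>The stochastic matrix on \<open>{0,...,d}\<close>; the absorbing state \<open>0\<close> (outside) is \<open>None\<close>.\<close>
definition routing_matrix :: "real^'n^'n::finite \<Rightarrow> real^('n option)^('n option)" where
  "routing_matrix p = (\<chi> a b. case a of
       None \<Rightarrow> (case b of None \<Rightarrow> 1 | Some j \<Rightarrow> 0)
     | Some i \<Rightarrow> (case b of None \<Rightarrow> exit_prob p i | Some j \<Rightarrow> p $ i $ j))"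

text \<open>The type class power on \<open>real^'n^'n\<close> is componentwise, hence the iterated matrix product.\<close>
definition routing_steps :: "real^'n^'n \<Rightarrow> nat \<Rightarrow> 'n \<Rightarrow> 'n::finite \<Rightarrow> real" where
  "routing_steps p n j i = (((**) (routing_matrix p) ^^ n) (mat 1)) $ Some j $ Some i"

definition assumption_J :: "real^'n \<Rightarrow> real^'n^'n::finite \<Rightarrow> bool" where
  "assumption_J lam p \<longleftrightarrow>
     spectral_radius_matrix p < 1 \<and> (\<forall>i. \<exists>n j. lam $ j * routing_steps p n j i > 0)"

definition traffic_equations :: "real^'n \<Rightarrow> real^'n^'n \<Rightarrow> real^'n::finite \<Rightarrow> bool" where
  "traffic_equations lam p nu \<longleftrightarrow> (\<forall>i. nu $ i = lam $ i + (\<Sum>j\<in>UNIV. nu $ j * p $ j $ i))"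

definition jackson_R :: "real^'n \<Rightarrow> real^'n \<Rightarrow> real^'n^'n \<Rightarrow> real^'n::finite \<Rightarrow> real" where
  "jackson_R lam mu p \<alpha> =
     (\<Sum>i\<in>UNIV. mu $ i * ((\<Sum>j\<in>UNIV - {i}. p $ i $ j * exp (\<alpha> $ j - \<alpha> $ i))
        + exit_prob p i * exp (- \<alpha> $ i) - 1))
     + (\<Sum>i\<in>UNIV. lam $ i * (exp (\<alpha> $ i) - 1))"

definition jackson_B :: "real^'n^'n \<Rightarrow> 'n::finite set \<Rightarrow> (real^'n) set" where
  "jackson_B p \<Lambda> =
     {\<alpha>. \<forall>i. i \<notin> \<Lambda> \<longrightarrow> \<alpha> $ i \<le> ln ((\<Sum>j\<in>UNIV. p $ i $ j * exp (\<alpha> $ j)) + exit_prob p i)}"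

text \<open>Extended real valued, since the supremum may be infinite for some \<open>v\<close>.\<close>
definition jackson_L ::
    "real^'n \<Rightarrow> real^'n \<Rightarrow> real^'n^'n \<Rightarrow> 'n::finite set \<Rightarrow> real^'n \<Rightarrow> ereal" where
  "jackson_L lam mu p \<Lambda> v = (SUP \<alpha>\<in>jackson_B p \<Lambda>. ereal (\<alpha> \<bullet> v - jackson_R lam mu p \<alpha>))"

end

theory Submission
  imports Defs
begin

text \<open>
  Everything is read off from functions on the state space. A positive function with finite support
  off \<open>K\<close> and \<open>G g \<ge> \<rho> g\<close> on its support bounds the mass of the process killed in \<open>K\<close> from below by
  \<open>exp (\<rho> t)\<close>; a positive function with \<open>G f \<le> \<rho> f\<close> off \<open>K\<close> bounds it from above. Both follow from
  the definition of the generator alone, by observing the chain on finer and finer dyadic grids.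

  Put \<open>x = exp \<alpha>\<^sub>1\<close>, \<open>y = exp \<alpha>\<^sub>2\<close>. Then \<open>x ^ m * y ^ n\<close> is an eigenfunction of the generator in the
  interior with eigenvalue \<open>R\<close>, and a supersolution near an axis if and only if \<open>(x, y)\<close> is on the right side
  of a line through \<open>(1, 1)\<close>. The value \<open>exp R\<close> is attained at critical points: those
  where \<open>R\<close> is stationary, or stationary along one of the lines with the transversal derivative pointing
  inwards. There the twisted walk is driftless and, in the second case, stable in the transversal direction,
  so that long bumps give almost optimal test functions. If both queues are subcritical, the
  bottleneck queue gives the critical point and a sum of two exponentials gives the matching
  supersolution; otherwise the minimiser of \<open>R\<close> over the wedge between the lines is critical, and one
  exponential suffices.
\<close>

section \<open>Finite-dimensional distributions and killed processes\<close>

text \<open>The chain is known only through its finite-dimensional laws, its right-continuous paths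
  and, for each bounded function and each starting point separately, the derivative of the semigroup
  at time 0. Neither Kolmogorov equations nor a strong Markov property are at hand, and the
  derivative is uniform only over finitely many states. So functions are always cut off to finite
  sets. Cutting off a positive function lowers the generator where the function is kept, which
  preserves supersolutions; the lost mass is controlled separately, by non-explosion. Since R is
  convex in logarithmic coordinates, a critical point minimises it on a whole side of one of the
  lines. This identifies its value with the variational expression in L, given a point of no larger
  value on the admissible side of the other line. Ergodicity means finite mean return times and has
  to be translated into traffic inequalities: strict subcriticality of both queues implies it,
  strict overload of one queue refutes it. The balanced case in between is not decided; both
  branches of the argument cover it, and both values are then 0.\<close>

locale rates_chain =
  fixes q :: "'s::countable \<Rightarrow> 's \<Rightarrow> real" and P :: "'s \<Rightarrow> 'w measure" and X :: "real \<Rightarrow> 'w \<Rightarrow> 's"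
  assumes chain: "markov_chain_with_rates q P X"
begin

lemmas chain_props = chain[unfolded markov_chain_with_rates_def]

lemma prob_space_P: "prob_space (P x)"
  using conjunct1[OF chain_props] by simp

lemma X_measurable: "0 \<le> t \<Longrightarrow> X t \<in> measurable (P x) (count_space UNIV)"
  using conjunct1[OF conjunct2[OF conjunct2[OF chain_props]]] by simp

lemma X_sets [measurable]: "0 \<le> t \<Longrightarrow> {\<omega> \<in> space (P x). X t \<omega> \<in> A} \<in> sets (P x)"
  using measurable_sets[OF X_measurable, of t A x] by (simp add: vimage_def Int_def conj_commute)

lemma X_eq_sets: "0 \<le> t \<Longrightarrow> {\<omega> \<in> space (P x). X t \<omega> = y} \<in> sets (P x)"
  using X_sets[of t x "{y}"] by simp

lemma right_cont:
  "\<omega> \<in> space (P x) \<Longrightarrow> 0 \<le> t \<Longrightarrow> \<exists>\<epsilon>>0. \<forall>s\<in>{t..<t+\<epsilon>}. X s \<omega> = X t \<omega>"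
  using conjunct1[OF conjunct2[OF conjunct2[OF conjunct2[OF chain_props]]]] by simp

lemma start: "measure (P x) {\<omega> \<in> space (P x). X 0 \<omega> = x} = 1"
  using conjunct1[OF conjunct2[OF conjunct2[OF conjunct2[OF conjunct2[OF chain_props]]]]] by simp

definition tp :: "real \<Rightarrow> 's \<Rightarrow> 's \<Rightarrow> real" where
  "tp t x y = measure (P x) {\<omega> \<in> space (P x). X t \<omega> = y}"

lemma tp_nonneg [simp]: "0 \<le> tp t x y" by (simp add: tp_def)

lemma markov_point:
  assumes "0 \<le> s" "0 \<le> t" "finite T" "T \<subseteq> {0..s}"
  shows "measure (P x) {\<omega> \<in> space (P x). (\<forall>r\<in>T. X r \<omega> = f r) \<and> X s \<omega> = y \<and> X (s + t) \<omega> = z} =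
    measure (P x) {\<omega> \<in> space (P x). (\<forall>r\<in>T. X r \<omega> = f r) \<and> X s \<omega> = y} * tp t y z"
proof -
  have "\<forall>x y z s t T f. 0 \<le> s \<longrightarrow> 0 \<le> t \<longrightarrow> finite T \<longrightarrow> T \<subseteq> {0..s} \<longrightarrow>
        measure (P x) {\<omega> \<in> space (P x). (\<forall>r\<in>T. X r \<omega> = f r) \<and> X s \<omega> = y \<and> X (s + t) \<omega> = z} =
        measure (P x) {\<omega> \<in> space (P x). (\<forall>r\<in>T. X r \<omega> = f r) \<and> X s \<omega> = y} *
        measure (P y) {\<omega> \<in> space (P y). X t \<omega> = z}"
    by (rule conjunct1[OF conjunct2[OF conjunct2[OF conjunct2[OF conjunct2[OF conjunct2[OF chain_props]]]]]])
  from this[rule_format, OF assms(1,2,3,4)] show ?thesis unfolding tp_def .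
qed

lemma generator_limit:
  assumes "bounded (range f)"
  shows "((\<lambda>t. ((\<integral>\<omega>. f (X t \<omega>) \<partial>P x) - f x) / t) \<longlongrightarrow> generator q f x) (at_right 0)"
  using conjunct2[OF conjunct2[OF conjunct2[OF conjunct2[OF conjunct2[OF conjunct2[OF chain_props]]]]]] assms by simp

text \<open>The comparison runs over the whole sample type, not over \<open>space (P x)\<close>, so
  that the notion does not depend on the starting point.\<close>

definition determined :: "real set \<Rightarrow> ('w \<Rightarrow> bool) \<Rightarrow> bool" where
  "determined T A \<longleftrightarrow> (\<forall>\<omega> \<omega>'. (\<forall>r\<in>T. X r \<omega> = X r \<omega>') \<longrightarrow> A \<omega> = A \<omega>')"

text \<open>A countable state space and finitely many times allow only countably many observation
  patterns; those realised inside \<open>A\<close> split it into disjoint cylinders. This carries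
  the Markov property, assumed for cylinders only, over to past events such as never having left a
  set.\<close>

lemma determined_decomp:
  assumes T: "finite T" "T \<subseteq> {0..}" and A: "determined T A"
  obtains I where "countable I"
    "disjoint_family_on (\<lambda>\<phi>. {\<omega> \<in> space (P x). \<forall>r\<in>T. X r \<omega> = \<phi> r}) I"
    "{\<omega> \<in> space (P x). A \<omega>} = (\<Union>\<phi>\<in>I. {\<omega> \<in> space (P x). \<forall>r\<in>T. X r \<omega> = \<phi> r})"
    "\<And>\<phi>. {\<omega> \<in> space (P x). \<forall>r\<in>T. X r \<omega> = \<phi> r} \<in> sets (P x)"
proof -
  define I where "I = (\<lambda>\<omega>. restrict (\<lambda>r. X r \<omega>) T) ` {\<omega> \<in> space (P x). A \<omega>}"
  have IT: "I \<subseteq> PiE T (\<lambda>_. UNIV)" unfolding I_def by auto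
  have 1: "countable I"
    by (rule countable_subset[OF IT]) (intro countable_PiE T uncountable_infinite, auto)
  have 2: "disjoint_family_on (\<lambda>\<phi>. {\<omega> \<in> space (P x). \<forall>r\<in>T. X r \<omega> = \<phi> r}) I"
    unfolding disjoint_family_on_def
  proof (intro ballI impI)
    fix f g assume fg: "f \<in> I" "g \<in> I" "f \<noteq> g"
    then obtain r where "r \<in> T" "f r \<noteq> g r"
      using IT by (metis PiE_ext subsetD)
    then show "{\<omega> \<in> space (P x). \<forall>r\<in>T. X r \<omega> = f r} \<inter> {\<omega> \<in> space (P x). \<forall>r\<in>T. X r \<omega> = g r} = {}"
      by auto
  qed
  have 3: "{\<omega> \<in> space (P x). A \<omega>} = (\<Union>\<phi>\<in>I. {\<omega> \<in> space (P x). \<forall>r\<in>T. X r \<omega> = \<phi> r})"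
  proof (intro equalityI subsetI)
    fix \<omega> assume "\<omega> \<in> {\<omega> \<in> space (P x). A \<omega>}"
    then show "\<omega> \<in> (\<Union>\<phi>\<in>I. {\<omega> \<in> space (P x). \<forall>r\<in>T. X r \<omega> = \<phi> r})"
      unfolding I_def by (intro UN_I[of "restrict (\<lambda>r. X r \<omega>) T"]) auto
  next
    fix \<omega> assume "\<omega> \<in> (\<Union>\<phi>\<in>I. {\<omega> \<in> space (P x). \<forall>r\<in>T. X r \<omega> = \<phi> r})"
    then obtain \<omega>' where w: "\<omega> \<in> space (P x)" "A \<omega>'" "\<forall>r\<in>T. X r \<omega> = X r \<omega>'"
      unfolding I_def by auto
    then have "A \<omega>" using A unfolding determined_def by metis
    with w show "\<omega> \<in> {\<omega> \<in> space (P x). A \<omega>}" by simp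
  qed
  have 4: "{\<omega> \<in> space (P x). \<forall>r\<in>T. X r \<omega> = \<phi> r} \<in> sets (P x)" for \<phi>
    using T by (intro sets.sets_Collect_finite_All X_eq_sets) auto
  show ?thesis using that[OF 1 2 3 4] .
qed

lemma determined_sets:
  assumes T: "finite T" "T \<subseteq> {0..}" and A: "determined T A"
  shows "{\<omega> \<in> space (P x). A \<omega>} \<in> sets (P x)"
proof -
  obtain I where I: "countable I"
    "disjoint_family_on (\<lambda>\<phi>. {\<omega> \<in> space (P x). \<forall>r\<in>T. X r \<omega> = \<phi> r}) I"
    "{\<omega> \<in> space (P x). A \<omega>} = (\<Union>\<phi>\<in>I. {\<omega> \<in> space (P x). \<forall>r\<in>T. X r \<omega> = \<phi> r})"
    "\<And>\<phi>. {\<omega> \<in> space (P x). \<forall>r\<in>T. X r \<omega> = \<phi> r} \<in> sets (P x)"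
    by (rule determined_decomp[OF assms, of x]) (rule that)
  show ?thesis unfolding I(3) by (intro sets.countable_UN' I(1)) (use I(4) in auto)
qed

lemma markov_determined:
  assumes st: "0 \<le> s" "0 \<le> t" and T: "finite T" "T \<subseteq> {0..s}" and A: "determined T A"
  shows "measure (P x) {\<omega> \<in> space (P x). A \<omega> \<and> X s \<omega> = y \<and> X (s + t) \<omega> = z} =
    measure (P x) {\<omega> \<in> space (P x). A \<omega> \<and> X s \<omega> = y} * tp t y z"
proof -
  interpret prob_space "P x" by (rule prob_space_P)
  have T': "T \<subseteq> {0..}" using T by auto
  obtain I where I: "countable I"
    "disjoint_family_on (\<lambda>\<phi>. {\<omega> \<in> space (P x). \<forall>r\<in>T. X r \<omega> = \<phi> r}) I"
    "{\<omega> \<in> space (P x). A \<omega>} = (\<Union>\<phi>\<in>I. {\<omega> \<in> space (P x). \<forall>r\<in>T. X r \<omega> = \<phi> r})"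
    "\<And>\<phi>. {\<omega> \<in> space (P x). \<forall>r\<in>T. X r \<omega> = \<phi> r} \<in> sets (P x)"
    by (rule determined_decomp[OF T(1) T' A, of x]) (rule that)
  have gen: "emeasure (P x) {\<omega> \<in> space (P x). A \<omega> \<and> B \<omega>} =
      (\<integral>\<^sup>+\<phi>. emeasure (P x) {\<omega> \<in> space (P x). (\<forall>r\<in>T. X r \<omega> = \<phi> r) \<and> B \<omega>} \<partial>count_space I)"
    if B: "{\<omega> \<in> space (P x). B \<omega>} \<in> sets (P x)" for B
  proof -
    have eq: "{\<omega> \<in> space (P x). A \<omega> \<and> B \<omega>} =
        (\<Union>\<phi>\<in>I. {\<omega> \<in> space (P x). (\<forall>r\<in>T. X r \<omega> = \<phi> r) \<and> B \<omega>})"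
      using I(3) by blast
    have m: "{\<omega> \<in> space (P x). (\<forall>r\<in>T. X r \<omega> = \<phi> r) \<and> B \<omega>} \<in> sets (P x)" for \<phi>
      using sets.Int[OF I(4)[of \<phi>] B] by (simp add: Collect_conj_eq[symmetric] Int_def conj_ac)
    show ?thesis unfolding eq
    proof (rule emeasure_UN_countable[OF m I(1)])
      show "disjoint_family_on (\<lambda>\<phi>. {\<omega> \<in> space (P x). (\<forall>r\<in>T. X r \<omega> = \<phi> r) \<and> B \<omega>}) I"
        using I(2) unfolding disjoint_family_on_def by blast
    qed
  qed
  have ms: "{\<omega> \<in> space (P x). X s \<omega> = y} \<in> sets (P x)" "{\<omega> \<in> space (P x). X (s+t) \<omega> = z} \<in> sets (P x)"
    using st by (auto intro: X_eq_sets)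
  have "{\<omega> \<in> space (P x). X s \<omega> = y \<and> X (s+t) \<omega> = z} =
     {\<omega> \<in> space (P x). X s \<omega> = y} \<inter> {\<omega> \<in> space (P x). X (s+t) \<omega> = z}" by auto
  then have ms2: "{\<omega> \<in> space (P x). X s \<omega> = y \<and> X (s+t) \<omega> = z} \<in> sets (P x)"
    using sets.Int[OF ms] by simp
  have "emeasure (P x) {\<omega> \<in> space (P x). A \<omega> \<and> X s \<omega> = y \<and> X (s + t) \<omega> = z} =
     (\<integral>\<^sup>+\<phi>. emeasure (P x) {\<omega> \<in> space (P x). (\<forall>r\<in>T. X r \<omega> = \<phi> r) \<and> X s \<omega> = y \<and> X (s + t) \<omega> = z} \<partial>count_space I)"
    by (rule gen[OF ms2])
  also have "\<dots> = (\<integral>\<^sup>+\<phi>. emeasure (P x) {\<omega> \<in> space (P x). (\<forall>r\<in>T. X r \<omega> = \<phi> r) \<and> X s \<omega> = y} * ennreal (tp t y z) \<partial>count_space I)"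
    by (simp add: emeasure_eq_measure markov_point[OF st T] ennreal_mult')
  also have "\<dots> = (\<integral>\<^sup>+\<phi>. emeasure (P x) {\<omega> \<in> space (P x). (\<forall>r\<in>T. X r \<omega> = \<phi> r) \<and> X s \<omega> = y} \<partial>count_space I) * ennreal (tp t y z)"
    by (rule nn_integral_multc) simp
  also have "\<dots> = emeasure (P x) {\<omega> \<in> space (P x). A \<omega> \<and> X s \<omega> = y} * ennreal (tp t y z)"
    by (subst gen[OF ms(1)]) simp
  finally show ?thesis
    by (simp add: emeasure_eq_measure ennreal_mult'[symmetric])
qed

abbreviation grid_times :: "nat \<Rightarrow> real \<Rightarrow> real set" where
  "grid_times n h \<equiv> (\<lambda>k. real k * h) ` {..n}"

lemma grid_times: "0 \<le> h \<Longrightarrow> finite (grid_times n h) \<and> grid_times n h \<subseteq> {0..real n * h} \<and> grid_times n h \<subseteq> {0..}"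
  by (auto intro!: mult_right_mono)

lemma grid_times_mem: "k \<le> n \<Longrightarrow> real k * h \<in> grid_times n h"
  by (rule imageI) simp

lemma grid_sets:
  assumes "0 \<le> h" "determined (grid_times n h) A"
  shows "{\<omega> \<in> space (P x). A \<omega>} \<in> sets (P x)"
  using determined_sets[OF _ _ assms(2)] grid_times[OF assms(1), of n] by blast

lemma grid_markov:
  assumes h: "0 \<le> h" and A: "determined (grid_times n h) A"
  shows "measure (P x) {\<omega> \<in> space (P x). A \<omega> \<and> X (real n * h) \<omega> = y \<and> X (real (Suc n) * h) \<omega> = z} =
    measure (P x) {\<omega> \<in> space (P x). A \<omega> \<and> X (real n * h) \<omega> = y} * tp h y z"
proof -
  have eq: "real n * h + h = real (Suc n) * h" by (simp add: algebra_simps)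
  show ?thesis
    using markov_determined[of "real n * h" h "grid_times n h" A x y z] grid_times[OF h, of n] h A
    unfolding eq by auto
qed

lemma grid_markov_finite:
  assumes h: "0 \<le> h" and A: "determined (grid_times n h) A" and S: "finite S"
  shows "measure (P x) {\<omega> \<in> space (P x). A \<omega> \<and> X (real n * h) \<omega> \<in> S \<and> X (real (Suc n) * h) \<omega> = z} =
    (\<Sum>y\<in>S. measure (P x) {\<omega> \<in> space (P x). A \<omega> \<and> X (real n * h) \<omega> = y} * tp h y z)"
proof -
  interpret prob_space "P x" by (rule prob_space_P)
  have eq: "{\<omega> \<in> space (P x). A \<omega> \<and> X (real n * h) \<omega> \<in> S \<and> X (real (Suc n) * h) \<omega> = z} =
      (\<Union>y\<in>S. {\<omega> \<in> space (P x). A \<omega> \<and> X (real n * h) \<omega> = y \<and> X (real (Suc n) * h) \<omega> = z})" by auto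
  have m: "{\<omega> \<in> space (P x). A \<omega> \<and> X (real n * h) \<omega> = y \<and> X (real (Suc n) * h) \<omega> = z} \<in> sets (P x)" for y
  proof (rule grid_sets[OF h, of "Suc n"])
    show "determined (grid_times (Suc n) h) (\<lambda>\<omega>. A \<omega> \<and> X (real n * h) \<omega> = y \<and> X (real (Suc n) * h) \<omega> = z)"
      unfolding determined_def
    proof (intro allI impI)
      fix \<omega> \<omega>' assume *: "\<forall>r\<in>grid_times (Suc n) h. X r \<omega> = X r \<omega>'"
      then have "A \<omega> = A \<omega>'" using A unfolding determined_def by auto
      moreover have "X (real n * h) \<omega> = X (real n * h) \<omega>'" "X (real (Suc n) * h) \<omega> = X (real (Suc n) * h) \<omega>'"
        by (rule bspec[OF * grid_times_mem], simp)+
      ultimately show "(A \<omega> \<and> X (real n * h) \<omega> = y \<and> X (real (Suc n) * h) \<omega> = z) =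
         (A \<omega>' \<and> X (real n * h) \<omega>' = y \<and> X (real (Suc n) * h) \<omega>' = z)" by simp
    qed
  qed
  show ?thesis unfolding eq
    by (subst finite_measure_finite_Union[OF S])
      (auto simp: m disjoint_family_on_def grid_markov[OF h A] simp del: of_nat_Suc)
qed

lemma determinedI:
  "(\<And>\<omega> \<omega>'. (\<And>r. r \<in> T \<Longrightarrow> X r \<omega> = X r \<omega>') \<Longrightarrow> A \<omega> = A \<omega>') \<Longrightarrow> determined T A"
  unfolding determined_def by blast

text \<open>For \<open>x\<close> and \<open>z\<close> in \<open>S\<close> this is an entry of the
  \<open>n\<close>-th power of the matrix \<open>tp h\<close> restricted to \<open>S\<close>; what
  happens between grid times is not watched.\<close>

definition grid_stay :: "nat \<Rightarrow> real \<Rightarrow> 's set \<Rightarrow> 's \<Rightarrow> 's \<Rightarrow> real" where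
  "grid_stay n h S x z =
     measure (P x) {\<omega> \<in> space (P x). (\<forall>k\<le>n. X (real k * h) \<omega> \<in> S) \<and> X (real n * h) \<omega> = z}"

lemma determined_stay: "determined (grid_times n h) (\<lambda>\<omega>. \<forall>k\<le>n. X (real k * h) \<omega> \<in> S)"
proof (rule determinedI)
  fix \<omega> \<omega>' assume "\<And>r. r \<in> grid_times n h \<Longrightarrow> X r \<omega> = X r \<omega>'"
  then have "\<And>k. k \<le> n \<Longrightarrow> X (real k * h) \<omega> = X (real k * h) \<omega>'" using grid_times_mem by simp
  then show "(\<forall>k\<le>n. X (real k * h) \<omega> \<in> S) = (\<forall>k\<le>n. X (real k * h) \<omega>' \<in> S)" by simp
qed

lemma grid_stay_nonneg [simp]: "0 \<le> grid_stay n h S x z" by (simp add: grid_stay_def)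

lemma grid_stay_Suc:
  assumes h: "0 \<le> h" and S: "finite S" and z: "z \<in> S"
  shows "grid_stay (Suc n) h S x z = (\<Sum>y\<in>S. grid_stay n h S x y * tp h y z)"
proof -
  have "{\<omega> \<in> space (P x). (\<forall>k\<le>Suc n. X (real k * h) \<omega> \<in> S) \<and> X (real (Suc n) * h) \<omega> = z} =
    {\<omega> \<in> space (P x). (\<forall>k\<le>n. X (real k * h) \<omega> \<in> S) \<and> X (real n * h) \<omega> \<in> S \<and> X (real (Suc n) * h) \<omega> = z}"
    using z by (auto simp: le_Suc_eq simp del: of_nat_Suc)
  then show ?thesis
    unfolding grid_stay_def by (simp only: grid_markov_finite[OF h determined_stay S])
qed

lemma start_event: "measure (P x) {\<omega> \<in> space (P x). A \<omega> \<and> X 0 \<omega> = x} = measure (P x) {\<omega> \<in> space (P x). A \<omega>}"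
  if "{\<omega> \<in> space (P x). A \<omega>} \<in> sets (P x)"
proof -
  interpret prob_space "P x" by (rule prob_space_P)
  have "AE \<omega> in P x. X 0 \<omega> = x"
    using start[of x] by (subst prob_Collect_eq_1[symmetric]) (auto simp: X_eq_sets)
  then show ?thesis
    using that by (intro measure_eq_AE sets.sets_Collect_conj X_eq_sets) auto
qed

lemma start_other: assumes "z \<noteq> x" shows "measure (P x) {\<omega> \<in> space (P x). A \<omega> \<and> X 0 \<omega> = z} = 0"
proof -
  interpret prob_space "P x" by (rule prob_space_P)
  have "AE \<omega> in P x. X 0 \<omega> = x"
    using start[of x] by (subst prob_Collect_eq_1[symmetric]) (auto simp: X_eq_sets)
  then have "AE \<omega> in P x. X 0 \<omega> \<noteq> z" using assms by auto
  then have "prob {\<omega> \<in> space (P x). X 0 \<omega> = z} = 0"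
    by (subst prob_Collect_eq_0) (auto simp: X_eq_sets)
  moreover have "prob {\<omega> \<in> space (P x). A \<omega> \<and> X 0 \<omega> = z} \<le> prob {\<omega> \<in> space (P x). X 0 \<omega> = z}"
    by (rule finite_measure_mono) (auto simp: X_eq_sets)
  ultimately show ?thesis by (simp add: order_antisym)
qed

lemma grid_stay_0:
  assumes "x \<in> S" shows "grid_stay 0 h S x z = (if z = x then 1 else 0)"
proof (cases "z = x")
  case True
  have "{\<omega> \<in> space (P x). (\<forall>k\<le>0. X (real k * h) \<omega> \<in> S) \<and> X (real 0 * h) \<omega> = x} = {\<omega> \<in> space (P x). X 0 \<omega> = x}"
    using assms by auto
  then show ?thesis using True start unfolding grid_stay_def by simp
next
  case False
  then show ?thesis using start_other[OF False, of "\<lambda>\<omega>. \<forall>k\<le>0. X (real k * h) \<omega> \<in> S"]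
    unfolding grid_stay_def by simp
qed

lemma grid_stay_sum:
  assumes h: "0 \<le> h" and S: "finite S"
  shows "(\<Sum>y\<in>S. grid_stay n h S x y) = measure (P x) {\<omega> \<in> space (P x). \<forall>k\<le>n. X (real k * h) \<omega> \<in> S}"
proof -
  interpret prob_space "P x" by (rule prob_space_P)
  have eq: "{\<omega> \<in> space (P x). \<forall>k\<le>n. X (real k * h) \<omega> \<in> S} =
     (\<Union>y\<in>S. {\<omega> \<in> space (P x). (\<forall>k\<le>n. X (real k * h) \<omega> \<in> S) \<and> X (real n * h) \<omega> = y})" by auto
  have m: "{\<omega> \<in> space (P x). (\<forall>k\<le>n. X (real k * h) \<omega> \<in> S) \<and> X (real n * h) \<omega> = y} \<in> sets (P x)" for y
    using h by (intro sets.sets_Collect_conj grid_sets[OF h determined_stay] X_eq_sets) simp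
  show ?thesis unfolding grid_stay_def eq
    by (subst finite_measure_finite_Union[OF S]) (auto simp: m disjoint_family_on_def)
qed

lemma grid_stay_sum_le_1: "0 \<le> h \<Longrightarrow> finite S \<Longrightarrow> (\<Sum>y\<in>S. grid_stay n h S x y) \<le> 1"
  using grid_stay_sum[of h S n x] prob_space.prob_le_1[OF prob_space_P] by simp

lemma expectation_finite_support:
  assumes h: "0 \<le> h" and S: "finite S" "\<And>z. z \<notin> S \<Longrightarrow> g z = 0"
  shows "(\<integral>\<omega>. g (X h \<omega>) \<partial>P y) = (\<Sum>z\<in>S. tp h y z * (g z :: real))"
proof -
  interpret prob_space "P y" by (rule prob_space_P)
  have "(\<integral>\<omega>. g (X h \<omega>) \<partial>P y) = (\<integral>\<omega>. (\<Sum>z\<in>S. indicator {\<omega> \<in> space (P y). X h \<omega> = z} \<omega> * g z) \<partial>P y)"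
  proof (rule Bochner_Integration.integral_cong[OF refl])
    fix \<omega> assume "\<omega> \<in> space (P y)"
    then have "(\<Sum>z\<in>S. indicator {\<omega> \<in> space (P y). X h \<omega> = z} \<omega> * g z) = (\<Sum>z\<in>S. if X h \<omega> = z then g z else 0)"
      by (intro sum.cong) (auto simp: indicator_def)
    also have "\<dots> = g (X h \<omega>)" using S by simp
    finally show "g (X h \<omega>) = (\<Sum>z\<in>S. indicator {\<omega> \<in> space (P y). X h \<omega> = z} \<omega> * g z)" by simp
  qed
  also have "\<dots> = (\<Sum>z\<in>S. tp h y z * g z)"
    using h by (subst Bochner_Integration.integral_sum) (auto simp: X_eq_sets tp_def integrable_indicator_iff emeasure_eq_measure)
  finally show ?thesis .
qed

text \<open>A function of finite support is bounded, so the generator limit applies, and its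
  expectation is a finite sum of transition probabilities: no tail has to be controlled.\<close>

lemma generator_limit_finite:
  assumes S: "finite S" "\<And>z. z \<notin> S \<Longrightarrow> g z = 0"
  shows "((\<lambda>h. ((\<Sum>z\<in>S. tp h y z * g z) - g y) / h) \<longlongrightarrow> generator q g y) (at_right 0)"
proof -
  have "range g \<subseteq> insert 0 (g ` S)" using S(2) by blast
  then have "bounded (range g)" using S(1) by (meson finite_imageI finite_insert finite_imp_bounded finite_subset)
  note lim = generator_limit[OF this, of y]
  have ev: "eventually (\<lambda>h. ((\<integral>\<omega>. g (X h \<omega>) \<partial>P y) - g y) / h = ((\<Sum>z\<in>S. tp h y z * g z) - g y) / h) (at_right 0)"
    using eventually_at_right_less[of "0::real"] by eventually_elim (simp add: expectation_finite_support S)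
  show ?thesis by (rule Lim_transform_eventually[OF lim ev])
qed

lemma grid_functional_Suc:
  assumes h: "0 \<le> h" and S: "finite S"
  shows "(\<Sum>z\<in>S. grid_stay (Suc n) h S x z * g z) = (\<Sum>y\<in>S. grid_stay n h S x y * (\<Sum>z\<in>S. tp h y z * g z))"
proof -
  have "(\<Sum>z\<in>S. grid_stay (Suc n) h S x z * g z) = (\<Sum>z\<in>S. \<Sum>y\<in>S. grid_stay n h S x y * tp h y z * g z)"
    by (intro sum.cong refl) (simp add: grid_stay_Suc[OF h S] sum_distrib_right)
  also have "\<dots> = (\<Sum>y\<in>S. \<Sum>z\<in>S. grid_stay n h S x y * tp h y z * g z)" by (rule sum.swap)
  finally show ?thesis by (simp add: sum_distrib_left mult.assoc)
qed

lemma grid_functional_0: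
  assumes "finite S" "x \<in> S"
  shows "(\<Sum>z\<in>S. grid_stay 0 h S x z * g z) = g x"
proof -
  have "(\<Sum>z\<in>S. grid_stay 0 h S x z * g z) = (\<Sum>z\<in>S. if z = x then g z else 0)"
    by (intro sum.cong) (auto simp: grid_stay_0[OF assms(2)])
  then show ?thesis using assms by simp
qed

text \<open>Iterates a one-step inequality. The factor \<open>a\<close> must be nonnegative, whereas
  \<open>g\<close> may have either sign.\<close>

lemma grid_functional_ge:
  assumes h: "0 \<le> h" and S: "finite S" "x \<in> S" and a: "0 \<le> a"
    and step: "\<And>y. y \<in> S \<Longrightarrow> a * g y \<le> (\<Sum>z\<in>S. tp h y z * g z)"
  shows "a ^ n * g x \<le> (\<Sum>z\<in>S. grid_stay n h S x z * g z)"
proof (induction n)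
  case 0 show ?case using grid_functional_0[OF S, of h g] by simp
next
  case (Suc n)
  have "a ^ Suc n * g x \<le> a * (\<Sum>z\<in>S. grid_stay n h S x z * g z)"
    using mult_left_mono[OF Suc a] by (simp add: mult_ac)
  also have "\<dots> = (\<Sum>y\<in>S. grid_stay n h S x y * (a * g y))" by (simp add: sum_distrib_left mult_ac)
  also have "\<dots> \<le> (\<Sum>y\<in>S. grid_stay n h S x y * (\<Sum>z\<in>S. tp h y z * g z))"
    by (intro sum_mono mult_left_mono step) auto
  finally show ?case unfolding grid_functional_Suc[OF h S(1)] .
qed

text \<open>Each step loses at most \<open>b\<close> times the mass still in \<open>S\<close>, which
  is at most 1.\<close>

lemma grid_functional_ge_additive:
  assumes h: "0 \<le> h" and S: "finite S" "x \<in> S" and b: "0 \<le> b"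
    and step: "\<And>y. y \<in> S \<Longrightarrow> g y - b \<le> (\<Sum>z\<in>S. tp h y z * g z)"
  shows "g x - real n * b \<le> (\<Sum>z\<in>S. grid_stay n h S x z * g z)"
proof (induction n)
  case 0 show ?case using grid_functional_0[OF S, of h g] by simp
next
  case (Suc n)
  have "(\<Sum>y\<in>S. grid_stay n h S x y * b) \<le> b"
    using mult_right_mono[OF grid_stay_sum_le_1[OF h S(1), of n x] b] by (simp add: sum_distrib_right)
  then have "g x - real (Suc n) * b \<le> (\<Sum>y\<in>S. grid_stay n h S x y * (g y - b))"
    using Suc by (simp add: algebra_simps sum_subtractf)
  also have "\<dots> \<le> (\<Sum>y\<in>S. grid_stay n h S x y * (\<Sum>z\<in>S. tp h y z * g z))"
    by (intro sum_mono mult_left_mono step) auto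
  finally show ?case unfolding grid_functional_Suc[OF h S(1)] .
qed

end

section \<open>From dyadic grids to continuous time\<close>

lemma dyadic_between:
  fixes s t u :: real
  assumes s: "0 \<le> s" "s \<le> t" and u: "s < u" and t: "0 < t"
  shows "\<exists>J. \<forall>j\<ge>J. \<exists>k\<le>2^j. s \<le> real k * (t / 2^j) \<and> real k * (t / 2^j) < u"
proof -
  obtain J where J: "t / (u - s) < 2 ^ J" using real_arch_pow[of 2] by auto
  show ?thesis
  proof (rule exI[of _ J], intro allI impI)
    fix j assume "J \<le> j"
    then have "(2::real)^J \<le> 2^j" by simp
    with J have lt: "t / (u - s) < 2 ^ j" by linarith
    define d where "d = t / 2^j"
    have d: "0 < d" "d < u - s" using t u lt by (auto simp: d_def field_simps)
    \<comment> \<open>The first grid index at or after \<open>s\<close>. It does not exceed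
      \<open>2^j\<close> because \<open>s \<le> t\<close>, and its grid point overshoots
      \<open>s\<close> by less than one mesh width.\<close>
    define k where "k = nat \<lceil>s / d\<rceil>"
    have sd: "0 \<le> s / d" using s d by simp
    then have nn: "0 \<le> \<lceil>s / d\<rceil>" by linarith
    from sd have k: "s / d \<le> real k" "real k < s / d + 1" unfolding k_def using nn by linarith+
    have "s / d \<le> 2^j" using s(2) t by (simp add: d_def field_simps)
    then have "\<lceil>s / d\<rceil> \<le> 2^j" by (metis ceiling_le_iff of_int_numeral of_int_power)
    then have "k \<le> 2^j" unfolding k_def using nn by (simp add: nat_le_iff)
    moreover have "s \<le> real k * d" using k(1) d by (simp add: field_simps)
    moreover have "real k * d < u"
    proof -
      have "real k * d < (s / d + 1) * d" using k(2) d by (intro mult_strict_right_mono)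
      also have "\<dots> = s + d" using d by (simp add: field_simps)
      finally show ?thesis using d by linarith
    qed
    ultimately show "\<exists>k\<le>2^j. s \<le> real k * (t / 2^j) \<and> real k * (t / 2^j) < u" unfolding d_def by blast
  qed
qed

context rates_chain begin

definition stay :: "'s set \<Rightarrow> real \<Rightarrow> 's \<Rightarrow> 's \<Rightarrow> real" where
  "stay S t x z = measure (P x) {\<omega> \<in> space (P x). X t \<omega> = z \<and> (\<forall>s\<in>{0..t}. X s \<omega> \<in> S)}"

lemma stay_nonneg [simp]: "0 \<le> stay S t x z" by (simp add: stay_def)

text \<open>A path outside \<open>S\<close> at time \<open>s\<close> keeps its state on a short
  interval to the right, and fine dyadic grids meet that interval inside \<open>{0..t}\<close>; for
  \<open>s = t\<close> the grid point is \<open>t\<close> itself.\<close>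

lemma stay_iff_dyadic:
  assumes w: "\<omega> \<in> space (P x)" and t: "0 < t"
  shows "(\<forall>s\<in>{0..t}. X s \<omega> \<in> S) \<longleftrightarrow> (\<forall>j. \<forall>k\<le>2^j. X (real k * (t / 2^j)) \<omega> \<in> S)"
proof
  assume *: "\<forall>s\<in>{0..t}. X s \<omega> \<in> S"
  show "\<forall>j. \<forall>k\<le>2^j. X (real k * (t / 2^j)) \<omega> \<in> S"
  proof (intro allI impI)
    fix j k :: nat assume "k \<le> 2^j"
    then have "real k \<le> 2^j" by (metis of_nat_le_iff of_nat_numeral of_nat_power)
    then have "real k * t \<le> 2^j * t" using t by (intro mult_right_mono) auto
    then have "real k * (t / 2^j) \<in> {0..t}" using t by (simp add: field_simps)
    with * show "X (real k * (t / 2^j)) \<omega> \<in> S" by blast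
  qed
next
  assume *: "\<forall>j. \<forall>k\<le>2^j. X (real k * (t / 2^j)) \<omega> \<in> S"
  show "\<forall>s\<in>{0..t}. X s \<omega> \<in> S"
  proof
    fix s assume s: "s \<in> {0..t}"
    then obtain e where e: "e > 0" "\<forall>r\<in>{s..<s+e}. X r \<omega> = X s \<omega>" using right_cont[OF w, of s] by auto
    obtain J where J: "\<forall>j\<ge>J. \<exists>k\<le>2^j. s \<le> real k * (t / 2^j) \<and> real k * (t / 2^j) < s + e"
      using dyadic_between[of s t "s+e"] s e t by auto
    then obtain k where "k \<le> 2^J" "s \<le> real k * (t / 2^J)" "real k * (t / 2^J) < s + e" by blast
    then show "X s \<omega> \<in> S" using * e(2) by (metis atLeastLessThan_iff)
  qed
qed

text \<open>The grid of level \<open>j\<close> consists of the even-indexed points of the grid of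
  level \<open>Suc j\<close>.\<close>

lemma dyadic_stay_decseq:
  "decseq (\<lambda>j. {\<omega> \<in> space (P x). (\<forall>k\<le>2^j. X (real k * (t / 2^j)) \<omega> \<in> S) \<and> B \<omega>})"
proof (rule decseq_SucI, rule subsetI)
  fix j \<omega> assume "\<omega> \<in> {\<omega> \<in> space (P x). (\<forall>k\<le>2^Suc j. X (real k * (t / 2^Suc j)) \<omega> \<in> S) \<and> B \<omega>}"
  then have w: "\<omega> \<in> space (P x)" "B \<omega>" "\<forall>k\<le>2^Suc j. X (real k * (t / 2^Suc j)) \<omega> \<in> S" by auto
  have "X (real k * (t / 2^j)) \<omega> \<in> S" if "k \<le> 2^j" for k
  proof -
    have "real (2 * k) * (t / 2^Suc j) = real k * (t / 2^j)" by simp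
    then show ?thesis using w(3)[rule_format, of "2*k"] that by simp
  qed
  with w show "\<omega> \<in> {\<omega> \<in> space (P x). (\<forall>k\<le>2^j. X (real k * (t / 2^j)) \<omega> \<in> S) \<and> B \<omega>}" by simp
qed

lemma dyadic_stay_sets:
  "0 < t \<Longrightarrow> {\<omega> \<in> space (P x). (\<forall>k\<le>2^j. X (real k * (t / 2^j)) \<omega> \<in> S) \<and> X t \<omega> = z} \<in> sets (P x)"
  using grid_sets[OF _ determined_stay, of "t / 2^j" x "2^j" S]
  by (intro sets.sets_Collect_conj X_eq_sets) auto

lemma stay_event:
  assumes t: "0 < t"
  shows "{\<omega> \<in> space (P x). X t \<omega> = z \<and> (\<forall>s\<in>{0..t}. X s \<omega> \<in> S)} =
    (\<Inter>j. {\<omega> \<in> space (P x). (\<forall>k\<le>2^j. X (real k * (t / 2^j)) \<omega> \<in> S) \<and> X t \<omega> = z})"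
proof -
  have "\<omega> \<in> {\<omega> \<in> space (P x). X t \<omega> = z \<and> (\<forall>s\<in>{0..t}. X s \<omega> \<in> S)} \<longleftrightarrow>
      \<omega> \<in> (\<Inter>j. {\<omega> \<in> space (P x). (\<forall>k\<le>2^j. X (real k * (t / 2^j)) \<omega> \<in> S) \<and> X t \<omega> = z})" for \<omega>
    unfolding INT_iff mem_Collect_eq using stay_iff_dyadic[of \<omega> x t S, OF _ t] by (cases "\<omega> \<in> space (P x)") (simp_all add: conj_commute)
  then show ?thesis by (rule set_eqI)
qed

lemma stay_sets:
  assumes t: "0 < t"
  shows "{\<omega> \<in> space (P x). X t \<omega> = z \<and> (\<forall>s\<in>{0..t}. X s \<omega> \<in> S)} \<in> sets (P x)"
  unfolding stay_event[OF t] by (rule sets.countable_INT, rule image_subsetI, rule dyadic_stay_sets[OF t], simp)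

lemma grid_stay_limit:
  assumes t: "0 < t"
  shows "(\<lambda>j. grid_stay (2^j) (t / 2^j) S x z) \<longlonglongrightarrow> stay S t x z"
proof -
  interpret prob_space "P x" by (rule prob_space_P)
  have "(\<lambda>j. prob {\<omega> \<in> space (P x). (\<forall>k\<le>2^j. X (real k * (t / 2^j)) \<omega> \<in> S) \<and> X t \<omega> = z}) \<longlonglongrightarrow>
      prob (\<Inter>j. {\<omega> \<in> space (P x). (\<forall>k\<le>2^j. X (real k * (t / 2^j)) \<omega> \<in> S) \<and> X t \<omega> = z})"
    by (rule finite_Lim_measure_decseq[OF _ dyadic_stay_decseq], rule image_subsetI, rule dyadic_stay_sets[OF t])
  then show ?thesis unfolding stay_def stay_event[OF t] grid_stay_def by simp
qed

lemma stay_sum_le_1: "0 < t \<Longrightarrow> finite S \<Longrightarrow> (\<Sum>z\<in>S. stay S t x z) \<le> 1"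
  by (rule LIMSEQ_le_const2[OF tendsto_sum[OF grid_stay_limit]]) (auto intro!: grid_stay_sum_le_1)

lemma dyadic_mesh: "0 < t \<Longrightarrow> filterlim (\<lambda>j. t / 2^j) (at_right (0::real)) sequentially"
  by (rule tendsto_imp_filterlim_at_right[OF LIMSEQ_divide_realpow_zero]) auto

lemma dyadic_exp: "(\<lambda>j. (1 + c * (t / 2^j)) ^ 2^j) \<longlonglongrightarrow> exp (c * t :: real)"
proof -
  have "filterlim (\<lambda>j. 2^j :: nat) at_top sequentially"
    by (rule filterlim_subseq) (simp add: strict_mono_def)
  from filterlim_compose[OF tendsto_exp_limit_sequentially[of "c * t"] this]
  show ?thesis by simp
qed

text \<open>The hypothesis is strict so that the difference quotients, which merely converge to the
  generator, eventually exceed \<open>A y\<close>; finiteness of \<open>S\<close> gives one mesh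
  that serves all \<open>y\<close>.\<close>

lemma eventually_dyadic_step:
  assumes S: "finite S" and t: "0 < t" and g: "\<And>z. z \<notin> S \<Longrightarrow> g z = 0"
    and gen: "\<And>y. y \<in> S \<Longrightarrow> A y < generator q g y"
  shows "eventually (\<lambda>j. \<forall>y\<in>S. g y + A y * (t / 2^j) \<le> (\<Sum>z\<in>S. tp (t / 2^j) y z * g z)) sequentially"
proof -
  have "eventually (\<lambda>h. A y < ((\<Sum>z\<in>S. tp h y z * g z) - g y) / h) (at_right 0)" if "y \<in> S" for y
  proof (rule order_tendstoD(1)[OF _ gen[OF that]])
    show "((\<lambda>h. ((\<Sum>z\<in>S. tp h y z * g z) - g y) / h) \<longlongrightarrow> generator q g y) (at_right 0)"
      by (rule generator_limit_finite[OF S]) (rule g)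
  qed
  then have "eventually (\<lambda>h. 0 < h \<and> (\<forall>y\<in>S. A y < ((\<Sum>z\<in>S. tp h y z * g z) - g y) / h)) (at_right 0)"
    using eventually_at_right_less[of "0::real"] S by (auto simp: eventually_conj_iff eventually_ball_finite_distrib)
  from eventually_compose_filterlim[OF this dyadic_mesh[OF t]] show ?thesis
  proof eventually_elim
    case (elim j)
    show ?case
    proof
      fix y assume y: "y \<in> S"
      define h where "h = t / 2^j"
      have h: "0 < h" "A y < ((\<Sum>z\<in>S. tp h y z * g z) - g y) / h" using elim y unfolding h_def by auto
      show "g y + A y * (t / 2^j) \<le> (\<Sum>z\<in>S. tp (t / 2^j) y z * g z)"
        using h(2) unfolding h_def[symmetric] pos_less_divide_eq[OF h(1)] by simp
    qed
  qed
qed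

text \<open>The one-step factors \<open>1 + \<rho> * h\<close> multiply up to
  \<open>exp (\<rho> * t)\<close>. No sign of \<open>g\<close> is assumed, which lets the same
  estimate be applied to a negated function for the upper bound.\<close>

lemma stay_functional_strict:
  assumes S: "finite S" "x \<in> S" and t: "0 < t" and g: "\<And>z. z \<notin> S \<Longrightarrow> g z = 0"
    and gen: "\<And>y. y \<in> S \<Longrightarrow> \<rho> * g y < generator q g y"
  shows "exp (\<rho> * t) * g x \<le> (\<Sum>z\<in>S. stay S t x z * g z)"
proof (rule LIMSEQ_le)
  show "(\<lambda>j. (1 + \<rho> * (t / 2^j)) ^ 2^j * g x) \<longlonglongrightarrow> exp (\<rho> * t) * g x"
    by (intro tendsto_mult_right dyadic_exp)
  show "(\<lambda>j. \<Sum>z\<in>S. grid_stay (2^j) (t / 2^j) S x z * g z) \<longlonglongrightarrow> (\<Sum>z\<in>S. stay S t x z * g z)"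
    by (intro tendsto_sum tendsto_mult_right grid_stay_limit t)
  \<comment> \<open>For negative \<open>\<rho>\<close> the factor \<open>1 + \<rho> * h\<close> is
    positive only once the grid is fine enough.\<close>
  have "((\<lambda>h. 1 + \<rho> * h) \<longlongrightarrow> 1 + \<rho> * 0) (at_right 0)" by (intro tendsto_intros)
  from order_tendstoD(1)[OF this, of 0] have "eventually (\<lambda>h. 0 < 1 + \<rho> * h) (at_right 0)" by simp
  from eventually_compose_filterlim[OF this dyadic_mesh[OF t]]
  have "eventually (\<lambda>j. 0 < 1 + \<rho> * (t / 2^j)) sequentially" .
  moreover have "eventually (\<lambda>j. \<forall>y\<in>S. g y + \<rho> * g y * (t / 2^j) \<le> (\<Sum>z\<in>S. tp (t / 2^j) y z * g z)) sequentially"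
    by (rule eventually_dyadic_step[where A = "\<lambda>y. \<rho> * g y"]) (use S t g gen in auto)
  ultimately have "eventually (\<lambda>j. 0 < 1 + \<rho> * (t / 2^j) \<and>
      (\<forall>y\<in>S. g y + \<rho> * g y * (t / 2^j) \<le> (\<Sum>z\<in>S. tp (t / 2^j) y z * g z))) sequentially"
    by (rule eventually_conj)
  then
  have "eventually (\<lambda>j. (1 + \<rho> * (t / 2^j)) ^ 2^j * g x \<le> (\<Sum>z\<in>S. grid_stay (2^j) (t / 2^j) S x z * g z)) sequentially"
  proof eventually_elim
    case (elim j)
    show ?case
    proof (rule grid_functional_ge[OF _ S])
      fix y assume "y \<in> S"
      with elim have "g y + \<rho> * g y * (t / 2^j) \<le> (\<Sum>z\<in>S. tp (t / 2^j) y z * g z)" by blast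
      then show "(1 + \<rho> * (t / 2^j)) * g y \<le> (\<Sum>z\<in>S. tp (t / 2^j) y z * g z)" by (simp add: algebra_simps)
    qed (use elim t in auto)
  qed
  then show "\<exists>N. \<forall>j\<ge>N. (1 + \<rho> * (t / 2^j)) ^ 2^j * g x \<le> (\<Sum>z\<in>S. grid_stay (2^j) (t / 2^j) S x z * g z)"
    by (simp add: eventually_sequentially)
qed

text \<open>Lowering \<open>\<rho>\<close> by \<open>\<epsilon>\<close> makes the inequality strict
  because \<open>g\<close> is positive on \<open>S\<close>; then \<open>\<epsilon>\<close> tends to
  0.\<close>

lemma stay_functional_ge:
  assumes S: "finite S" "x \<in> S" and t: "0 < t"
    and g: "\<And>z. z \<in> S \<Longrightarrow> 0 < g z" "\<And>z. z \<notin> S \<Longrightarrow> g z = 0"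
    and gen: "\<And>y. y \<in> S \<Longrightarrow> \<rho> * g y \<le> generator q g y"
  shows "exp (\<rho> * t) * g x \<le> (\<Sum>z\<in>S. stay S t x z * g z)"
proof -
  have main: "exp ((\<rho> - \<epsilon>) * t) * g x \<le> (\<Sum>z\<in>S. stay S t x z * g z)" if e: "0 < \<epsilon>" for \<epsilon>
  proof (rule stay_functional_strict[OF S t])
    show "(\<rho> - \<epsilon>) * g y < generator q g y" if "y \<in> S" for y
      using gen[OF that] mult_pos_pos[OF e g(1)[OF that]] by (simp add: left_diff_distrib)
  qed (rule g(2))
  have "((\<lambda>\<epsilon>. exp ((\<rho> - \<epsilon>) * t) * g x) \<longlongrightarrow> exp ((\<rho> - 0) * t) * g x) (at_right 0)" by (intro tendsto_intros)
  then have "exp ((\<rho> - 0) * t) * g x \<le> (\<Sum>z\<in>S. stay S t x z * g z)"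
    by (rule tendsto_upperbound) (use main eventually_at_right_less[of "0::real"] in \<open>auto elim: eventually_mono\<close>)
  then show ?thesis by simp
qed

lemma stay_functional_le:
  assumes S: "finite S" "x \<in> S" and t: "0 < t"
    and g: "\<And>z. z \<in> S \<Longrightarrow> 0 < g z" "\<And>z. z \<notin> S \<Longrightarrow> g z = 0"
    and gen: "\<And>y. y \<in> S \<Longrightarrow> generator q g y \<le> \<rho> * g y"
  shows "(\<Sum>z\<in>S. stay S t x z * g z) \<le> exp (\<rho> * t) * g x"
proof -
  have neg: "generator q (\<lambda>y. - g y) y = - generator q g y" for y
    unfolding generator_def infsum_uminus[symmetric] by (simp add: algebra_simps)
  have main: "(\<Sum>z\<in>S. stay S t x z * g z) \<le> exp ((\<rho> + \<epsilon>) * t) * g x" if e: "0 < \<epsilon>" for \<epsilon>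
  proof -
    have "exp ((\<rho> + \<epsilon>) * t) * (- g x) \<le> (\<Sum>z\<in>S. stay S t x z * (- g z))"
    proof (rule stay_functional_strict[OF S t])
      show "(\<rho> + \<epsilon>) * (- g y) < generator q (\<lambda>y. - g y) y" if "y \<in> S" for y
        using gen[OF that] mult_pos_pos[OF e g(1)[OF that]] unfolding neg by (simp add: distrib_right)
    qed (use g in simp)
    then show ?thesis by (simp add: sum_negf)
  qed
  have "((\<lambda>\<epsilon>. exp ((\<rho> + \<epsilon>) * t) * g x) \<longlongrightarrow> exp ((\<rho> + 0) * t) * g x) (at_right 0)" by (intro tendsto_intros)
  then have "(\<Sum>z\<in>S. stay S t x z * g z) \<le> exp ((\<rho> + 0) * t) * g x"
    by (rule tendsto_lowerbound) (use main eventually_at_right_less[of "0::real"] in \<open>auto elim: eventually_mono\<close>)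
  then show ?thesis by simp
qed

text \<open>\<open>hitting_time\<close> is an infimum, so avoiding \<open>K\<close> up to and
  including \<open>t\<close> must also rule out entrances immediately after \<open>t\<close>;
  right-continuity provides the margin.\<close>

lemma hitting_time_gt_iff:
  assumes w: "\<omega> \<in> space (P x)" and t: "0 \<le> t"
  shows "hitting_time X K \<omega> > ennreal t \<longleftrightarrow> (\<forall>s\<in>{0..t}. X s \<omega> \<in> - K)"
proof
  assume h: "hitting_time X K \<omega> > ennreal t"
  show "\<forall>s\<in>{0..t}. X s \<omega> \<in> - K"
  proof (intro ballI ComplI)
    fix s assume s: "s \<in> {0..t}" "X s \<omega> \<in> K"
    then have "hitting_time X K \<omega> \<le> ennreal s" unfolding hitting_time_def by (intro Inf_lower) auto
    also have "\<dots> \<le> ennreal t" using s by (intro ennreal_leI) auto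
    finally show False using h by simp
  qed
next
  assume *: "\<forall>s\<in>{0..t}. X s \<omega> \<in> - K"
  obtain e where e: "e > 0" "\<forall>r\<in>{t..<t+e}. X r \<omega> = X t \<omega>" using right_cont[OF w t] by auto
  have "ennreal (t + e) \<le> hitting_time X K \<omega>" unfolding hitting_time_def
  proof (intro Inf_greatest, clarify)
    fix s assume s: "0 \<le> s" "X s \<omega> \<in> K"
    have "\<not> s < t + e"
    proof
      assume "s < t + e"
      show False
      proof (cases "s \<le> t")
        case True
        then show False using bspec[OF *, of s] s by simp
      next
        case False
        then have "X s \<omega> = X t \<omega>" using bspec[OF e(2), of s] \<open>s < t + e\<close> by simp
        then show False using bspec[OF *, of t] s(2) t by simp
      qed
    qed
    then show "ennreal (t + e) \<le> ennreal s" by (intro ennreal_leI) simp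
  qed
  moreover have "ennreal t < ennreal (t + e)" using e t by (simp add: ennreal_less_iff)
  ultimately show "hitting_time X K \<omega> > ennreal t" by (rule less_le_trans[rotated])
qed

lemma killed_eq_stay:
  assumes t: "0 \<le> t"
  shows "measure (P x) {\<omega> \<in> space (P x). X t \<omega> = y \<and> hitting_time X K \<omega> > ennreal t} = stay (- K) t x y"
proof -
  have "{\<omega> \<in> space (P x). X t \<omega> = y \<and> hitting_time X K \<omega> > ennreal t} =
      {\<omega> \<in> space (P x). X t \<omega> = y \<and> (\<forall>s\<in>{0..t}. X s \<omega> \<in> - K)}"
    by (intro Collect_cong conj_cong refl hitting_time_gt_iff[OF _ t])
  then show ?thesis by (simp only: stay_def)
qed

lemma stay_sets':
  assumes t: "0 \<le> t"
  shows "{\<omega> \<in> space (P x). X t \<omega> = z \<and> (\<forall>s\<in>{0..t}. X s \<omega> \<in> S)} \<in> sets (P x)"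
proof (cases "t = 0")
  case True
  have "{\<omega> \<in> space (P x). X t \<omega> = z \<and> (\<forall>s\<in>{0..t}. X s \<omega> \<in> S)} = {\<omega> \<in> space (P x). X 0 \<omega> \<in> {z} \<inter> S}"
    using True by auto
  then show ?thesis by (simp only: X_sets[OF order_refl])
next
  case False
  then show ?thesis using t stay_sets[of t] by simp
qed

lemma stay_le_1: "stay S t x z \<le> 1"
  unfolding stay_def by (rule prob_space.prob_le_1[OF prob_space_P])

lemma stay_mono:
  assumes "0 \<le> t" "S \<subseteq> S'" shows "stay S t x z \<le> stay S' t x z"
proof -
  interpret prob_space "P x" by (rule prob_space_P)
  show ?thesis unfolding stay_def
    using assms(2) by (intro finite_measure_mono stay_sets' assms(1)) blast
qed

lemma stay_UNIV: "stay UNIV t x z = tp t x z"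
  by (simp add: stay_def tp_def)

lemma stay_sum_eq:
  assumes t: "0 \<le> t" and S: "finite S"
  shows "(\<Sum>z\<in>S. stay S t x z) = measure (P x) {\<omega> \<in> space (P x). \<forall>s\<in>{0..t}. X s \<omega> \<in> S}"
    and "{\<omega> \<in> space (P x). \<forall>s\<in>{0..t}. X s \<omega> \<in> S} \<in> sets (P x)"
proof -
  interpret prob_space "P x" by (rule prob_space_P)
  have eq: "{\<omega> \<in> space (P x). \<forall>s\<in>{0..t}. X s \<omega> \<in> S} =
      (\<Union>z\<in>S. {\<omega> \<in> space (P x). X t \<omega> = z \<and> (\<forall>s\<in>{0..t}. X s \<omega> \<in> S)})" using t by auto
  show "{\<omega> \<in> space (P x). \<forall>s\<in>{0..t}. X s \<omega> \<in> S} \<in> sets (P x)"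
    unfolding eq by (intro sets.finite_UN S stay_sets'[OF t])
  show "(\<Sum>z\<in>S. stay S t x z) = measure (P x) {\<omega> \<in> space (P x). \<forall>s\<in>{0..t}. X s \<omega> \<in> S}"
    unfolding eq stay_def
  proof (rule finite_measure_finite_Union[symmetric, OF S])
    show "(\<lambda>z. {\<omega> \<in> space (P x). X t \<omega> = z \<and> (\<forall>s\<in>{0..t}. X s \<omega> \<in> S)}) ` S \<subseteq> events"
      by (rule image_subsetI) (rule stay_sets'[OF t])
    show "disjoint_family_on (\<lambda>z. {\<omega> \<in> space (P x). X t \<omega> = z \<and> (\<forall>s\<in>{0..t}. X s \<omega> \<in> S)}) S"
      unfolding disjoint_family_on_def by blast
  qed
qed

text \<open>A path that stays in \<open>D\<close> either stays in \<open>S \<inter> D\<close> or has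
  left \<open>S\<close> by time \<open>t\<close>.\<close>

lemma stay_le_stay_finite:
  assumes t: "0 \<le> t" and S: "finite S"
  shows "stay D t x y \<le> stay (S \<inter> D) t x y + (1 - (\<Sum>z\<in>S. stay S t x z))"
proof -
  interpret prob_space "P x" by (rule prob_space_P)
  let ?S = "{\<omega> \<in> space (P x). \<forall>s\<in>{0..t}. X s \<omega> \<in> S}"
  let ?A = "{\<omega> \<in> space (P x). X t \<omega> = y \<and> (\<forall>s\<in>{0..t}. X s \<omega> \<in> S \<inter> D)}"
  have m: "?S \<in> sets (P x)" "?A \<in> sets (P x)"
    using stay_sum_eq(2)[OF t S, of x] stay_sets'[OF t, of x y "S \<inter> D"] by simp_all
  have sub: "{\<omega> \<in> space (P x). X t \<omega> = y \<and> (\<forall>s\<in>{0..t}. X s \<omega> \<in> D)} \<subseteq> ?A \<union> (space (P x) - ?S)"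
    by blast
  have "stay D t x y \<le> prob (?A \<union> (space (P x) - ?S))"
    unfolding stay_def by (rule finite_measure_mono[OF sub]) (use m in auto)
  also have "\<dots> \<le> prob ?A + prob (space (P x) - ?S)" by (rule measure_Un_le) (use m in auto)
  also have "prob (space (P x) - ?S) = 1 - prob ?S" by (rule prob_compl[OF m(1)])
  finally show ?thesis unfolding stay_def[of "S \<inter> D"] stay_sum_eq(1)[OF t S] .
qed

section \<open>Non-explosion and upper bounds from supersolutions\<close>

lemma stay_functional_ge_additive:
  assumes S: "finite S" "x \<in> S" and t: "0 < t" and c: "0 \<le> c"
    and g: "\<And>z. z \<notin> S \<Longrightarrow> g z = 0"
    and gen: "\<And>y. y \<in> S \<Longrightarrow> - c \<le> generator q g y"
  shows "g x - c * t \<le> (\<Sum>z\<in>S. stay S t x z * g z)"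
proof -
  have main: "g x - (c + \<epsilon>) * t \<le> (\<Sum>z\<in>S. stay S t x z * g z)" if e: "0 < \<epsilon>" for \<epsilon>
  proof (rule LIMSEQ_le_const)
    show "(\<lambda>j. \<Sum>z\<in>S. grid_stay (2^j) (t / 2^j) S x z * g z) \<longlonglongrightarrow> (\<Sum>z\<in>S. stay S t x z * g z)"
      by (intro tendsto_sum tendsto_mult_right grid_stay_limit t)
    have "- (c + \<epsilon>) < generator q g y" if "y \<in> S" for y using gen[OF that] e by simp
    then have "eventually (\<lambda>j. \<forall>y\<in>S. g y + - (c + \<epsilon>) * (t / 2^j) \<le> (\<Sum>z\<in>S. tp (t / 2^j) y z * g z)) sequentially"
      by (intro eventually_dyadic_step S t g)
    then have "eventually (\<lambda>j. g x - (c + \<epsilon>) * t \<le> (\<Sum>z\<in>S. grid_stay (2^j) (t / 2^j) S x z * g z)) sequentially"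
    proof eventually_elim
      case (elim j)
      have "g x - real (2^j) * ((c + \<epsilon>) * (t / 2^j)) \<le> (\<Sum>z\<in>S. grid_stay (2^j) (t / 2^j) S x z * g z)"
      proof (rule grid_functional_ge_additive[OF _ S])
        fix y assume "y \<in> S"
        then have "g y + - (c + \<epsilon>) * (t / 2^j) \<le> (\<Sum>z\<in>S. tp (t / 2^j) y z * g z)" by (rule bspec[OF elim])
        then show "g y - (c + \<epsilon>) * (t / 2^j) \<le> (\<Sum>z\<in>S. tp (t / 2^j) y z * g z)"
          by (simp only: mult_minus_left add_uminus_conv_diff)
      qed (use t c e in auto)
      then show ?case by simp
    qed
    then show "\<exists>N. \<forall>j\<ge>N. g x - (c + \<epsilon>) * t \<le> (\<Sum>z\<in>S. grid_stay (2^j) (t / 2^j) S x z * g z)"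
      by (simp add: eventually_sequentially)
  qed
  have "((\<lambda>\<epsilon>. g x - (c + \<epsilon>) * t) \<longlongrightarrow> g x - (c + 0) * t) (at_right 0)" by (intro tendsto_intros)
  then have "g x - (c + 0) * t \<le> (\<Sum>z\<in>S. stay S t x z * g z)"
    by (rule tendsto_upperbound) (use main eventually_at_right_less[of "0::real"] in \<open>auto elim: eventually_mono\<close>)
  then show ?thesis by simp
qed

text \<open>The last clause is non-explosion, phrased without exit times. Right-continuity of the
  paths does not imply it, since jump times may accumulate from the left.\<close>

definition exhausting :: "(nat \<Rightarrow> 's set) \<Rightarrow> bool" where
  "exhausting S \<longleftrightarrow> (\<forall>N. finite (S N)) \<and> (\<forall>x. eventually (\<lambda>N. x \<in> S N) sequentially) \<and>
     (\<forall>x t. 0 < t \<longrightarrow> (\<lambda>N. \<Sum>z\<in>S N. stay (S N) t x z) \<longlonglongrightarrow> 1)"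

text \<open>\<open>g N\<close> is at most 1, vanishes off \<open>S N\<close> and decreases at rate
  at most \<open>c N\<close>. So the mass still in \<open>S N\<close> is at least
  \<open>g N z - c N * t\<close> for the starting point \<open>z\<close>, which tends to 1.\<close>

lemma exhaustingI:
  assumes S: "\<And>N. finite (S N)" and x: "\<And>x. eventually (\<lambda>N. x \<in> S N) sequentially"
    and g: "\<And>N z. z \<notin> S N \<Longrightarrow> g N z = 0" "\<And>N z. g N z \<le> 1" "\<And>z. (\<lambda>N. g N z) \<longlonglongrightarrow> 1"
    and c: "\<And>N. 0 \<le> c N" "c \<longlonglongrightarrow> 0"
    and gen: "\<And>N y. y \<in> S N \<Longrightarrow> - c N \<le> generator q (g N) y"
  shows "exhausting S"
  unfolding exhausting_def
proof (intro conjI allI impI S x)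
  fix z :: 's and t :: real assume t: "0 < t"
  show "(\<lambda>N. \<Sum>y\<in>S N. stay (S N) t z y) \<longlonglongrightarrow> 1"
  proof (rule tendsto_sandwich)
    have "(\<lambda>N. g N z - c N * t) \<longlonglongrightarrow> 1 - 0 * t" by (intro tendsto_intros g c)
    then show "(\<lambda>N. g N z - c N * t) \<longlonglongrightarrow> 1" by simp
    show "(\<lambda>N. 1) \<longlonglongrightarrow> (1::real)" by simp
    show "eventually (\<lambda>N. (\<Sum>y\<in>S N. stay (S N) t z y) \<le> 1) sequentially"
      using stay_sum_le_1[OF t S] by simp
    show "eventually (\<lambda>N. g N z - c N * t \<le> (\<Sum>y\<in>S N. stay (S N) t z y)) sequentially"
      using x[of z]
    proof eventually_elim
      case (elim N)
      have "g N z - c N * t \<le> (\<Sum>y\<in>S N. stay (S N) t z y * g N y)"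
        by (rule stay_functional_ge_additive[OF S elim t c(1)]) (use g gen in auto)
      also have "\<dots> \<le> (\<Sum>y\<in>S N. stay (S N) t z y)"
        by (intro sum_mono mult_left_le g) simp
      finally show ?case .
    qed
  qed
qed

text \<open>\<open>f\<close> may be unbounded, so it is cut off to the finite set
  \<open>S N \<inter> D\<close>. The finite comparison bounds the mass at \<open>y\<close> there,
  and what is missed is at most the probability of leaving \<open>S N\<close>, which vanishes as
  \<open>N\<close> grows.\<close>

lemma stay_le_supersolution:
  assumes S: "exhausting S" and t: "0 < t" and x: "x \<in> D" and y: "y \<in> D"
    and f: "\<And>z. z \<in> D \<Longrightarrow> 0 < f z"
    and gen: "\<And>N z. z \<in> S N \<inter> D \<Longrightarrow> generator q (\<lambda>w. if w \<in> S N \<inter> D then f w else 0) z \<le> \<rho> * f z"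
  shows "stay D t x y \<le> exp (\<rho> * t) * f x / f y"
proof (rule LIMSEQ_le_const)
  have fin: "finite (S N)" for N using S by (simp add: exhausting_def)
  show "(\<lambda>N. exp (\<rho> * t) * f x / f y + (1 - (\<Sum>z\<in>S N. stay (S N) t x z))) \<longlonglongrightarrow> exp (\<rho> * t) * f x / f y"
    using S t unfolding exhausting_def by (auto intro!: tendsto_eq_intros)
  have "eventually (\<lambda>N. x \<in> S N \<and> y \<in> S N) sequentially"
    using S by (simp add: exhausting_def eventually_conj_iff)
  then have "eventually (\<lambda>N. stay D t x y \<le> exp (\<rho> * t) * f x / f y + (1 - (\<Sum>z\<in>S N. stay (S N) t x z))) sequentially"
  proof eventually_elim
    case (elim N)
    let ?g = "\<lambda>w. if w \<in> S N \<inter> D then f w else 0"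
    have "stay (S N \<inter> D) t x y * f y = stay (S N \<inter> D) t x y * ?g y" using elim y by simp
    also have "\<dots> \<le> (\<Sum>z\<in>S N \<inter> D. stay (S N \<inter> D) t x z * ?g z)"
      using elim y fin[of N] f by (intro member_le_sum) (auto intro!: mult_nonneg_nonneg intro: less_imp_le)
    also have "\<dots> \<le> exp (\<rho> * t) * ?g x"
      by (rule stay_functional_le[OF _ _ t]) (use elim x fin[of N] f gen in auto)
    also have "\<dots> = exp (\<rho> * t) * f x" using elim x by simp
    finally have "stay (S N \<inter> D) t x y \<le> exp (\<rho> * t) * f x / f y"
      using f[OF y] by (simp add: field_simps)
    then show ?case using stay_le_stay_finite[OF less_imp_le[OF t] fin[of N], of D x y] by simp
  qed
  then show "\<exists>M. \<forall>N\<ge>M. stay D t x y \<le> exp (\<rho> * t) * f x / f y + (1 - (\<Sum>z\<in>S N. stay (S N) t x z))"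
    by (simp add: eventually_sequentially)
qed

section \<open>Time integrals and bounds for the spectral radii\<close>

lemma stay_right_continuous:
  assumes t: "0 \<le> t" and s: "\<And>n. t \<le> s n" "s \<longlonglongrightarrow> t"
  shows "(\<lambda>n. stay S (s n) x z) \<longlonglongrightarrow> stay S t x z"
proof -
  interpret prob_space "P x" by (rule prob_space_P)
  let ?E = "\<lambda>u. {\<omega> \<in> space (P x). X u \<omega> = z \<and> (\<forall>r\<in>{0..u}. X r \<omega> \<in> S)}"
  have s0: "0 \<le> s n" for n using t s(1)[of n] by simp
  have m: "?E t \<in> events" "\<And>n. ?E (s n) \<in> events" by (rule stay_sets'[OF t], rule stay_sets'[OF s0])
  have "(\<lambda>n. \<integral>\<omega>. indicat_real (?E (s n)) \<omega> \<partial>P x) \<longlonglongrightarrow> (\<integral>\<omega>. indicat_real (?E t) \<omega> \<partial>P x)"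
  proof (rule integral_dominated_convergence[where w = "\<lambda>_. 1"])
    show "indicat_real (?E t) \<in> borel_measurable (P x)" using m by (intro borel_measurable_indicator)
    show "\<And>n. indicat_real (?E (s n)) \<in> borel_measurable (P x)" using m by (intro borel_measurable_indicator)
    show "AE \<omega> in P x. (\<lambda>n. indicat_real (?E (s n)) \<omega>) \<longlonglongrightarrow> indicat_real (?E t) \<omega>"
    proof (intro AE_I2)
      fix \<omega> assume w: "\<omega> \<in> space (P x)"
      obtain e where e: "e > 0" "\<forall>r\<in>{t..<t+e}. X r \<omega> = X t \<omega>" using right_cont[OF w t] by auto
      have "eventually (\<lambda>n. s n < t + e) sequentially" using s(2) e(1) by (intro order_tendstoD(2)[of s t]) auto
      then have "eventually (\<lambda>n. indicat_real (?E (s n)) \<omega> = indicat_real (?E t) \<omega>) sequentially"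
      proof eventually_elim
        case (elim n)
        have Xs: "X r \<omega> = X t \<omega>" if "t \<le> r" "r \<le> s n" for r using bspec[OF e(2), of r] elim that by simp
        have 1: "X (s n) \<omega> = X t \<omega>" using Xs[OF s(1)] by simp
        have 2: "(\<forall>r\<in>{0..s n}. X r \<omega> \<in> S) \<longleftrightarrow> (\<forall>r\<in>{0..t}. X r \<omega> \<in> S)"
        proof
          assume a: "\<forall>r\<in>{0..s n}. X r \<omega> \<in> S"
          show "\<forall>r\<in>{0..t}. X r \<omega> \<in> S"
          proof
            fix r assume "r \<in> {0..t}"
            then show "X r \<omega> \<in> S" using bspec[OF a, of r] s(1)[of n] by simp
          qed
        next
          assume a: "\<forall>r\<in>{0..t}. X r \<omega> \<in> S"
          show "\<forall>r\<in>{0..s n}. X r \<omega> \<in> S"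
          proof
            fix r assume "r \<in> {0..s n}"
            then show "X r \<omega> \<in> S" using bspec[OF a, of r] bspec[OF a, of t] Xs[of r] t by (cases "r \<le> t") simp_all
          qed
        qed
        have "\<omega> \<in> ?E (s n) \<longleftrightarrow> \<omega> \<in> ?E t" unfolding mem_Collect_eq 1 2 ..
        then show ?case unfolding indicator_def by (simp only:)
      qed
      then show "(\<lambda>n. indicat_real (?E (s n)) \<omega>) \<longlonglongrightarrow> indicat_real (?E t) \<omega>" by (rule tendsto_eventually)
    qed
  qed (auto simp: indicator_def)
  then show ?thesis unfolding stay_def using m by simp
qed

text \<open>By right-continuity \<open>stay\<close> is a limit of step functions in
  \<open>t\<close>. Measurability is needed to exchange a finite sum with the time integral.\<close>

lemma stay_measurable: "(\<lambda>t. stay S t x z * indicator {0..} t) \<in> borel_measurable borel"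
proof (rule borel_measurable_LIMSEQ_real)
  \<comment> \<open>Rounding down and adding one step lands to the right of \<open>t\<close>, the
    side on which continuity is known.\<close>
  define s where "s n t = (real_of_int \<lfloor>t * real (Suc n)\<rfloor> + 1) / real (Suc n)" for n and t :: real
  show "(\<lambda>n. stay S (s n t) x z * indicator {0..} t) \<longlonglongrightarrow> stay S t x z * indicator {0..} t" for t
  proof (cases "0 \<le> t")
    case True
    have a: "t \<le> s n t" for n
    proof -
      have "t * real (Suc n) \<le> real_of_int \<lfloor>t * real (Suc n)\<rfloor> + 1" by linarith
      then show ?thesis unfolding s_def by (simp add: pos_le_divide_eq del: of_nat_Suc)
    qed
    have b: "s n t \<le> t + inverse (real (Suc n))" for n
    proof -
      have "real_of_int \<lfloor>t * real (Suc n)\<rfloor> + 1 \<le> t * real (Suc n) + 1" by linarith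
      then show ?thesis unfolding s_def by (simp add: pos_divide_le_eq distrib_right del: of_nat_Suc)
    qed
    have "(\<lambda>n. t + inverse (real (Suc n))) \<longlonglongrightarrow> t + 0" by (intro tendsto_intros LIMSEQ_inverse_real_of_nat)
    then have "(\<lambda>n. s n t) \<longlonglongrightarrow> t"
      using a b by (intro tendsto_sandwich[of "\<lambda>_. t" "\<lambda>n. s n t" _ "\<lambda>n. t + inverse (real (Suc n))"]) auto
    from stay_right_continuous[OF True a this] show ?thesis using True by simp
  qed simp
  show "(\<lambda>t. stay S (s n t) x z * indicator {0..} t) \<in> borel_measurable borel" for n
  proof -
    have "(\<lambda>k::int. stay S ((real_of_int k + 1) / real (Suc n)) x z) \<in> borel_measurable (count_space UNIV)" by simp
    moreover have "(\<lambda>t. \<lfloor>t * real (Suc n)\<rfloor>) \<in> borel \<rightarrow>\<^sub>M count_space UNIV"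
      by (intro measurable_compose[OF _ measurable_real_floor]) simp
    ultimately have "(\<lambda>t. stay S (s n t) x z) \<in> borel_measurable borel"
      unfolding s_def by (rule measurable_compose[rotated])
    then show ?thesis by simp
  qed
qed

end

lemma nn_integral_exp_decay:
  assumes c: "c < 0" and C: "0 \<le> C"
  shows "(\<integral>\<^sup>+t\<in>{0..}. ennreal (C * exp (c * t)) \<partial>lborel) < \<infinity>"
proof -
  have "(\<integral>\<^sup>+t. ennreal (C * exp (c * t)) * indicator {0..} t \<partial>lborel) = ennreal (0 - C / c * exp (c * 0))"
  proof (rule nn_integral_FTC_atLeast)
    show "((\<lambda>t. C / c * exp (c * t)) has_real_derivative C * exp (c * t)) (at t)" for t
      using c by (auto intro!: derivative_eq_intros)
    have "filterlim (\<lambda>t. c * t) at_bot at_top"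
      using c by (simp add: filterlim_tendsto_neg_mult_at_bot[OF tendsto_const] filterlim_ident)
    then have "((\<lambda>t. exp (c * t)) \<longlongrightarrow> 0) at_top" by (rule filterlim_compose[OF exp_at_bot])
    from tendsto_mult_right_zero[OF this, of "C / c"] show "((\<lambda>t. C / c * exp (c * t)) \<longlongrightarrow> 0) at_top" .
  qed (use C in auto)
  then show ?thesis by simp
qed

lemma nn_integral_const_infinite:
  assumes c: "0 < c" shows "(\<integral>\<^sup>+t\<in>{0::real..}. ennreal c \<partial>lborel) = \<infinity>"
proof -
  have le: "ennreal (c * real n) \<le> (\<integral>\<^sup>+t\<in>{0::real..}. ennreal c \<partial>lborel)" for n
  proof -
    have "ennreal (c * real n) = ennreal c * emeasure lborel {0..real n}" using c by (simp add: ennreal_mult)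
    also have "\<dots> = (\<integral>\<^sup>+t. ennreal c * indicator {0..real n} t \<partial>lborel)"
      by (rule nn_integral_cmult_indicator[symmetric]) simp
    also have "\<dots> \<le> (\<integral>\<^sup>+t\<in>{0::real..}. ennreal c \<partial>lborel)"
      by (intro nn_integral_mono) (auto simp: indicator_def)
    finally show ?thesis .
  qed
  show ?thesis
  proof (cases "\<integral>\<^sup>+t\<in>{0::real..}. ennreal c \<partial>lborel" rule: ennreal_cases)
    case (real v)
    obtain n where "v < real n * c" using reals_Archimedean3[OF c] by blast
    moreover have "c * real n \<le> v" using le[of n] real by simp
    ultimately show ?thesis by (simp add: mult.commute)
  qed simp
qed

context rates_chain begin

text \<open>The bound is assumed for positive times only; at time 0 the trivial bound 1 is absorbed
  by replacing \<open>C\<close> with \<open>C + 1\<close>.\<close>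

lemma set_stay_integral_finite:
  assumes r: "exp \<rho> < r" and C: "0 \<le> C" and b: "\<And>t. 0 < t \<Longrightarrow> stay D t x y \<le> C * exp (\<rho> * t)"
  shows "(\<integral>\<^sup>+t\<in>{0..}. ennreal (r powr (- t) * stay D t x y) \<partial>lborel) < \<infinity>"
proof -
  have r0: "0 < r" using r exp_gt_zero[of \<rho>] by linarith
  have c: "\<rho> - ln r < 0" using r r0 by (metis diff_less_0_iff_less exp_less_cancel_iff exp_ln)
  have "(\<integral>\<^sup>+t\<in>{0..}. ennreal (r powr (- t) * stay D t x y) \<partial>lborel) \<le>
      (\<integral>\<^sup>+t\<in>{0..}. ennreal ((C + 1) * exp ((\<rho> - ln r) * t)) \<partial>lborel)"
  proof (intro nn_integral_mono)
    fix t :: real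
    show "ennreal (r powr (- t) * stay D t x y) * indicator {0..} t \<le> ennreal ((C + 1) * exp ((\<rho> - ln r) * t)) * indicator {0..} t"
    proof (cases "0 \<le> t")
      case True
      have pw: "r powr (- t) = exp (- ln r * t)" using r0 by (simp add: powr_def mult.commute)
      have "stay D t x y \<le> (C + 1) * exp (\<rho> * t)"
      proof (cases "t = 0")
        case True then show ?thesis using stay_le_1[of D 0 x y] C by simp
      next
        case False
        have "C * exp (\<rho> * t) \<le> (C + 1) * exp (\<rho> * t)" by (intro mult_right_mono) auto
        moreover have "stay D t x y \<le> C * exp (\<rho> * t)" using b[of t] True False by simp
        ultimately show ?thesis by (rule order_trans[rotated])
      qed
      then have "r powr (- t) * stay D t x y \<le> exp (- ln r * t) * ((C + 1) * exp (\<rho> * t))"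
        unfolding pw by (intro mult_left_mono) auto
      also have "\<dots> = (C + 1) * exp ((\<rho> - ln r) * t)" by (simp add: left_diff_distrib exp_diff exp_minus field_simps)
      finally show ?thesis using True by (simp add: ennreal_leI)
    qed simp
  qed
  also have "\<dots> < \<infinity>" by (rule nn_integral_exp_decay) (use c C in auto)
  finally show ?thesis .
qed

lemma essential_set_eq:
  "essential_spectral_radius_chain P X = Inf {r. r > 0 \<and> (\<exists>K. finite K \<and>
     (\<forall>x\<in>- K. \<forall>y\<in>- K. (\<integral>\<^sup>+t\<in>{0..}. ennreal (r powr (- t) * stay (- K) t x y) \<partial>lborel) < \<infinity>))}"
proof -
  have "(\<integral>\<^sup>+t\<in>{0..}. ennreal (r powr (- t) * measure (P x) {\<omega> \<in> space (P x). X t \<omega> = y \<and> hitting_time X K \<omega> > ennreal t}) \<partial>lborel)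
      = (\<integral>\<^sup>+t\<in>{0..}. ennreal (r powr (- t) * stay (- K) t x y) \<partial>lborel)" for r x y K
    by (intro nn_integral_cong) (simp add: killed_eq_stay indicator_def)
  then show ?thesis unfolding essential_spectral_radius_chain_def by simp
qed

lemma spectral_set_eq:
  "spectral_radius_chain P X = Inf {r. r > 0 \<and>
     (\<forall>x y. (\<integral>\<^sup>+t\<in>{0..}. ennreal (r powr (- t) * stay UNIV t x y) \<partial>lborel) < \<infinity>)}"
  unfolding spectral_radius_chain_def stay_UNIV tp_def ..

lemma essential_spectral_radius_le:
  assumes S: "exhausting S" and K: "finite K"
    and f: "\<And>z. z \<notin> K \<Longrightarrow> 0 < f z"
    and gen: "\<And>N z. z \<in> S N - K \<Longrightarrow> generator q (\<lambda>w. if w \<in> S N - K then f w else 0) z \<le> \<rho> * f z"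
  shows "essential_spectral_radius_chain P X \<le> exp \<rho>"
proof (rule field_le_epsilon)
  fix e :: real assume e: "0 < e"
  show "essential_spectral_radius_chain P X \<le> exp \<rho> + e"
    unfolding essential_set_eq
  proof (rule cInf_lower, rule CollectI, intro conjI exI[of _ K] ballI K)
    show "0 < exp \<rho> + e" using e by (simp add: add_pos_pos)
    fix x y assume xy: "x \<in> - K" "y \<in> - K"
    show "(\<integral>\<^sup>+t\<in>{0..}. ennreal ((exp \<rho> + e) powr (- t) * stay (- K) t x y) \<partial>lborel) < \<infinity>"
    proof (rule set_stay_integral_finite[where \<rho> = \<rho> and C = "f x / f y"])
      show "stay (- K) t x y \<le> f x / f y * exp (\<rho> * t)" if t: "0 < t" for t
        using stay_le_supersolution[OF S t xy, of f \<rho>] f gen by (simp add: Diff_eq mult.commute)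
      show "0 \<le> f x / f y" using f[of x] f[of y] xy by simp
    qed (use e in simp)
  qed (auto intro!: bdd_belowI[of _ 0])
qed

text \<open>Taking \<open>K = {}\<close> shows that every rate admissible for the spectral radius is
  admissible for the essential one. Comparing the infima needs the smaller set to be nonempty, and
  the supersolution supplies elements of it; hence both conclusions from the same
  hypotheses.\<close>

lemma spectral_radius_le:
  assumes S: "exhausting S"
    and f: "\<And>z. 0 < f z"
    and gen: "\<And>N z. z \<in> S N \<Longrightarrow> generator q (\<lambda>w. if w \<in> S N then f w else 0) z \<le> \<rho> * f z"
  shows "spectral_radius_chain P X \<le> exp \<rho>"
    and "essential_spectral_radius_chain P X \<le> spectral_radius_chain P X"
proof -
  let ?A = "{r. r > 0 \<and> (\<forall>x y. (\<integral>\<^sup>+t\<in>{0..}. ennreal (r powr (- t) * stay UNIV t x y) \<partial>lborel) < \<infinity>)}"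
  have mem: "exp \<rho> + e \<in> ?A" if e: "0 < e" for e
  proof (rule CollectI, intro conjI allI)
    show "0 < exp \<rho> + e" using e by (simp add: add_pos_pos)
    fix x y
    show "(\<integral>\<^sup>+t\<in>{0..}. ennreal ((exp \<rho> + e) powr (- t) * stay UNIV t x y) \<partial>lborel) < \<infinity>"
    proof (rule set_stay_integral_finite[where \<rho> = \<rho> and C = "f x / f y"])
      show "stay UNIV t x y \<le> f x / f y * exp (\<rho> * t)" if t: "0 < t" for t
        using stay_le_supersolution[OF S t UNIV_I UNIV_I, of f \<rho>] f gen by (simp add: mult.commute)
      show "0 \<le> f x / f y" using f[of x] f[of y] by simp
    qed (use e in simp)
  qed
  show "spectral_radius_chain P X \<le> exp \<rho>"
  proof (rule field_le_epsilon)
    fix e :: real assume "0 < e"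
    moreover have "bdd_below ?A" by (auto intro!: bdd_belowI[of _ 0])
    ultimately show "spectral_radius_chain P X \<le> exp \<rho> + e"
      unfolding spectral_set_eq by (intro cInf_lower mem)
  qed
  show "essential_spectral_radius_chain P X \<le> spectral_radius_chain P X"
    unfolding spectral_set_eq essential_set_eq
  proof (rule cInf_superset_mono)
    show "?A \<noteq> {}" using mem[of 1] by auto
  qed (auto intro!: bdd_belowI[of _ 0] exI[of _ "{}"])
qed

text \<open>A subsolution on \<open>S\<close> forces the total mass of the process confined to
  \<open>S\<close> to be at least a constant times \<open>exp (\<rho> * t)\<close>. If
  \<open>r < exp \<rho>\<close>, the weighted sum over the finitely many end points then has an
  infinite integral, although each summand should have a finite one.\<close>

lemma essential_spectral_radius_ge:
  assumes sub: "\<And>K. finite K \<Longrightarrow> \<exists>S g. finite S \<and> S \<noteq> {} \<and> S \<inter> K = {} \<and> (\<forall>z\<in>S. 0 < g z) \<and> (\<forall>z. z \<notin> S \<longrightarrow> g z = 0) \<and>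
      (\<forall>z\<in>S. \<rho> * g z \<le> generator q g z)"
  shows "exp \<rho> \<le> essential_spectral_radius_chain P X"
  unfolding essential_set_eq
proof (rule cInf_greatest)
  show "{r. r > 0 \<and> (\<exists>K. finite K \<and>
     (\<forall>x\<in>- K. \<forall>y\<in>- K. (\<integral>\<^sup>+t\<in>{0..}. ennreal (r powr (- t) * stay (- K) t x y) \<partial>lborel) < \<infinity>))} \<noteq> {}"
  proof -
    have "(\<integral>\<^sup>+t\<in>{0..}. ennreal (2 powr (- t) * stay (- {}) t x y) \<partial>lborel) < \<infinity>" for x y
      by (rule set_stay_integral_finite[where \<rho> = 0 and C = 1]) (auto simp: stay_le_1)
    then show ?thesis by (intro ex_in_conv[THEN iffD1] exI[of _ 2] CollectI conjI exI[of _ "{}"] ballI) auto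
  qed
  fix r assume "r \<in> {r. r > 0 \<and> (\<exists>K. finite K \<and>
     (\<forall>x\<in>- K. \<forall>y\<in>- K. (\<integral>\<^sup>+t\<in>{0..}. ennreal (r powr (- t) * stay (- K) t x y) \<partial>lborel) < \<infinity>))}"
  then obtain K where r: "r > 0" and K: "finite K"
    and fin: "\<And>x y. x \<notin> K \<Longrightarrow> y \<notin> K \<Longrightarrow> (\<integral>\<^sup>+t\<in>{0..}. ennreal (r powr (- t) * stay (- K) t x y) \<partial>lborel) < \<infinity>"
    by auto
  obtain S g where S: "finite S" "S \<noteq> {}" "S \<inter> K = {}" and g: "\<And>z. z \<in> S \<Longrightarrow> 0 < g z" "\<And>z. z \<notin> S \<Longrightarrow> g z = 0"
    and gen: "\<And>z. z \<in> S \<Longrightarrow> \<rho> * g z \<le> generator q g z"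
    using sub[OF K] by blast
  obtain x where x: "x \<in> S" using S by auto
  define M where "M = (\<Sum>z\<in>S. g z)"
  have gM: "g z \<le> M" if "z \<in> S" for z unfolding M_def using that S g by (intro member_le_sum) (auto intro: less_imp_le)
  have M: "0 < M" using g(1)[OF x] gM[OF x] by linarith
  show "exp \<rho> \<le> r"
  proof (rule ccontr)
    assume "\<not> exp \<rho> \<le> r"
    then have lr: "ln r \<le> \<rho>" using r by (metis exp_le_cancel_iff exp_ln linear)
    \<comment> \<open>The constant \<open>g x / M\<close> comes from \<open>g \<le> M\<close> on
      \<open>S\<close>. Time 0 is left out because the comparison is stated for positive
      times.\<close>
    have low: "ennreal (g x / M) * indicator {0<..} t \<le>
       (\<Sum>y\<in>S. ennreal (r powr (- t) * (stay S t x y * indicator {0..} t)))" for t :: real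
    proof (cases "0 < t")
      case True
      have "exp (\<rho> * t) * g x \<le> (\<Sum>z\<in>S. stay S t x z * g z)"
        by (rule stay_functional_ge[OF S(1) x True g gen])
      also have "\<dots> \<le> (\<Sum>z\<in>S. stay S t x z * M)" by (intro sum_mono mult_left_mono gM) auto
      finally have "exp (\<rho> * t) * (g x / M) \<le> (\<Sum>z\<in>S. stay S t x z)"
        using M by (simp add: field_simps sum_distrib_left[symmetric])
      then have "r powr (- t) * (exp (\<rho> * t) * (g x / M)) \<le> r powr (- t) * (\<Sum>z\<in>S. stay S t x z)"
        by (intro mult_left_mono) auto
      moreover have "g x / M \<le> r powr (- t) * (exp (\<rho> * t) * (g x / M))"
      proof -
        have "r powr (- t) * exp (\<rho> * t) = exp ((\<rho> - ln r) * t)"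
          using r by (simp add: powr_def left_diff_distrib exp_diff exp_minus field_simps)
        moreover have "1 \<le> exp ((\<rho> - ln r) * t)" using lr True by simp
        ultimately have "1 * (g x / M) \<le> r powr (- t) * exp (\<rho> * t) * (g x / M)"
          using g(1)[OF x] M by (intro mult_right_mono) auto
        then show ?thesis by (simp add: mult.assoc)
      qed
      ultimately have "g x / M \<le> (\<Sum>z\<in>S. r powr (- t) * (stay S t x z * indicator {0..} t))"
        using True by (simp add: sum_distrib_left)
      then have "ennreal (g x / M) \<le> ennreal (\<Sum>z\<in>S. r powr (- t) * (stay S t x z * indicator {0..} t))"
        by (rule ennreal_leI)
      also have "\<dots> = (\<Sum>y\<in>S. ennreal (r powr (- t) * (stay S t x y * indicator {0..} t)))"
        by (intro sum_ennreal[symmetric]) auto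
      finally show ?thesis using True by simp
    qed simp
    have meas: "(\<lambda>t. ennreal (r powr (- t) * (stay S t x y * indicator {0..} t))) \<in> borel_measurable lborel" for y
      using stay_measurable[of S x y] by measurable
    have "\<infinity> = (\<integral>\<^sup>+t\<in>{0::real..}. ennreal (g x / M) \<partial>lborel)"
      using nn_integral_const_infinite[of "g x / M"] g(1)[OF x] M by simp
    also have "\<dots> = (\<integral>\<^sup>+t\<in>{0::real<..}. ennreal (g x / M) \<partial>lborel)"
      by (intro nn_integral_cong_AE, rule AE_mp[OF AE_lborel_singleton[of 0]]) (auto simp: indicator_def)
    also have "\<dots> \<le> (\<integral>\<^sup>+t. (\<Sum>y\<in>S. ennreal (r powr (- t) * (stay S t x y * indicator {0..} t))) \<partial>lborel)"
      by (intro nn_integral_mono low)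
    also have "\<dots> = (\<Sum>y\<in>S. \<integral>\<^sup>+t. ennreal (r powr (- t) * (stay S t x y * indicator {0..} t)) \<partial>lborel)"
      by (intro nn_integral_sum meas)
    also have "\<dots> \<le> (\<Sum>y\<in>S. \<integral>\<^sup>+t\<in>{0..}. ennreal (r powr (- t) * stay (- K) t x y) \<partial>lborel)"
    proof (intro sum_mono nn_integral_mono)
      fix y t assume "y \<in> S"
      show "ennreal (r powr (- t) * (stay S t x y * indicator {0..} t)) \<le> ennreal (r powr (- t) * stay (- K) t x y) * indicator {0..} t"
        using stay_mono[of t S "- K" x y] S(3) by (cases "0 \<le> t") (auto intro!: ennreal_leI mult_left_mono)
    qed
    also have "\<dots> < \<infinity>" using fin x S by (subst infinity_ennreal_def, subst ennreal_sum_less_top) auto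
    finally show False by simp
  qed
qed

end

section \<open>Positive recurrence and its failure\<close>

context rates_chain begin

text \<open>The mirror image of the estimates for functions: the matrix now acts on measures, and
  the induction peels off the last step.\<close>

lemma grid_stay_subinvariant:
  assumes h: "0 \<le> h" and S: "finite S" and a: "0 \<le> a"
    and step: "\<And>z. z \<in> S \<Longrightarrow> (\<Sum>y\<in>S. \<pi> y * tp h y z) \<le> a * \<pi> z" and z: "z \<in> S"
  shows "(\<Sum>y\<in>S. \<pi> y * grid_stay n h S y z) \<le> a ^ n * \<pi> z"
  using z
proof (induction n arbitrary: z)
  case 0
  have "(\<Sum>y\<in>S. \<pi> y * grid_stay 0 h S y z) = (\<Sum>y\<in>S. if y = z then \<pi> y else 0)"
    by (intro sum.cong) (auto simp: grid_stay_0)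
  then show ?case using 0 S by simp
next
  case (Suc n)
  have "(\<Sum>y\<in>S. \<pi> y * grid_stay (Suc n) h S y z) = (\<Sum>y\<in>S. \<Sum>w\<in>S. \<pi> y * grid_stay n h S y w * tp h w z)"
    by (simp add: grid_stay_Suc[OF h S Suc.prems] sum_distrib_left mult.assoc)
  also have "\<dots> = (\<Sum>w\<in>S. (\<Sum>y\<in>S. \<pi> y * grid_stay n h S y w) * tp h w z)"
    by (subst sum.swap) (simp add: sum_distrib_right)
  also have "\<dots> \<le> (\<Sum>w\<in>S. (a ^ n * \<pi> w) * tp h w z)"
    by (intro sum_mono mult_right_mono Suc.IH) auto
  also have "\<dots> = a ^ n * (\<Sum>w\<in>S. \<pi> w * tp h w z)" by (simp add: sum_distrib_left mult.assoc)
  also have "\<dots> \<le> a ^ n * (a * \<pi> z)" by (intro mult_left_mono step Suc.prems) (use a in auto)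
  finally show ?case by (simp add: mult_ac)
qed

text \<open>Indicators of single states read off the columns of the generator; the hypothesis says
  that \<open>\<pi>\<close> has no net inflow at any state of \<open>S\<close>. The
  \<open>\<epsilon>\<close> serves once more to turn a limit into an inequality valid on fine
  grids.\<close>

lemma stay_subinvariant:
  assumes S: "finite S" "z \<in> S" and t: "0 < t" and p: "\<And>y. y \<in> S \<Longrightarrow> 0 < \<pi> y"
    and gen: "\<And>z. z \<in> S \<Longrightarrow> (\<Sum>y\<in>S. \<pi> y * generator q (\<lambda>w. if w = z then 1 else 0) y) \<le> 0"
  shows "(\<Sum>y\<in>S. \<pi> y * stay S t y z) \<le> \<pi> z"
proof -
  have main: "(\<Sum>y\<in>S. \<pi> y * stay S t y z) \<le> exp (\<epsilon> * t) * \<pi> z" if e: "0 < \<epsilon>" for \<epsilon>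
  proof (rule LIMSEQ_le)
    show "(\<lambda>j. (1 + \<epsilon> * (t / 2^j)) ^ 2^j * \<pi> z) \<longlonglongrightarrow> exp (\<epsilon> * t) * \<pi> z"
      by (intro tendsto_mult_right dyadic_exp)
    show "(\<lambda>j. \<Sum>y\<in>S. \<pi> y * grid_stay (2^j) (t / 2^j) S y z) \<longlonglongrightarrow> (\<Sum>y\<in>S. \<pi> y * stay S t y z)"
      by (intro tendsto_sum tendsto_mult_left grid_stay_limit t)
    have 1: "eventually (\<lambda>h. (\<Sum>y\<in>S. \<pi> y * ((tp h y z - (if y = z then 1 else 0)) / h)) < \<epsilon> * \<pi> z) (at_right 0)" if z: "z \<in> S" for z
    proof (rule order_tendstoD(2)[OF tendsto_sum[OF tendsto_mult_left]])
      show "((\<lambda>h. (tp h y z - (if y = z then 1 else 0)) / h) \<longlongrightarrow> generator q (\<lambda>w. if w = z then 1 else 0) y) (at_right 0)" for y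
        using generator_limit_finite[of "{z}" "\<lambda>w. if w = z then 1 else 0" y] by simp
      show "(\<Sum>y\<in>S. \<pi> y * generator q (\<lambda>w. if w = z then 1 else 0) y) < \<epsilon> * \<pi> z"
        using gen[OF z] mult_pos_pos[OF e p[OF z]] by simp
    qed
    have "eventually (\<lambda>h. 0 < h \<and> (\<forall>z\<in>S. (\<Sum>y\<in>S. \<pi> y * ((tp h y z - (if y = z then 1 else 0)) / h)) < \<epsilon> * \<pi> z)) (at_right 0)"
      using eventually_at_right_less[of "0::real"] 1 S(1) by (auto simp: eventually_conj_iff eventually_ball_finite_distrib)
    from eventually_compose_filterlim[OF this dyadic_mesh[OF t]]
    have "eventually (\<lambda>j. (\<Sum>y\<in>S. \<pi> y * grid_stay (2^j) (t / 2^j) S y z) \<le> (1 + \<epsilon> * (t / 2^j)) ^ 2^j * \<pi> z) sequentially"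
    proof eventually_elim
      case (elim j)
      define h where "h = t / 2^j"
      have h: "0 < h" using t by (simp add: h_def)
      have "(\<Sum>y\<in>S. \<pi> y * grid_stay (2^j) h S y z) \<le> (1 + \<epsilon> * h) ^ 2^j * \<pi> z"
      proof (rule grid_stay_subinvariant[OF _ S(1) _ _ S(2)])
        fix w assume w: "w \<in> S"
        have "(\<Sum>y\<in>S. \<pi> y * ((tp h y w - (if y = w then 1 else 0)) / h)) < \<epsilon> * \<pi> w"
          using elim w unfolding h_def by blast
        moreover have "(\<Sum>y\<in>S. \<pi> y * ((tp h y w - (if y = w then 1 else 0)) / h)) =
            ((\<Sum>y\<in>S. \<pi> y * tp h y w) - \<pi> w) / h"
        proof -
          have "(\<Sum>y\<in>S. \<pi> y * (if y = w then 1 else 0)) = \<pi> w"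
            using S(1) w by (simp add: if_distrib[of "(*) _"] cong: if_cong)
          then show ?thesis by (simp add: right_diff_distrib diff_divide_distrib sum_subtractf sum_divide_distrib[symmetric])
        qed
        ultimately have "((\<Sum>y\<in>S. \<pi> y * tp h y w) - \<pi> w) / h < \<epsilon> * \<pi> w" by simp
        then show "(\<Sum>y\<in>S. \<pi> y * tp h y w) \<le> (1 + \<epsilon> * h) * \<pi> w"
          unfolding pos_divide_less_eq[OF h] by (simp add: algebra_simps)
      qed (use h e in auto)
      then show ?case unfolding h_def .
    qed
    then show "\<exists>N. \<forall>j\<ge>N. (\<Sum>y\<in>S. \<pi> y * grid_stay (2^j) (t / 2^j) S y z) \<le> (1 + \<epsilon> * (t / 2^j)) ^ 2^j * \<pi> z"
      by (simp add: eventually_sequentially)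
  qed
  have "((\<lambda>\<epsilon>. exp (\<epsilon> * t) * \<pi> z) \<longlongrightarrow> exp (0 * t) * \<pi> z) (at_right 0)" by (intro tendsto_intros)
  then have "(\<Sum>y\<in>S. \<pi> y * stay S t y z) \<le> exp (0 * t) * \<pi> z"
    by (rule tendsto_lowerbound) (use main eventually_at_right_less[of "0::real"] in \<open>auto elim: eventually_mono\<close>)
  then show ?thesis by simp
qed

text \<open>For finitely many starting states the error of confining the chain to \<open>S N\<close>
  vanishes with \<open>N\<close>; Fatou's lemma passes to all starting states.\<close>

lemma tp_subinvariant:
  assumes S: "exhausting S" and t: "0 < t" and p: "\<And>y. 0 < \<pi> y"
    and gen: "\<And>N z. z \<in> S N \<Longrightarrow> (\<Sum>y\<in>S N. \<pi> y * generator q (\<lambda>w. if w = z then 1 else 0) y) \<le> 0"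
  shows "(\<integral>\<^sup>+y. ennreal (\<pi> y * tp t y z) \<partial>count_space UNIV) \<le> ennreal (\<pi> z)"
proof -
  have fin: "finite (S N)" for N using S by (simp add: exhausting_def)
  have finite_bound: "(\<Sum>y\<in>F. \<pi> y * tp t y z) \<le> \<pi> z" if F: "finite F" for F
  proof (rule LIMSEQ_le_const)
    have "(\<lambda>N. \<pi> z + (\<Sum>y\<in>F. \<pi> y * (1 - (\<Sum>w\<in>S N. stay (S N) t y w)))) \<longlonglongrightarrow> \<pi> z + (\<Sum>y\<in>F. \<pi> y * (1 - 1))"
      using S t unfolding exhausting_def by (intro tendsto_intros) auto
    then show "(\<lambda>N. \<pi> z + (\<Sum>y\<in>F. \<pi> y * (1 - (\<Sum>w\<in>S N. stay (S N) t y w)))) \<longlonglongrightarrow> \<pi> z" by simp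
    have "eventually (\<lambda>N. z \<in> S N \<and> (\<forall>y\<in>F. y \<in> S N)) sequentially"
      using S F by (simp add: exhausting_def eventually_conj_iff eventually_ball_finite_distrib)
    then have "eventually (\<lambda>N. (\<Sum>y\<in>F. \<pi> y * tp t y z) \<le> \<pi> z + (\<Sum>y\<in>F. \<pi> y * (1 - (\<Sum>w\<in>S N. stay (S N) t y w)))) sequentially"
    proof eventually_elim
      case (elim N)
      have "(\<Sum>y\<in>F. \<pi> y * tp t y z) \<le> (\<Sum>y\<in>F. \<pi> y * (stay (S N) t y z + (1 - (\<Sum>w\<in>S N. stay (S N) t y w))))"
        using stay_le_stay_finite[OF less_imp_le[OF t] fin[of N], of UNIV _ z] p
        by (intro sum_mono mult_left_mono) (auto simp: stay_UNIV less_imp_le)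
      also have "\<dots> = (\<Sum>y\<in>F. \<pi> y * stay (S N) t y z) + (\<Sum>y\<in>F. \<pi> y * (1 - (\<Sum>w\<in>S N. stay (S N) t y w)))"
        by (simp add: distrib_left sum.distrib)
      also have "(\<Sum>y\<in>F. \<pi> y * stay (S N) t y z) \<le> (\<Sum>y\<in>S N. \<pi> y * stay (S N) t y z)"
        using elim fin p by (intro sum_mono2) (auto intro!: mult_nonneg_nonneg less_imp_le[OF p])
      also have "\<dots> \<le> \<pi> z" by (rule stay_subinvariant[OF fin _ t]) (use elim p gen in auto)
      finally show ?case by simp
    qed
    then show "\<exists>M. \<forall>N\<ge>M. (\<Sum>y\<in>F. \<pi> y * tp t y z) \<le> \<pi> z + (\<Sum>y\<in>F. \<pi> y * (1 - (\<Sum>w\<in>S N. stay (S N) t y w)))"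
      by (simp add: eventually_sequentially)
  qed
  let ?f = "\<lambda>N y. ennreal (\<pi> y * tp t y z) * indicator (S N) y"
  have "(\<integral>\<^sup>+y. ennreal (\<pi> y * tp t y z) \<partial>count_space UNIV) = (\<integral>\<^sup>+y. liminf (\<lambda>N. ?f N y) \<partial>count_space UNIV)"
  proof (rule nn_integral_cong)
    fix y
    have "eventually (\<lambda>N. ?f N y = ennreal (\<pi> y * tp t y z)) sequentially"
      using S[unfolded exhausting_def, THEN conjunct2, THEN conjunct1, rule_format, of y]
      by (rule eventually_mono) simp
    then have "(\<lambda>N. ?f N y) \<longlonglongrightarrow> ennreal (\<pi> y * tp t y z)" by (rule tendsto_eventually)
    then show "ennreal (\<pi> y * tp t y z) = liminf (\<lambda>N. ?f N y)"
      by (simp add: lim_imp_Liminf)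
  qed
  also have "\<dots> \<le> liminf (\<lambda>N. \<integral>\<^sup>+y. ?f N y \<partial>count_space UNIV)" by (rule nn_integral_liminf) simp
  also have "\<dots> \<le> liminf (\<lambda>N::nat. ennreal (\<pi> z))"
  proof (intro Liminf_mono always_eventually allI)
    fix N
    have "(\<integral>\<^sup>+y. ?f N y \<partial>count_space UNIV) = (\<integral>\<^sup>+y. ennreal (\<pi> y * tp t y z) \<partial>count_space (S N))"
      by (simp add: nn_integral_count_space_indicator)
    also have "\<dots> = (\<Sum>y\<in>S N. ennreal (\<pi> y * tp t y z))" by (rule nn_integral_count_space_finite[OF fin])
    also have "\<dots> = ennreal (\<Sum>y\<in>S N. \<pi> y * tp t y z)"
      by (intro sum_ennreal) (auto intro!: mult_nonneg_nonneg less_imp_le[OF p])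
    also have "\<dots> \<le> ennreal (\<pi> z)" by (intro ennreal_leI finite_bound fin)
    finally show "(\<integral>\<^sup>+y. ?f N y \<partial>count_space UNIV) \<le> ennreal (\<pi> z)" .
  qed
  also have "\<dots> = ennreal (\<pi> z)" by (simp add: Liminf_const)
  finally show ?thesis .
qed

section \<open>Mean return times from a finite subinvariant measure\<close>

text \<open>\<open>avoid h x n y\<close> is the probability that the chain started at \<open>y\<close> and observed at
  \<open>h, 2 h, ..., n h\<close> is never seen at \<open>x\<close>.\<close>
primrec avoid :: "real \<Rightarrow> 's \<Rightarrow> nat \<Rightarrow> 's \<Rightarrow> ennreal" where
  "avoid h x 0 y = 1"
| "avoid h x (Suc n) y = (\<integral>\<^sup>+z. ennreal (tp h y z) * (if z = x then 0 else avoid h x n z) \<partial>count_space UNIV)"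

text \<open>The argument of Kac: the mass that avoids \<open>x\<close> up to time \<open>n h\<close> decreases by at least
  \<open>\<pi> x * avoid h x (Suc n) x\<close> in each step.\<close>
lemma avoid_kac:
  assumes sub: "\<And>z. (\<integral>\<^sup>+y. ennreal (\<pi> y * tp h y z) \<partial>count_space UNIV) \<le> ennreal (\<pi> z)"
    and p: "\<And>y. 0 \<le> \<pi> y"
  shows "(\<integral>\<^sup>+y. ennreal (\<pi> y) * (if y = x then 0 else avoid h x n y) \<partial>count_space UNIV) +
    ennreal (\<pi> x) * (\<Sum>k<n. avoid h x (Suc k) x) \<le> (\<integral>\<^sup>+y. ennreal (\<pi> y) \<partial>count_space UNIV)"
proof (induction n)
  case 0 show ?case by (auto intro!: nn_integral_mono)
next
  case (Suc n)
  let ?u = "\<lambda>n y. if y = x then 0 else avoid h x n y"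
  \<comment> \<open>\<open>?u (Suc n)\<close> vanishes at \<open>x\<close>, so adding the mass
    sitting at \<open>x\<close> completes the sum of \<open>\<pi> y * avoid h x (Suc n) y\<close>
    over all \<open>y\<close>. Unfolding one step of \<open>avoid\<close> then exposes the action of
    \<open>tp h\<close> on \<open>\<pi>\<close>.\<close>
  have "(\<integral>\<^sup>+y. ennreal (\<pi> y) * ?u (Suc n) y \<partial>count_space UNIV) + ennreal (\<pi> x) * avoid h x (Suc n) x =
      (\<integral>\<^sup>+y. ennreal (\<pi> y) * ?u (Suc n) y \<partial>count_space UNIV) +
      (\<integral>\<^sup>+y. ennreal (\<pi> y) * avoid h x (Suc n) y * indicator {x} y \<partial>count_space UNIV)"
    by (simp add: nn_integral_count_space_indicator[symmetric] nn_integral_count_space_finite del: avoid.simps)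
  also have "\<dots> = (\<integral>\<^sup>+y. ennreal (\<pi> y) * ?u (Suc n) y + ennreal (\<pi> y) * avoid h x (Suc n) y * indicator {x} y \<partial>count_space UNIV)"
    by (rule nn_integral_add[symmetric]) auto
  also have "\<dots> = (\<integral>\<^sup>+y. ennreal (\<pi> y) * avoid h x (Suc n) y \<partial>count_space UNIV)"
    by (intro nn_integral_cong) (simp add: indicator_def del: avoid.simps)
  also have "\<dots> = (\<integral>\<^sup>+y. \<integral>\<^sup>+z. ennreal (\<pi> y) * (ennreal (tp h y z) * ?u n z) \<partial>count_space UNIV \<partial>count_space UNIV)"
    by (intro nn_integral_cong) (simp add: nn_integral_cmult)
  also have "\<dots> = (\<integral>\<^sup>+z. \<integral>\<^sup>+y. ennreal (\<pi> y) * (ennreal (tp h y z) * ?u n z) \<partial>count_space UNIV \<partial>count_space UNIV)"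
    using nn_integral_fst_count_space[of "\<lambda>(y, z). ennreal (\<pi> y) * (ennreal (tp h y z) * ?u n z)"]
      nn_integral_snd_count_space[of "\<lambda>(y, z). ennreal (\<pi> y) * (ennreal (tp h y z) * ?u n z)"] by simp
  also have "\<dots> = (\<integral>\<^sup>+z. (\<integral>\<^sup>+y. ennreal (\<pi> y * tp h y z) \<partial>count_space UNIV) * ?u n z \<partial>count_space UNIV)"
  proof (intro nn_integral_cong)
    fix z
    have "(\<integral>\<^sup>+y. ennreal (\<pi> y) * (ennreal (tp h y z) * ?u n z) \<partial>count_space UNIV) =
        (\<integral>\<^sup>+y. ennreal (\<pi> y * tp h y z) * ?u n z \<partial>count_space UNIV)"
      using p by (intro nn_integral_cong) (simp add: ennreal_mult mult.assoc)
    also have "\<dots> = (\<integral>\<^sup>+y. ennreal (\<pi> y * tp h y z) \<partial>count_space UNIV) * ?u n z"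
      by (rule nn_integral_multc) simp
    finally show "(\<integral>\<^sup>+y. ennreal (\<pi> y) * (ennreal (tp h y z) * ?u n z) \<partial>count_space UNIV) =
        (\<integral>\<^sup>+y. ennreal (\<pi> y * tp h y z) \<partial>count_space UNIV) * ?u n z" .
  qed
  also have "\<dots> \<le> (\<integral>\<^sup>+z. ennreal (\<pi> z) * ?u n z \<partial>count_space UNIV)"
    by (intro nn_integral_mono mult_right_mono sub) simp
  finally have step: "(\<integral>\<^sup>+y. ennreal (\<pi> y) * ?u (Suc n) y \<partial>count_space UNIV) + ennreal (\<pi> x) * avoid h x (Suc n) x \<le>
      (\<integral>\<^sup>+z. ennreal (\<pi> z) * ?u n z \<partial>count_space UNIV)" .
  have "(\<integral>\<^sup>+y. ennreal (\<pi> y) * ?u (Suc n) y \<partial>count_space UNIV) + ennreal (\<pi> x) * (\<Sum>k<Suc n. avoid h x (Suc k) x) =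
     ((\<integral>\<^sup>+y. ennreal (\<pi> y) * ?u (Suc n) y \<partial>count_space UNIV) + ennreal (\<pi> x) * avoid h x (Suc n) x) +
       ennreal (\<pi> x) * (\<Sum>k<n. avoid h x (Suc k) x)"
    by (simp add: distrib_left add_ac del: avoid.simps)
  also have "\<dots> \<le> (\<integral>\<^sup>+z. ennreal (\<pi> z) * ?u n z \<partial>count_space UNIV) + ennreal (\<pi> x) * (\<Sum>k<n. avoid h x (Suc k) x)"
    by (rule add_right_mono[OF step])
  also have "\<dots> \<le> (\<integral>\<^sup>+y. ennreal (\<pi> y) \<partial>count_space UNIV)" by (rule Suc.IH)
  finally show ?case .
qed

lemma determined_conj_grid:
  assumes "determined (grid_times n h) A"
  shows "determined (grid_times (Suc n) h) (\<lambda>\<omega>. A \<omega> \<and> B (X (real (Suc n) * h) \<omega>))"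
proof (rule determinedI)
  fix \<omega> \<omega>' assume *: "\<And>r. r \<in> grid_times (Suc n) h \<Longrightarrow> X r \<omega> = X r \<omega>'"
  have "\<forall>r\<in>grid_times n h. X r \<omega> = X r \<omega>'"
  proof
    fix r assume "r \<in> grid_times n h"
    then have "r \<in> grid_times (Suc n) h" by auto
    then show "X r \<omega> = X r \<omega>'" by (rule *)
  qed
  then have "A \<omega> = A \<omega>'" using assms unfolding determined_def by blast
  moreover have "X (real (Suc n) * h) \<omega> = X (real (Suc n) * h) \<omega>'" by (rule *[OF grid_times_mem]) simp
  ultimately show "(A \<omega> \<and> B (X (real (Suc n) * h) \<omega>)) = (A \<omega>' \<and> B (X (real (Suc n) * h) \<omega>'))" by (simp only:)
qed

lemma emeasure_split_state:
  assumes t: "0 \<le> t" and A: "{\<omega> \<in> space (P x). A \<omega>} \<in> sets (P x)"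
  shows "emeasure (P x) {\<omega> \<in> space (P x). A \<omega>} =
    (\<integral>\<^sup>+y. emeasure (P x) {\<omega> \<in> space (P x). A \<omega> \<and> X t \<omega> = y} \<partial>count_space UNIV)"
proof -
  have eq: "{\<omega> \<in> space (P x). A \<omega>} = (\<Union>y\<in>UNIV. {\<omega> \<in> space (P x). A \<omega> \<and> X t \<omega> = y})" by auto
  show ?thesis
  proof (subst eq, rule emeasure_UN_countable)
    show "disjoint_family_on (\<lambda>y. {\<omega> \<in> space (P x). A \<omega> \<and> X t \<omega> = y}) UNIV"
      unfolding disjoint_family_on_def by blast
    show "{\<omega> \<in> space (P x). A \<omega> \<and> X t \<omega> = y} \<in> sets (P x)" for y
      by (intro sets.sets_Collect_conj A X_eq_sets t)
  qed simp
qed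

lemma emeasure_grid_step:
  assumes h: "0 \<le> h" and A: "determined (grid_times n h) A"
  shows "emeasure (P x) {\<omega> \<in> space (P x). A \<omega> \<and> X (real (Suc n) * h) \<omega> = z} =
    (\<integral>\<^sup>+y. emeasure (P x) {\<omega> \<in> space (P x). A \<omega> \<and> X (real n * h) \<omega> = y} * ennreal (tp h y z) \<partial>count_space UNIV)"
proof -
  interpret prob_space "P x" by (rule prob_space_P)
  have "{\<omega> \<in> space (P x). A \<omega> \<and> X (real (Suc n) * h) \<omega> = z} \<in> sets (P x)"
    using h by (intro sets.sets_Collect_conj grid_sets[OF h A] X_eq_sets) simp
  from emeasure_split_state[OF _ this, of "real n * h"]
  have "emeasure (P x) {\<omega> \<in> space (P x). A \<omega> \<and> X (real (Suc n) * h) \<omega> = z} =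
    (\<integral>\<^sup>+y. emeasure (P x) {\<omega> \<in> space (P x). (A \<omega> \<and> X (real (Suc n) * h) \<omega> = z) \<and> X (real n * h) \<omega> = y} \<partial>count_space UNIV)"
    using h by simp
  also have "\<dots> = (\<integral>\<^sup>+y. emeasure (P x) {\<omega> \<in> space (P x). A \<omega> \<and> X (real n * h) \<omega> = y} * ennreal (tp h y z) \<partial>count_space UNIV)"
  proof (intro nn_integral_cong)
    fix y
    have "{\<omega> \<in> space (P x). (A \<omega> \<and> X (real (Suc n) * h) \<omega> = z) \<and> X (real n * h) \<omega> = y} =
        {\<omega> \<in> space (P x). A \<omega> \<and> X (real n * h) \<omega> = y \<and> X (real (Suc n) * h) \<omega> = z}" by blast
    then show "emeasure (P x) {\<omega> \<in> space (P x). (A \<omega> \<and> X (real (Suc n) * h) \<omega> = z) \<and> X (real n * h) \<omega> = y} =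
      emeasure (P x) {\<omega> \<in> space (P x). A \<omega> \<and> X (real n * h) \<omega> = y} * ennreal (tp h y z)"
      by (simp only: emeasure_eq_measure grid_markov[OF h A] ennreal_mult'[OF measure_nonneg] ennreal_mult[OF measure_nonneg tp_nonneg])
  qed
  finally show ?thesis .
qed

text \<open>The Markov property at time \<open>n * h\<close>: given the state there, the past event
  has no influence on the next \<open>k\<close> steps. The induction moves the first of these steps
  into the past event.\<close>

lemma emeasure_avoid:
  assumes h: "0 \<le> h" and A: "determined (grid_times n h) A"
  shows "emeasure (P x0) {\<omega> \<in> space (P x0). A \<omega> \<and> (\<forall>i\<in>{1..k}. X (real (n + i) * h) \<omega> \<noteq> x)} =
    (\<integral>\<^sup>+y. emeasure (P x0) {\<omega> \<in> space (P x0). A \<omega> \<and> X (real n * h) \<omega> = y} * avoid h x k y \<partial>count_space UNIV)"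
  using A
proof (induction k arbitrary: n A)
  case 0
  then show ?case using emeasure_split_state[OF _ grid_sets[OF h 0], of "real n * h" x0] h by simp
next
  case (Suc k)
  let ?A = "\<lambda>\<omega>. A \<omega> \<and> X (real (Suc n) * h) \<omega> \<noteq> x"
  let ?m = "\<lambda>y. emeasure (P x0) {\<omega> \<in> space (P x0). A \<omega> \<and> X (real n * h) \<omega> = y}"
  have shift: "(\<forall>i\<in>{1..Suc k}. Q (n + i)) \<longleftrightarrow> Q (Suc n) \<and> (\<forall>i\<in>{1..k}. Q (Suc n + i))" for Q
  proof (intro iffI conjI ballI)
    fix i assume a: "\<forall>i\<in>{1..Suc k}. Q (n + i)"
    show "Q (Suc n)" using bspec[OF a, of 1] by simp
    show "i \<in> {1..k} \<Longrightarrow> Q (Suc n + i)" using bspec[OF a, of "Suc i"] by simp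
  next
    fix i assume "Q (Suc n) \<and> (\<forall>i\<in>{1..k}. Q (Suc n + i))" "i \<in> {1..Suc k}"
    then show "Q (n + i)" by (cases i) (auto, metis Suc_le_eq atLeastAtMost_iff gr0I One_nat_def add_0_right)
  qed
  have "{\<omega> \<in> space (P x0). A \<omega> \<and> (\<forall>i\<in>{1..Suc k}. X (real (n + i) * h) \<omega> \<noteq> x)} =
      {\<omega> \<in> space (P x0). ?A \<omega> \<and> (\<forall>i\<in>{1..k}. X (real (Suc n + i) * h) \<omega> \<noteq> x)}"
    by (simp only: shift[of "\<lambda>m. X (real m * h) _ \<noteq> x"] conj_assoc)
  then have "emeasure (P x0) {\<omega> \<in> space (P x0). A \<omega> \<and> (\<forall>i\<in>{1..Suc k}. X (real (n + i) * h) \<omega> \<noteq> x)} =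
      (\<integral>\<^sup>+z. emeasure (P x0) {\<omega> \<in> space (P x0). ?A \<omega> \<and> X (real (Suc n) * h) \<omega> = z} * avoid h x k z \<partial>count_space UNIV)"
    by (simp only: Suc.IH[OF determined_conj_grid[OF Suc.prems, of "\<lambda>v. v \<noteq> x"]])
  also have "\<dots> = (\<integral>\<^sup>+z. \<integral>\<^sup>+y. ?m y * (ennreal (tp h y z) * (if z = x then 0 else avoid h x k z)) \<partial>count_space UNIV \<partial>count_space UNIV)"
  proof (intro nn_integral_cong)
    fix z
    show "emeasure (P x0) {\<omega> \<in> space (P x0). ?A \<omega> \<and> X (real (Suc n) * h) \<omega> = z} * avoid h x k z =
       (\<integral>\<^sup>+y. ?m y * (ennreal (tp h y z) * (if z = x then 0 else avoid h x k z)) \<partial>count_space UNIV)"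
    proof (cases "z = x")
      case True
      then have "{\<omega> \<in> space (P x0). ?A \<omega> \<and> X (real (Suc n) * h) \<omega> = z} = {}" by blast
      then have "emeasure (P x0) {\<omega> \<in> space (P x0). ?A \<omega> \<and> X (real (Suc n) * h) \<omega> = z} = 0" by (simp only: emeasure_empty)
      then show ?thesis using True by simp
    next
      case False
      then have "{\<omega> \<in> space (P x0). ?A \<omega> \<and> X (real (Suc n) * h) \<omega> = z} = {\<omega> \<in> space (P x0). A \<omega> \<and> X (real (Suc n) * h) \<omega> = z}" by blast
      then have "emeasure (P x0) {\<omega> \<in> space (P x0). ?A \<omega> \<and> X (real (Suc n) * h) \<omega> = z} =
          (\<integral>\<^sup>+y. ?m y * ennreal (tp h y z) \<partial>count_space UNIV)"
        by (simp only: emeasure_grid_step[OF h Suc.prems])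
      then show ?thesis using False by (simp add: nn_integral_multc[symmetric] mult.assoc)
    qed
  qed
  also have "\<dots> = (\<integral>\<^sup>+y. \<integral>\<^sup>+z. ?m y * (ennreal (tp h y z) * (if z = x then 0 else avoid h x k z)) \<partial>count_space UNIV \<partial>count_space UNIV)"
    using nn_integral_fst_count_space[of "\<lambda>(y, z). ?m y * (ennreal (tp h y z) * (if z = x then 0 else avoid h x k z))"]
      nn_integral_snd_count_space[of "\<lambda>(y, z). ?m y * (ennreal (tp h y z) * (if z = x then 0 else avoid h x k z))"] by simp
  also have "\<dots> = (\<integral>\<^sup>+y. ?m y * avoid h x (Suc k) y \<partial>count_space UNIV)"
    by (intro nn_integral_cong) (simp add: nn_integral_cmult)
  finally show ?case .
qed

lemma emeasure_hold:
  assumes h: "0 \<le> h"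
  shows "emeasure (P x) {\<omega> \<in> space (P x). (\<forall>k\<le>n. X (real k * h) \<omega> \<in> {x}) \<and> X (real n * h) \<omega> = y} =
    (if y = x then ennreal (tp h x x ^ n) else 0)"
proof (cases "y = x")
  case True
  interpret prob_space "P x" by (rule prob_space_P)
  have "grid_stay n h {x} x x = tp h x x ^ n"
    by (induction n) (simp_all add: grid_stay_0 grid_stay_Suc[OF h] mult.commute)
  then show ?thesis using True by (simp add: emeasure_eq_measure grid_stay_def)
next
  case False
  then have "{\<omega> \<in> space (P x). (\<forall>k\<le>n. X (real k * h) \<omega> \<in> {x}) \<and> X (real n * h) \<omega> = y} = {}" by blast
  then show ?thesis using False by (simp only: emeasure_empty if_False)
qed

text \<open>The grid version of the event that \<open>return_time\<close> exceeds
  \<open>n * h\<close>; a path that has not yet left \<open>x\<close> belongs to it.\<close>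

definition no_return :: "real \<Rightarrow> 's \<Rightarrow> nat \<Rightarrow> 'w \<Rightarrow> bool" where
  "no_return h x n \<omega> \<longleftrightarrow> (\<forall>i k. i < k \<longrightarrow> k \<le> n \<longrightarrow> X (real i * h) \<omega> \<noteq> x \<longrightarrow> X (real k * h) \<omega> \<noteq> x)"

lemma determined_no_return: "determined (grid_times n h) (no_return h x n)"
proof (rule determinedI)
  fix \<omega> \<omega>' assume "\<And>r. r \<in> grid_times n h \<Longrightarrow> X r \<omega> = X r \<omega>'"
  then have eq: "X (real k * h) \<omega> = X (real k * h) \<omega>'" if "k \<le> n" for k using grid_times_mem[OF that] by blast
  show "no_return h x n \<omega> = no_return h x n \<omega>'"
    unfolding no_return_def
    by (intro iff_allI imp_cong refl) (simp_all add: eq)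
qed

lemma last_initial_index:
  assumes "Y 0 = x"
  obtains j where "j \<le> n" "\<forall>k\<le>j. Y k = x" "j = n \<or> Y (Suc j) \<noteq> x"
proof -
  have "\<exists>j\<le>n. (\<forall>k\<le>j. Y k = x) \<and> (j = n \<or> Y (Suc j) \<noteq> x)"
  proof (induction n)
    case 0 show ?case using assms by simp
  next
    case (Suc n)
    then obtain j where j: "j \<le> n" "\<forall>k\<le>j. Y k = x" "j = n \<or> Y (Suc j) \<noteq> x" by blast
    show ?case
    proof (cases "Y (Suc j) = x")
      case True
      then have "j = n" using j by simp
      then show ?thesis using j True by (intro exI[of _ "Suc n"]) (simp add: le_Suc_eq)
    next
      case False
      then show ?thesis using j by (intro exI[of _ j]) simp
    qed
  qed
  then show ?thesis using that by blast
qed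

text \<open>Split by the last index \<open>j\<close> of the initial stay at \<open>x\<close>:
  holding for \<open>j\<close> steps has probability \<open>tp h x x ^ j\<close>, and
  \<open>x\<close> is avoided during the remaining \<open>n - j\<close> steps.\<close>

lemma emeasure_no_return_le:
  assumes h: "0 \<le> h"
  shows "emeasure (P x) {\<omega> \<in> space (P x). no_return h x n \<omega>} \<le> (\<Sum>j\<le>n. ennreal (tp h x x ^ j) * avoid h x (n - j) x)"
proof -
  interpret prob_space "P x" by (rule prob_space_P)
  let ?E = "\<lambda>j. {\<omega> \<in> space (P x). (\<forall>k\<le>j. X (real k * h) \<omega> \<in> {x}) \<and> (\<forall>i\<in>{1..n-j}. X (real (j + i) * h) \<omega> \<noteq> x)}"
  have Em: "?E j \<in> sets (P x)" for j
    using h by (intro sets.sets_Collect_conj grid_sets[OF h determined_stay] sets.sets_Collect_finite_All sets.sets_Collect_neg X_eq_sets) auto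
  have nr: "{\<omega> \<in> space (P x). no_return h x n \<omega>} \<in> sets (P x)" by (rule grid_sets[OF h determined_no_return])
  have "emeasure (P x) {\<omega> \<in> space (P x). no_return h x n \<omega>} = emeasure (P x) {\<omega> \<in> space (P x). no_return h x n \<omega> \<and> X 0 \<omega> = x}"
    using start_event[OF nr] by (simp only: emeasure_eq_measure)
  also have "\<dots> \<le> emeasure (P x) (\<Union>j\<in>{..n}. ?E j)"
  proof (rule emeasure_mono)
    show "(\<Union>j\<in>{..n}. ?E j) \<in> sets (P x)" by (rule sets.finite_UN[OF finite_atMost Em])
    show "{\<omega> \<in> space (P x). no_return h x n \<omega> \<and> X 0 \<omega> = x} \<subseteq> (\<Union>j\<in>{..n}. ?E j)"
    proof
      fix \<omega> assume "\<omega> \<in> {\<omega> \<in> space (P x). no_return h x n \<omega> \<and> X 0 \<omega> = x}"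
      then have w: "\<omega> \<in> space (P x)" "no_return h x n \<omega>" "X 0 \<omega> = x" by auto
      from w(3) have "X (real 0 * h) \<omega> = x" by simp
      then obtain j where j: "j \<le> n" "\<forall>k\<le>j. X (real k * h) \<omega> = x" "j = n \<or> X (real (Suc j) * h) \<omega> \<noteq> x"
        by (rule last_initial_index[of "\<lambda>k. X (real k * h) \<omega>"]) (rule that)
      have "X (real (j + i) * h) \<omega> \<noteq> x" if i: "i \<in> {1..n-j}" for i
      proof (cases "i = 1")
        case True
        moreover have "j \<noteq> n" using i by auto
        ultimately show ?thesis using j(3) by (simp del: of_nat_Suc)
      next
        case False
        then have "Suc j < j + i" "j + i \<le> n" "j \<noteq> n" using i j(1) by auto
        then show ?thesis
          using w(2)[unfolded no_return_def, rule_format, of "Suc j" "j + i"] j(3) by argo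
      qed
      then have "\<omega> \<in> ?E j" using w(1) j(2) by simp
      then show "\<omega> \<in> (\<Union>j\<in>{..n}. ?E j)" using j(1) by blast
    qed
  qed
  also have "\<dots> \<le> (\<Sum>j\<le>n. emeasure (P x) (?E j))" by (rule emeasure_subadditive_finite[OF finite_atMost], rule image_subsetI, rule Em)
  also have "\<dots> = (\<Sum>j\<le>n. ennreal (tp h x x ^ j) * avoid h x (n - j) x)"
  proof (intro sum.cong refl)
    fix j
    have "emeasure (P x) (?E j) = (\<integral>\<^sup>+y. (if y = x then ennreal (tp h x x ^ j) else 0) * avoid h x (n - j) y \<partial>count_space UNIV)"
      by (simp only: emeasure_avoid[OF h determined_stay] emeasure_hold[OF h])
    also have "\<dots> = (\<integral>\<^sup>+y. ennreal (tp h x x ^ j) * avoid h x (n - j) y * indicator {x} y \<partial>count_space UNIV)"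
      by (intro nn_integral_cong) (auto simp: indicator_def)
    also have "\<dots> = ennreal (tp h x x ^ j) * avoid h x (n - j) x"
      by (simp add: nn_integral_count_space_indicator[symmetric] nn_integral_count_space_finite)
    finally show "emeasure (P x) (?E j) = ennreal (tp h x x ^ j) * avoid h x (n - j) x" .
  qed
  finally show ?thesis .
qed

lemma return_time_le:
  assumes h: "0 \<le> h" and n: "\<not> no_return h x n \<omega>"
  shows "return_time X x \<omega> \<le> ennreal (real n * h)"
proof -
  obtain i k where ik: "i < k" "k \<le> n" "X (real i * h) \<omega> \<noteq> x" "X (real k * h) \<omega> = x"
    using n unfolding no_return_def by blast
  have "return_time X x \<omega> \<le> ennreal (real k * h)"
    unfolding return_time_def
  proof (intro Inf_lower imageI CollectI conjI)
    show "\<exists>s\<in>{0..real k * h}. X s \<omega> \<noteq> x"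
      using ik h by (intro bexI[of _ "real i * h"]) (auto intro!: mult_right_mono)
  qed (use ik h in auto)
  also have "\<dots> \<le> ennreal (real n * h)" using ik h by (intro ennreal_leI mult_right_mono) auto
  finally show ?thesis .
qed

text \<open>The inner sums satisfy \<open>u (Suc n) = w (Suc n) + p * u n\<close>, so a bound
  \<open>B\<close> for their partial sums reproduces itself if \<open>W + p * B \<le> B\<close>;
  \<open>B = W / (1 - p)\<close> gives equality.\<close>

lemma convolution_bound:
  fixes w :: "nat \<Rightarrow> ennreal"
  assumes p: "0 \<le> p" "p < 1" and w: "\<And>n. (\<Sum>k<n. w k) \<le> W"
  shows "(\<Sum>n<m. \<Sum>j\<le>n. ennreal (p ^ j) * w (n - j)) \<le> ennreal (1 / (1 - p)) * W"
proof (induction m)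
  case 0 show ?case by simp
next
  case (Suc m)
  let ?u = "\<lambda>n. \<Sum>j\<le>n. ennreal (p ^ j) * w (n - j)"
  have u: "?u (Suc n) = w (Suc n) + ennreal p * ?u n" for n
    using p by (subst sum.atMost_Suc_shift) (simp add: sum_distrib_left ennreal_mult mult.assoc)
  have "(\<Sum>n<Suc m. ?u n) = (\<Sum>n<Suc m. w n) + ennreal p * (\<Sum>n<m. ?u n)"
    by (subst (1 2) sum.lessThan_Suc_shift) (simp only: u sum.distrib sum_distrib_left add.assoc, simp)
  also have "\<dots> \<le> W + ennreal p * (ennreal (1 / (1 - p)) * W)"
    by (intro add_mono w mult_left_mono Suc.IH) simp
  also have "\<dots> = ennreal (1 + p * (1 / (1 - p))) * W"
  proof -
    define c where "c = 1 / (1 - p)"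
    have "0 \<le> c" using p by (simp add: c_def)
    then have "W + ennreal p * (ennreal c * W) = ennreal (1 + p * c) * W"
      using p by (simp add: ennreal_plus distrib_right ennreal_mult mult.assoc)
    then show ?thesis by (simp only: c_def)
  qed
  also have "1 + p * (1 / (1 - p)) = 1 / (1 - p)" using p by (simp add: field_simps)
  finally show ?case .
qed

text \<open>For one fixed mesh \<open>h\<close> the return time is at most \<open>h\<close> times
  the number of \<open>n\<close> with \<open>no_return h x n\<close>. Kac's inequality bounds the
  sum of the avoidance probabilities through the total mass of \<open>\<pi>\<close>, and
  \<open>out\<close> makes \<open>tp h x x\<close> less than 1, so the initial stay contributes only
  a finite factor.\<close>

lemma positive_recurrentI:
  assumes S: "exhausting S" and p: "\<And>y. 0 < \<pi> y" and fin: "(\<integral>\<^sup>+y. ennreal (\<pi> y) \<partial>count_space UNIV) < \<infinity>"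
    and gen: "\<And>N z. z \<in> S N \<Longrightarrow> (\<Sum>y\<in>S N. \<pi> y * generator q (\<lambda>w. if w = z then 1 else 0) y) \<le> 0"
    and out: "\<And>x. generator q (\<lambda>w. if w = x then 1 else 0) x < 0"
  shows "positive_recurrent P X"
  unfolding positive_recurrent_def
proof
  fix x
  interpret prob_space "P x" by (rule prob_space_P)
  have "((\<lambda>h. (tp h x x - 1) / h) \<longlongrightarrow> generator q (\<lambda>w. if w = x then 1 else 0) x) (at_right 0)"
    using generator_limit_finite[of "{x}" "\<lambda>w. if w = x then 1 else 0" x] by simp
  from order_tendstoD(2)[OF this out]
  have "eventually (\<lambda>h. 0 < h \<and> (tp h x x - 1) / h < 0) (at_right 0)"
    using eventually_at_right_less[of "0::real"] by (simp add: eventually_conj_iff)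
  then obtain h where h: "0 < h" "(tp h x x - 1) / h < 0"
    by (rule eventually_happens'[rotated, THEN exE]) auto
  then have p1: "tp h x x < 1" by (simp add: divide_less_0_iff)
  have sub: "(\<integral>\<^sup>+y. ennreal (\<pi> y * tp h y z) \<partial>count_space UNIV) \<le> ennreal (\<pi> z)" for z
    by (rule tp_subinvariant[OF S h(1) p gen])
  define I where "I = (\<integral>\<^sup>+y. ennreal (\<pi> y) \<partial>count_space UNIV)"
  \<comment> \<open>The summand 1 is the term for \<open>k = 0\<close>; \<open>avoid_kac\<close>
    controls the shifted sum.\<close>
  define W where "W = 1 + ennreal (1 / \<pi> x) * I"
  have I: "I < \<infinity>" using fin by (simp add: I_def)
  have W: "W < \<infinity>" using I p[of x] unfolding W_def by (simp add: ennreal_mult_less_top)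
  have w: "(\<Sum>k<n. avoid h x k x) \<le> W" for n
  proof -
    have "ennreal (\<pi> x) * (\<Sum>k<n. avoid h x (Suc k) x) \<le>
        (\<integral>\<^sup>+y. ennreal (\<pi> y) * (if y = x then 0 else avoid h x n y) \<partial>count_space UNIV) + ennreal (\<pi> x) * (\<Sum>k<n. avoid h x (Suc k) x)"
      by simp
    also have "\<dots> \<le> I" unfolding I_def by (rule avoid_kac[OF sub less_imp_le[OF p]])
    finally have "ennreal (1 / \<pi> x) * (ennreal (\<pi> x) * (\<Sum>k<n. avoid h x (Suc k) x)) \<le> ennreal (1 / \<pi> x) * I"
      by (rule mult_left_mono) simp
    moreover have "ennreal (1 / \<pi> x) * ennreal (\<pi> x) = 1"
      using p[of x] by (simp add: ennreal_mult'[symmetric])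
    ultimately have "(\<Sum>k<n. avoid h x (Suc k) x) \<le> ennreal (1 / \<pi> x) * I"
      by (simp add: mult.assoc[symmetric] del: avoid.simps)
    then have "(\<Sum>k<Suc n. avoid h x k x) \<le> W"
      unfolding W_def by (subst sum.lessThan_Suc_shift) (simp add: add_left_mono del: avoid.simps(2))
    moreover have "(\<Sum>k<n. avoid h x k x) \<le> (\<Sum>k<Suc n. avoid h x k x)" by simp
    ultimately show ?thesis by (rule order_trans[rotated])
  qed
  let ?B = "\<lambda>n. {\<omega> \<in> space (P x). no_return h x n \<omega>}"
  have Bm: "?B n \<in> sets (P x)" for n by (rule grid_sets[OF less_imp_le[OF h(1)] determined_no_return])
  have "(\<integral>\<^sup>+\<omega>. return_time X x \<omega> \<partial>P x) \<le> (\<integral>\<^sup>+\<omega>. (\<Sum>n. ennreal h * indicator (?B n) \<omega>) \<partial>P x)"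
  proof (intro nn_integral_mono)
    fix \<omega> assume sp: "\<omega> \<in> space (P x)"
    show "return_time X x \<omega> \<le> (\<Sum>n. ennreal h * indicator (?B n) \<omega>)"
    proof (cases "\<forall>n. no_return h x n \<omega>")
      case True
      then have "(\<Sum>n. ennreal h * indicator (?B n) \<omega>) = (\<Sum>n. ennreal h)" using sp by simp
      also have "\<dots> = \<infinity>" using h(1) by (simp add: nn_integral_count_space_nat[symmetric] ennreal_mult_top)
      finally show ?thesis by simp
    next
      case False
      define m where "m = (LEAST n. \<not> no_return h x n \<omega>)"
      have m: "\<not> no_return h x m \<omega>" using False unfolding m_def by (metis (mono_tags, lifting) LeastI)
      have lt: "no_return h x n \<omega>" if "n < m" for n using that unfolding m_def by (metis (mono_tags, lifting) not_less_Least)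
      have "return_time X x \<omega> \<le> ennreal (real m * h)" by (rule return_time_le[OF less_imp_le[OF h(1)] m])
      also have "\<dots> = (\<Sum>n<m. ennreal h)" using h(1) by (simp add: ennreal_mult ennreal_of_nat_eq_real_of_nat)
      also have "\<dots> = (\<Sum>n<m. ennreal h * indicator (?B n) \<omega>)" using sp lt by (intro sum.cong) auto
      also have "\<dots> \<le> (\<Sum>n. ennreal h * indicator (?B n) \<omega>)" by (intro sum_le_suminf) auto
      finally show ?thesis .
    qed
  qed
  also have "\<dots> = (\<Sum>n. \<integral>\<^sup>+\<omega>. ennreal h * indicator (?B n) \<omega> \<partial>P x)"
    by (rule nn_integral_suminf) (use Bm in auto)
  also have "\<dots> = (\<Sum>n. ennreal h * emeasure (P x) (?B n))" by (simp add: nn_integral_cmult_indicator Bm)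
  also have "\<dots> \<le> ennreal h * (ennreal (1 / (1 - tp h x x)) * W)"
    unfolding suminf_eq_SUP
  proof (rule SUP_least)
    fix m
    have "(\<Sum>n<m. ennreal h * emeasure (P x) (?B n)) \<le> ennreal h * (\<Sum>n<m. \<Sum>j\<le>n. ennreal (tp h x x ^ j) * avoid h x (n - j) x)"
      unfolding sum_distrib_left[symmetric] using h
      by (intro mult_left_mono sum_mono emeasure_no_return_le) auto
    also have "\<dots> \<le> ennreal h * (ennreal (1 / (1 - tp h x x)) * W)"
      by (intro mult_left_mono convolution_bound w p1) auto
    finally show "(\<Sum>n<m. ennreal h * emeasure (P x) (?B n)) \<le> ennreal h * (ennreal (1 / (1 - tp h x x)) * W)" .
  qed
  also have "\<dots> < \<infinity>" using W by (simp add: ennreal_mult_less_top)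
  finally show "(\<integral>\<^sup>+\<omega>. return_time X x \<omega> \<partial>P x) < \<infinity>" .
qed

section \<open>Lower bounds for return times\<close>

definition phase_event :: "real \<Rightarrow> 's \<Rightarrow> 's set \<Rightarrow> nat \<Rightarrow> 'w \<Rightarrow> bool" where
  "phase_event h x S n \<omega> \<longleftrightarrow> (\<forall>k\<le>n. X (real k * h) \<omega> \<in> insert x S) \<and> no_return h x n \<omega>"

lemma determined_phase_event: "determined (grid_times n h) (phase_event h x S n)"
  using determined_stay[of h n "insert x S"] determined_no_return[of h n x]
  unfolding determined_def phase_event_def by blast

lemma phase_event_Suc_away:
  assumes "phase_event h x S n \<omega>" "X (real (Suc n) * h) \<omega> = z" "z \<in> S" "x \<notin> S"
  shows "phase_event h x S (Suc n) \<omega>"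
proof -
  have "z \<noteq> x" using assms by blast
  then show ?thesis using assms unfolding phase_event_def no_return_def by (simp add: le_Suc_eq del: of_nat_Suc)
qed

text \<open>Being at \<open>x\<close> at step \<open>n\<close> without having returned means never
  having left, so another step at \<open>x\<close> is not a return.\<close>

lemma phase_event_Suc_hold:
  assumes e: "phase_event h x S n \<omega>" and X: "X (real n * h) \<omega> = x" "X (real (Suc n) * h) \<omega> = x"
  shows "phase_event h x S (Suc n) \<omega>"
proof -
  have eq: "X (real k * h) \<omega> = x" if "k \<le> n" for k
  proof (cases "k = n")
    case False
    then have "k < n" using that by simp
    then show ?thesis using e X(1) unfolding phase_event_def no_return_def by blast
  qed (use X in simp)
  have "X (real k * h) \<omega> = x" if "k \<le> Suc n" for k
    using that eq X(2) by (cases "k = Suc n") (auto simp del: of_nat_Suc)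
  then show ?thesis unfolding phase_event_def no_return_def by simp
qed

text \<open>A Lyapunov function for the chain with the memory bit ``has left \<open>x\<close>'': it is \<open>c\<close> before the
  first departure from \<open>x\<close> and \<open>g\<close> afterwards.\<close>
lemma phase_functional_ge:
  assumes h: "0 \<le> h" and S: "finite S" "x \<notin> S" and b: "0 \<le> b" and c: "c \<le> 1" "0 \<le> c"
    and g: "\<And>z. z \<in> S \<Longrightarrow> g z \<le> 1"
    and away: "\<And>y. y \<in> S \<Longrightarrow> g y - b \<le> (\<Sum>z\<in>S. tp h y z * g z)"
    and hold: "c \<le> c * tp h x x + (\<Sum>z\<in>S. tp h x z * g z)"
    and gpos: "\<And>z. z \<in> S \<Longrightarrow> 0 \<le> g z"
  shows "c - real n * b \<le> measure (P x) {\<omega> \<in> space (P x). no_return h x n \<omega>}"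
proof -
  interpret prob_space "P x" by (rule prob_space_P)
  define M where "M n z = prob {\<omega> \<in> space (P x). phase_event h x S n \<omega> \<and> X (real n * h) \<omega> = z}" for n z
  have ev: "{\<omega> \<in> space (P x). phase_event h x S n \<omega> \<and> X (real m * h) \<omega> = z} \<in> sets (P x)" for n m z
    using h by (intro sets.sets_Collect_conj grid_sets[OF h determined_phase_event] X_eq_sets) simp
  have fin: "finite (insert x S)" using S by simp
  have tot: "(\<Sum>y\<in>insert x S. M n y) \<le> prob {\<omega> \<in> space (P x). no_return h x n \<omega>}" for n
  proof -
    have "(\<Sum>y\<in>insert x S. M n y) = prob (\<Union>y\<in>insert x S. {\<omega> \<in> space (P x). phase_event h x S n \<omega> \<and> X (real n * h) \<omega> = y})"
      unfolding M_def
    proof (rule finite_measure_finite_Union[symmetric, OF fin])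
      show "(\<lambda>y. {\<omega> \<in> space (P x). phase_event h x S n \<omega> \<and> X (real n * h) \<omega> = y}) ` insert x S \<subseteq> events"
        by (rule image_subsetI) (rule ev)
      show "disjoint_family_on (\<lambda>y. {\<omega> \<in> space (P x). phase_event h x S n \<omega> \<and> X (real n * h) \<omega> = y}) (insert x S)"
        unfolding disjoint_family_on_def by blast
    qed
    also have "\<dots> \<le> prob {\<omega> \<in> space (P x). no_return h x n \<omega>}"
    proof (rule finite_measure_mono)
      show "(\<Union>y\<in>insert x S. {\<omega> \<in> space (P x). phase_event h x S n \<omega> \<and> X (real n * h) \<omega> = y}) \<subseteq> {\<omega> \<in> space (P x). no_return h x n \<omega>}"
        unfolding phase_event_def by blast
    qed (rule grid_sets[OF h determined_no_return])
    finally show ?thesis .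
  qed
  have Msum: "(\<Sum>y\<in>S. M n y) \<le> 1" for n
  proof -
    have "(\<Sum>y\<in>S. M n y) \<le> (\<Sum>y\<in>insert x S. M n y)" using fin by (intro sum_mono2) (auto simp: M_def)
    also have "\<dots> \<le> prob {\<omega> \<in> space (P x). no_return h x n \<omega>}" by (rule tot)
    also have "\<dots> \<le> 1" by (rule prob_le_1)
    finally show ?thesis .
  qed
  have MS: "M (Suc n) z \<ge> M n x * tp h x z + (\<Sum>y\<in>S. M n y * tp h y z)" if z: "z \<in> S" for n z
  proof -
    have "M n x * tp h x z + (\<Sum>y\<in>S. M n y * tp h y z) = (\<Sum>y\<in>insert x S. M n y * tp h y z)" using S by simp
    also have "\<dots> = prob {\<omega> \<in> space (P x). phase_event h x S n \<omega> \<and> X (real n * h) \<omega> \<in> insert x S \<and> X (real (Suc n) * h) \<omega> = z}"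
      unfolding M_def by (rule grid_markov_finite[OF h determined_phase_event fin, symmetric])
    also have "\<dots> \<le> M (Suc n) z" unfolding M_def
    proof (rule finite_measure_mono[OF _ ev], rule subsetI)
      fix \<omega> assume "\<omega> \<in> {\<omega> \<in> space (P x). phase_event h x S n \<omega> \<and> X (real n * h) \<omega> \<in> insert x S \<and> X (real (Suc n) * h) \<omega> = z}"
      then have "\<omega> \<in> space (P x)" "phase_event h x S n \<omega>" "X (real (Suc n) * h) \<omega> = z" by blast+
      moreover from this(2,3) have "phase_event h x S (Suc n) \<omega>" using z S(2) by (rule phase_event_Suc_away)
      ultimately show "\<omega> \<in> {\<omega> \<in> space (P x). phase_event h x S (Suc n) \<omega> \<and> X (real (Suc n) * h) \<omega> = z}" by blast
    qed
    finally show ?thesis .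
  qed
  have Mx: "M (Suc n) x \<ge> M n x * tp h x x" for n
  proof -
    have "M n x * tp h x x = prob {\<omega> \<in> space (P x). phase_event h x S n \<omega> \<and> X (real n * h) \<omega> = x \<and> X (real (Suc n) * h) \<omega> = x}"
      unfolding M_def by (rule grid_markov[OF h determined_phase_event, symmetric])
    also have "\<dots> \<le> M (Suc n) x" unfolding M_def
    proof (rule finite_measure_mono[OF _ ev], rule subsetI)
      fix \<omega> assume "\<omega> \<in> {\<omega> \<in> space (P x). phase_event h x S n \<omega> \<and> X (real n * h) \<omega> = x \<and> X (real (Suc n) * h) \<omega> = x}"
      then have "\<omega> \<in> space (P x)" "phase_event h x S n \<omega>" "X (real n * h) \<omega> = x" "X (real (Suc n) * h) \<omega> = x" by blast+
      moreover from this(2,3,4) have "phase_event h x S (Suc n) \<omega>" by (rule phase_event_Suc_hold)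
      ultimately show "\<omega> \<in> {\<omega> \<in> space (P x). phase_event h x S (Suc n) \<omega> \<and> X (real (Suc n) * h) \<omega> = x}" by blast
    qed
    finally show ?thesis .
  qed
  have M0: "M n y \<ge> 0" for n y by (simp add: M_def)
  have main: "c - real n * b \<le> M n x * c + (\<Sum>y\<in>S. M n y * g y)" for n
  proof (induction n)
    case 0
    have "{\<omega> \<in> space (P x). phase_event h x S 0 \<omega> \<and> X (real 0 * h) \<omega> = x} = {\<omega> \<in> space (P x). X 0 \<omega> = x}"
      unfolding phase_event_def no_return_def by auto
    then have "M 0 x = 1" using start[of x] by (simp only: M_def)
    then show ?case using M0 gpos by (simp add: sum_nonneg)
  next
    case (Suc n)
    have "(\<Sum>y\<in>S. M n y * b) \<le> b" using mult_right_mono[OF Msum[of n] b] by (simp add: sum_distrib_right)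
    then have "c - real (Suc n) * b \<le> M n x * c + (\<Sum>y\<in>S. M n y * (g y - b))"
      using Suc by (simp add: algebra_simps sum_subtractf)
    also have "\<dots> \<le> M n x * (c * tp h x x + (\<Sum>z\<in>S. tp h x z * g z)) + (\<Sum>y\<in>S. M n y * (\<Sum>z\<in>S. tp h y z * g z))"
      by (intro add_mono mult_left_mono sum_mono away hold M0)
    also have "\<dots> = M n x * tp h x x * c + (\<Sum>z\<in>S. (M n x * tp h x z + (\<Sum>y\<in>S. M n y * tp h y z)) * g z)"
    proof -
      have "(\<Sum>y\<in>S. M n y * (\<Sum>z\<in>S. tp h y z * g z)) = (\<Sum>z\<in>S. (\<Sum>y\<in>S. M n y * tp h y z) * g z)"
        by (simp only: sum_distrib_left sum_distrib_right mult.assoc) (rule sum.swap)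
      then show ?thesis by (simp add: distrib_left distrib_right sum.distrib sum_distrib_left mult_ac)
    qed
    also have "\<dots> \<le> M (Suc n) x * c + (\<Sum>z\<in>S. M (Suc n) z * g z)"
      by (intro add_mono mult_right_mono sum_mono MS Mx c gpos)
    finally show ?case .
  qed
  have "c - real n * b \<le> M n x * c + (\<Sum>y\<in>S. M n y * g y)" by (rule main)
  also have "\<dots> \<le> M n x * 1 + (\<Sum>y\<in>S. M n y * 1)"
    by (intro add_mono mult_left_mono sum_mono c g M0)
  also have "\<dots> = (\<Sum>y\<in>insert x S. M n y)" using S by simp
  also have "\<dots> \<le> prob {\<omega> \<in> space (P x). no_return h x n \<omega>}" by (rule tot)
  finally show ?thesis .
qed

lemma no_return_dyadic_decseq: "decseq (\<lambda>j. {\<omega> \<in> space (P x). no_return (t / 2^j) x (2^j) \<omega>})"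
proof (rule decseq_SucI, rule subsetI)
  fix j \<omega> assume "\<omega> \<in> {\<omega> \<in> space (P x). no_return (t / 2^Suc j) x (2^Suc j) \<omega>}"
  then have w: "\<omega> \<in> space (P x)" "no_return (t / 2^Suc j) x (2^Suc j) \<omega>" by auto
  have eq: "real (2 * k) * (t / 2^Suc j) = real k * (t / 2^j)" for k by simp
  have "no_return (t / 2^j) x (2^j) \<omega>"
    unfolding no_return_def
  proof (intro allI impI)
    fix i k :: nat assume ik: "i < k" "k \<le> 2^j" "X (real i * (t / 2^j)) \<omega> \<noteq> x"
    then show "X (real k * (t / 2^j)) \<omega> \<noteq> x"
      using w(2)[unfolded no_return_def, rule_format, of "2 * i" "2 * k"] unfolding eq by simp
  qed
  with w show "\<omega> \<in> {\<omega> \<in> space (P x). no_return (t / 2^j) x (2^j) \<omega>}" by simp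
qed

text \<open>A return before \<open>t\<close> involves a time away from \<open>x\<close> and a later
  time at \<open>x\<close>. Both states persist for a while, so some dyadic grid sees them in this
  order.\<close>

lemma return_time_ge:
  assumes w: "\<omega> \<in> space (P x)" and t: "0 < t" and nr: "\<And>j. no_return (t / 2^j) x (2^j) \<omega>"
  shows "ennreal t \<le> return_time X x \<omega>"
  unfolding return_time_def
proof (rule Inf_greatest)
  fix e assume "e \<in> ennreal ` {t. 0 \<le> t \<and> X t \<omega> = x \<and> (\<exists>s\<in>{0..t}. X s \<omega> \<noteq> x)}"
  then obtain u s where u: "e = ennreal u" "0 \<le> u" "X u \<omega> = x" and s: "0 \<le> s" "s \<le> u" "X s \<omega> \<noteq> x" by auto
  have "t \<le> u"
  proof (rule ccontr)
    assume "\<not> t \<le> u"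
    then have ut: "u < t" by simp
    have su: "s < u" using s u by (cases "s = u") auto
    obtain a where a: "a > 0" "\<forall>r\<in>{s..<s+a}. X r \<omega> = X s \<omega>" using right_cont[OF w s(1)] by blast
    obtain b where b: "b > 0" "\<forall>r\<in>{u..<u+b}. X r \<omega> = X u \<omega>" using right_cont[OF w u(2)] by blast
    from a b have a0: "0 < a" and b0: "0 < b" by simp_all
    \<comment> \<open>The bound \<open>u\<close> in the minimum keeps the grid time away from
      \<open>x\<close> ahead of the grid time at \<open>x\<close>.\<close>
    obtain J1 where J1: "\<forall>j\<ge>J1. \<exists>k\<le>2^j. s \<le> real k * (t / 2^j) \<and> real k * (t / 2^j) < min (s + a) u"
      using dyadic_between[of s t "min (s + a) u"] s su ut a0 s(1) t by auto
    obtain J2 where J2: "\<forall>j\<ge>J2. \<exists>k\<le>2^j. u \<le> real k * (t / 2^j) \<and> real k * (t / 2^j) < u + b"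
      using dyadic_between[of u t "u + b"] u(2) ut b0 t by auto
    define j where "j = max J1 J2"
    obtain i where i: "i \<le> 2^j" "s \<le> real i * (t / 2^j)" "real i * (t / 2^j) < min (s + a) u"
      using J1[rule_format, of j] by (auto simp: j_def)
    obtain k where k: "k \<le> 2^j" "u \<le> real k * (t / 2^j)" "real k * (t / 2^j) < u + b"
      using J2[rule_format, of j] by (auto simp: j_def)
    have "real i * (t / 2^j) < real k * (t / 2^j)" using i k by linarith
    then have "i < k" using t by (simp add: mult_less_cancel_right divide_less_cancel)
    moreover have "X (real i * (t / 2^j)) \<omega> \<noteq> x" using bspec[OF a(2), of "real i * (t / 2^j)"] i s(3) by simp
    moreover have "X (real k * (t / 2^j)) \<omega> = x" using bspec[OF b(2), of "real k * (t / 2^j)"] k u(3) by simp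
    ultimately show False using nr[of j] k(1) unfolding no_return_def by blast
  qed
  then show "ennreal t \<le> e" using u by (simp add: ennreal_leI)
qed

text \<open>Markov's inequality: the mean is at least \<open>t\<close> times the probability of no
  return before \<open>t\<close>, and the latter is at least \<open>c - b * t\<close>. By
  \<open>hold\<close>, the function equal to \<open>c\<close> before the departure and to
  \<open>g\<close> afterwards has positive drift at \<open>x\<close>.\<close>

lemma nn_integral_return_time_ge:
  assumes S: "finite S" "x \<notin> S" and t: "0 < t" and b: "0 \<le> b" and c: "c \<le> 1" "0 \<le> c"
    and g: "\<And>z. z \<in> S \<Longrightarrow> g z \<le> 1" "\<And>z. z \<notin> S \<Longrightarrow> g z = 0" "\<And>z. z \<in> S \<Longrightarrow> 0 \<le> g z"
    and away: "\<And>y. y \<in> S \<Longrightarrow> - b < generator q g y"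
    and hold: "0 < c * generator q (\<lambda>w. if w = x then 1 else 0) x + generator q g x"
  shows "ennreal (t * (c - b * t)) \<le> (\<integral>\<^sup>+\<omega>. return_time X x \<omega> \<partial>P x)"
proof -
  interpret prob_space "P x" by (rule prob_space_P)
  let ?E = "\<lambda>j. {\<omega> \<in> space (P x). no_return (t / 2^j) x (2^j) \<omega>}"
  have Em: "?E j \<in> sets (P x)" for j using t by (intro grid_sets[OF _ determined_no_return]) simp
  have Im: "(\<Inter>j. ?E j) \<in> sets (P x)" by (rule sets.countable_INT, rule image_subsetI, rule Em, simp)
  have 1: "eventually (\<lambda>h. - b < ((\<Sum>z\<in>S. tp h y z * g z) - g y) / h) (at_right 0)" if "y \<in> S" for y
    by (rule order_tendstoD(1)[OF generator_limit_finite away[OF that]]) (use S g in auto)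
  have "((\<lambda>h. c * ((tp h x x - 1) / h) + ((\<Sum>z\<in>S. tp h x z * g z) - g x) / h) \<longlongrightarrow>
      c * generator q (\<lambda>w. if w = x then 1 else 0) x + generator q g x) (at_right 0)"
    using generator_limit_finite[of "{x}" "\<lambda>w. if w = x then 1 else 0" x] generator_limit_finite[of S g x] S g
    by (intro tendsto_intros) auto
  from order_tendstoD(1)[OF this hold]
  have 2: "eventually (\<lambda>h. 0 < c * ((tp h x x - 1) / h) + ((\<Sum>z\<in>S. tp h x z * g z) - g x) / h) (at_right 0)" .
  have "eventually (\<lambda>h. 0 < h \<and> 0 < c * ((tp h x x - 1) / h) + ((\<Sum>z\<in>S. tp h x z * g z) - g x) / h \<and>
      (\<forall>y\<in>S. - b < ((\<Sum>z\<in>S. tp h y z * g z) - g y) / h)) (at_right 0)"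
    using eventually_at_right_less[of "0::real"] 1 2 S(1) by (auto simp: eventually_conj_iff eventually_ball_finite_distrib)
  from eventually_compose_filterlim[OF this dyadic_mesh[OF t]]
  have "eventually (\<lambda>j. c - b * t \<le> prob (?E j)) sequentially"
  proof eventually_elim
    case (elim j)
    define h where "h = t / 2^j"
    have h: "0 < h" "0 < c * ((tp h x x - 1) / h) + ((\<Sum>z\<in>S. tp h x z * g z) - g x) / h"
      "\<And>y. y \<in> S \<Longrightarrow> - b < ((\<Sum>z\<in>S. tp h y z * g z) - g y) / h"
      using elim unfolding h_def by auto
    have "c - real (2^j) * (b * h) \<le> prob {\<omega> \<in> space (P x). no_return h x (2^j) \<omega>}"
    proof (rule phase_functional_ge[OF _ S _ c g(1) _ _ g(3)])
      show "g y - b * h \<le> (\<Sum>z\<in>S. tp h y z * g z)" if "y \<in> S" for y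
        using h(3)[OF that] unfolding pos_less_divide_eq[OF h(1)] by (simp add: algebra_simps)
      have "c * ((tp h x x - 1) / h) + ((\<Sum>z\<in>S. tp h x z * g z) - g x) / h =
         (c * tp h x x + (\<Sum>z\<in>S. tp h x z * g z) - c) / h"
        using g(2)[OF S(2)] by (simp add: right_diff_distrib add_divide_distrib diff_divide_distrib)
      then show "c \<le> c * tp h x x + (\<Sum>z\<in>S. tp h x z * g z)"
        using h(1,2) by (simp add: zero_less_divide_iff)
    qed (use h b in auto)
    moreover have "real (2^j) * (b * h) = b * t" by (simp add: h_def)
    ultimately show ?case unfolding h_def by simp
  qed
  then have "c - b * t \<le> prob (\<Inter>j. ?E j)"
    by (intro tendsto_lowerbound[OF finite_Lim_measure_decseq[OF image_subsetI[OF Em] no_return_dyadic_decseq]]) auto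
  then have "ennreal (t * (c - b * t)) \<le> ennreal (t * prob (\<Inter>j. ?E j))"
    using t by (intro ennreal_leI mult_left_mono) auto
  also have "\<dots> = (\<integral>\<^sup>+\<omega>. ennreal t * indicator (\<Inter>j. ?E j) \<omega> \<partial>P x)"
    using t by (subst nn_integral_cmult_indicator[OF Im]) (simp add: emeasure_eq_measure ennreal_mult)
  also have "\<dots> \<le> (\<integral>\<^sup>+\<omega>. return_time X x \<omega> \<partial>P x)"
  proof (intro nn_integral_mono)
    fix \<omega> assume w: "\<omega> \<in> space (P x)"
    show "ennreal t * indicator (\<Inter>j. ?E j) \<omega> \<le> return_time X x \<omega>"
    proof (cases "\<omega> \<in> (\<Inter>j. ?E j)")
      case True
      then have "\<And>j. no_return (t / 2^j) x (2^j) \<omega>" by blast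
      from return_time_ge[OF w t this] show ?thesis using True by simp
    qed simp
  qed
  finally show ?thesis .
qed

text \<open>For fixed \<open>t\<close> the loss \<open>b N * t\<close> vanishes with
  \<open>N\<close>, so the mean return time is at least \<open>c * t\<close> for every
  \<open>t\<close>. A sequence is used because each \<open>g N\<close> must have finite
  support.\<close>

lemma not_positive_recurrentI:
  assumes S: "\<And>N::nat. finite (S N)" "\<And>N. x \<notin> S N" and c: "c \<le> 1" "0 < c"
    and g: "\<And>N z. z \<in> S N \<Longrightarrow> g N z \<le> 1" "\<And>N z. z \<notin> S N \<Longrightarrow> g N z = 0" "\<And>N z. z \<in> S N \<Longrightarrow> 0 \<le> g N z"
    and b: "\<And>N. 0 \<le> b N" "b \<longlonglongrightarrow> 0"
    and away: "\<And>N y. y \<in> S N \<Longrightarrow> - b N < generator q (g N) y"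
    and hold: "\<And>N. 0 < c * generator q (\<lambda>w. if w = x then 1 else 0) x + generator q (g N) x"
  shows "\<not> positive_recurrent P X"
proof
  assume "positive_recurrent P X"
  then have fin: "(\<integral>\<^sup>+\<omega>. return_time X x \<omega> \<partial>P x) < \<infinity>" (is "?I < _") by (simp add: positive_recurrent_def)
  have low: "ennreal (t * c) \<le> ?I" if t: "0 < t" for t
  proof (rule LIMSEQ_le_const2)
    have "(\<lambda>N. t * (c - b N * t)) \<longlonglongrightarrow> t * (c - 0 * t)" by (intro tendsto_intros b)
    then show "(\<lambda>N. ennreal (t * (c - b N * t))) \<longlonglongrightarrow> ennreal (t * c)" by (simp add: tendsto_ennrealI)
    show "\<exists>M. \<forall>N\<ge>M. ennreal (t * (c - b N * t)) \<le> ?I"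
      using nn_integral_return_time_ge[OF S t b(1) c(1) less_imp_le[OF c(2)] g away hold] by blast
  qed
  from fin obtain v where v: "?I = ennreal v" "0 \<le> v" by (cases "?I" rule: ennreal_cases) auto
  have "ennreal ((v + 1) / c * c) \<le> ennreal v" using low[of "(v + 1) / c"] v c(2) by simp
  then show False using c(2) v by simp
qed

end

section \<open>The two-queue network in exponential coordinates\<close>

text \<open>The parameters are \<open>a = p\<^sub>1\<^sub>2\<close> and \<open>b = p\<^sub>2\<^sub>1\<close>, so the exit probabilities are \<open>1 - a\<close> and \<open>1 - b\<close>;
  \<open>(x, y)\<close> stands for \<open>(exp \<alpha>\<^sub>1, exp \<alpha>\<^sub>2)\<close>.\<close>
definition net_R :: "real \<Rightarrow> real \<Rightarrow> real \<Rightarrow> real \<Rightarrow> real \<Rightarrow> real \<Rightarrow> real \<Rightarrow> real \<Rightarrow> real" where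
  "net_R l1 l2 m1 m2 a b x y =
     m1 * ((a * y + 1 - a) / x - 1) + m2 * ((b * x + 1 - b) / y - 1) + l1 * (x - 1) + l2 * (y - 1)"

definition net_G :: "real \<Rightarrow> real \<Rightarrow> real \<Rightarrow> real \<Rightarrow> real \<Rightarrow> real \<Rightarrow> (nat \<Rightarrow> nat \<Rightarrow> real) \<Rightarrow> nat \<Rightarrow> nat \<Rightarrow> real" where
  "net_G l1 l2 m1 m2 a b F m n =
     l1 * (F (Suc m) n - F m n) + l2 * (F m (Suc n) - F m n)
     + (case m of 0 \<Rightarrow> 0 | Suc k \<Rightarrow> m1 * ((1 - a) * (F k n - F m n) + a * (F k (Suc n) - F m n)))
     + (case n of 0 \<Rightarrow> 0 | Suc k \<Rightarrow> m2 * ((1 - b) * (F m k - F m n) + b * (F (Suc m) k - F m n)))"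

lemma net_R_swap: "net_R l2 l1 m2 m1 b a y x = net_R l1 l2 m1 m2 a b x y"
  by (simp add: net_R_def)

lemma net_G_swap: "net_G l2 l1 m2 m1 b a (\<lambda>i j. F j i) n m = net_G l1 l2 m1 m2 a b F m n"
  unfolding net_G_def by simp

locale two_queues =
  fixes l1 l2 m1 m2 a b :: real
  assumes l1: "0 \<le> l1" and l2: "0 \<le> l2" and m1: "0 < m1" and m2: "0 < m2"
    and a: "0 \<le> a" "a \<le> 1" and b: "0 \<le> b" "b \<le> 1" and ab: "a * b < 1"
    and flow1: "0 < l1 + l2 * b" and flow2: "0 < l2 + l1 * a"
begin

abbreviation "R \<equiv> net_R l1 l2 m1 m2 a b"
abbreviation "G \<equiv> net_G l1 l2 m1 m2 a b"

lemma swapped: "two_queues l2 l1 m2 m1 b a"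
  using l1 l2 m1 m2 a b ab flow1 flow2 by unfold_locales (auto simp: mult.commute)

text \<open>Vanishing of both derivatives of \<open>R\<close> in logarithmic coordinates. The terms
  are jump rates of the twisted walk: each equation balances the upward against the downward jumps
  of one queue.\<close>

definition stationary :: "real \<Rightarrow> real \<Rightarrow> bool" where
  "stationary x y \<longleftrightarrow> l1 * x + m2 * b * x / y = m1 * (a * y + 1 - a) / x \<and>
     l2 * y + m1 * a * y / x = m2 * (b * x + 1 - b) / y"

text \<open>On the line the \<open>m2\<close> term of \<open>R\<close> vanishes; the second equation
  says that the rest is stationary along the line.\<close>

definition axis_stationary :: "real \<Rightarrow> real \<Rightarrow> bool" where
  "axis_stationary x y \<longleftrightarrow> y = b * x + 1 - b \<and> (1 - a * b) * m1 = (l1 + l2 * b) * x\<^sup>2"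

lemma line_pos: "0 < x \<Longrightarrow> 0 < b * x + 1 - b"
proof -
  assume x: "0 < x"
  have "0 \<le> b * x" using x b by simp
  moreover have "0 < b * x" if "b = 1" using x that by simp
  ultimately show ?thesis using b by (cases "b = 1") auto
qed

lemma ln_bound: "0 < t \<Longrightarrow> 1 + ln t \<le> (t::real)"
  using ln_le_minus_one[of t] by simp

text \<open>Up to a constant \<open>R\<close> is a sum of six monomials in the ratios
  \<open>u\<close> and \<open>v\<close> with nonnegative coefficients. Each monomial is at least 1
  plus its logarithm, and the logarithms cancel by stationarity; this is the tangent inequality of a
  convex function.\<close>

lemma stationary_minimal:
  assumes x0: "0 < x0" "0 < y0" and st: "stationary x0 y0" and x: "0 < x" "0 < y"
  shows "R x0 y0 \<le> R x y"
proof -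
  define A1 A2 A3 A4 A5 A6 where "A1 = l1 * x0" and "A2 = l2 * y0" and "A3 = m1 * (1 - a) / x0"
    and "A4 = m1 * a * y0 / x0" and "A5 = m2 * (1 - b) / y0" and "A6 = m2 * b * x0 / y0"
  note A = A1_def A2_def A3_def A4_def A5_def A6_def
  have nn: "0 \<le> A1" "0 \<le> A2" "0 \<le> A3" "0 \<le> A4" "0 \<le> A5" "0 \<le> A6"
    unfolding A using l1 l2 m1 m2 a b x0 by simp_all
  define u v where "u = x / x0" and "v = y / y0"
  have uv: "0 < u" "0 < v" using x x0 by (simp_all add: u_def v_def)
  have R: "R x y = A1 * u + A2 * v + A3 * (1 / u) + A4 * (v / u) + A5 * (1 / v) + A6 * (u / v) - (l1 + l2 + m1 + m2)"
    unfolding A net_R_def u_def v_def using x x0 by (simp add: field_simps)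
  have R0: "R x0 y0 = A1 + A2 + A3 + A4 + A5 + A6 - (l1 + l2 + m1 + m2)"
    unfolding A net_R_def using x0 by (simp add: field_simps)
  have st1: "A1 + A6 = A3 + A4"
    using st unfolding stationary_def A by (simp add: add_divide_distrib diff_divide_distrib algebra_simps)
  have st2: "A2 + A4 = A5 + A6"
    using st unfolding stationary_def A by (simp add: add_divide_distrib diff_divide_distrib algebra_simps)
  have "A1 * (1 + ln u) \<le> A1 * u" "A2 * (1 + ln v) \<le> A2 * v" "A3 * (1 + ln (1 / u)) \<le> A3 * (1 / u)"
    "A4 * (1 + ln (v / u)) \<le> A4 * (v / u)" "A5 * (1 + ln (1 / v)) \<le> A5 * (1 / v)" "A6 * (1 + ln (u / v)) \<le> A6 * (u / v)"
    using nn uv by (intro mult_left_mono ln_bound; simp)+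
  moreover have "A1 * (1 + ln u) + A2 * (1 + ln v) + A3 * (1 + ln (1 / u)) + A4 * (1 + ln (v / u)) + A5 * (1 + ln (1 / v)) + A6 * (1 + ln (u / v))
    = A1 + A2 + A3 + A4 + A5 + A6 + ((A1 + A6) - (A3 + A4)) * ln u + ((A2 + A4) - (A5 + A6)) * ln v"
    using uv by (simp add: ln_div algebra_simps)
  ultimately show ?thesis unfolding R R0 st1 st2 by simp
qed

lemma R_on_line:
  assumes "0 < x" shows "R x (b * x + 1 - b) = (1 - a * b) * m1 * (1 / x - 1) + (l1 + l2 * b) * (x - 1)"
  using line_pos[OF assms] assms unfolding net_R_def by (simp add: field_simps)

end

text \<open>Below the line the \<open>m2\<close>-term of \<open>R\<close> is nonnegative, so \<open>m2\<close> may be lowered to the value that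
  makes the point stationary.\<close>
lemma (in two_queues) axis_stationary_minimal:
  assumes x0: "0 < x0" and st: "axis_stationary x0 y0" and le: "y0 * (l2 + m1 * a / x0) \<le> m2"
    and x: "0 < x" "0 < y" "y \<le> b * x + 1 - b"
  shows "R x0 y0 \<le> R x y"
proof -
  have y0: "y0 = b * x0 + 1 - b" "(1 - a * b) * m1 = (l1 + l2 * b) * x0\<^sup>2"
    using st by (simp_all add: axis_stationary_def)
  have y0p: "0 < y0" unfolding y0 by (rule line_pos[OF x0])
  define m where "m = y0 * (l2 + m1 * a / x0)"
  have dm: "net_R l1 l2 m1 m a b x y \<le> R x y"
  proof -
    have "0 \<le> (m2 - m) * ((b * x + 1 - b) / y - 1)"
      using le x unfolding m_def by (intro mult_nonneg_nonneg) (auto simp: field_simps)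
    moreover have "R x y - net_R l1 l2 m1 m a b x y = (m2 - m) * ((b * x + 1 - b) / y - 1)"
      unfolding net_R_def by (simp only: left_diff_distrib)
    ultimately show ?thesis by linarith
  qed
  have eq: "net_R l1 l2 m1 m a b x0 y0 = R x0 y0"
    unfolding net_R_def y0(1)[symmetric] using y0p by simp
  have st2: "l2 * y0 + m1 * a * y0 / x0 = m" by (simp add: m_def algebra_simps)
  have st1: "l1 * x0 + m * b * x0 / y0 = m1 * (a * y0 + 1 - a) / x0"
  proof -
    have "l1 * x0 + m * b * x0 / y0 = l1 * x0 + b * x0 * (l2 + m1 * a / x0)" using y0p by (simp add: m_def)
    also have "\<dots> = (l1 + l2 * b) * x0 + m1 * a * b" using x0 by (simp add: field_simps)
    also have "\<dots> = (1 - a * b) * m1 / x0 + m1 * a * b" unfolding y0(2) using x0 by (simp add: power2_eq_square)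
    also have "\<dots> = m1 * (a * y0 + 1 - a) / x0" unfolding y0(1) using x0 by (simp add: field_simps)
    finally show ?thesis .
  qed
  show ?thesis
  proof (cases "0 < m")
    case True
    interpret T: two_queues l1 l2 m1 m a b
      using l1 l2 m1 True a b ab flow1 flow2 by unfold_locales
    have "T.stationary x0 y0"
      unfolding T.stationary_def using st1 st2 y0p unfolding y0(1)[symmetric] by simp
    from T.stationary_minimal[OF x0 y0p this x(1,2)] show ?thesis using dm eq by simp
  next
    \<comment> \<open>The lowered rate could vanish only if queue 2 received no work at all, against
      \<open>flow2\<close>.\<close>
    case False
    have "0 \<le> l2 + m1 * a / x0" using l2 m1 a x0 by simp
    then have z: "l2 + m1 * a / x0 = 0"
      using False y0p unfolding m_def by (simp add: zero_less_mult_iff not_less order_antisym)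
    moreover have "0 \<le> m1 * a / x0" using m1 a x0 by simp
    ultimately have "l2 = 0" "m1 * a / x0 = 0" using l2 by linarith+
    then have "l2 = 0" "a = 0" using m1 x0 by simp_all
    then show ?thesis using flow2 by simp
  qed
qed

section \<open>Test functions at critical points\<close>

text \<open>The bump \<open>(1 - w\<^sup>2/L\<^sup>2)\<^sup>2\<close> is convex near its zeros. This beats the boundary
  terms there, while in the middle its concavity costs only a small multiple of the bump itself.\<close>
lemma bump_increment:
  fixes w J L :: real
  assumes L: "4 \<le> L" and w: "\<bar>w\<bar> \<le> L" and J: "\<bar>J\<bar> \<le> 1"
  defines "\<phi> \<equiv> \<lambda>w. 1 - w\<^sup>2 / L\<^sup>2"
  shows "(\<phi> (w + J))\<^sup>2 - (\<phi> w)\<^sup>2 \<ge> - (4 * \<phi> w * w / L\<^sup>2) * J + J\<^sup>2 / L\<^sup>2 * (3 - 6 * \<phi> w)"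
proof -
  have L2: "0 < L\<^sup>2" using L by simp
  \<comment> \<open>\<open>D\<close> is the increase of \<open>w\<^sup>2\<close>, so
    \<open>\<phi>\<close> drops by \<open>D / L\<^sup>2\<close>. The convexity that is exploited
    sits in the square of this drop.\<close>
  define D where "D = 2 * w * J + J\<^sup>2"
  have phi: "\<phi> (w + J) = \<phi> w - D / L\<^sup>2"
  proof -
    have "(w + J)\<^sup>2 = w\<^sup>2 + D" by (simp add: D_def power2_eq_square algebra_simps)
    then show ?thesis by (simp add: \<phi>_def add_divide_distrib)
  qed
  have "(\<phi> (w + J))\<^sup>2 - (\<phi> w)\<^sup>2 = - 2 * \<phi> w * D / L\<^sup>2 + D\<^sup>2 / (L\<^sup>2)\<^sup>2"
    unfolding phi by (simp add: power2_diff power_divide)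
  moreover have "D\<^sup>2 \<ge> J\<^sup>2 * (L\<^sup>2 * (3 - 4 * \<phi> w))"
  proof -
    have "(2 * w + J)\<^sup>2 \<ge> 4 * w\<^sup>2 - 4 * \<bar>w\<bar>"
    proof -
      have "\<bar>w * J\<bar> \<le> \<bar>w\<bar> * 1" unfolding abs_mult using J by (intro mult_left_mono) auto
      then have "- \<bar>w\<bar> \<le> w * J" by linarith
      moreover have "(2 * w + J)\<^sup>2 = 4 * w\<^sup>2 + 4 * (w * J) + J\<^sup>2" by (simp add: power2_eq_square algebra_simps)
      ultimately show ?thesis using zero_le_power2[of J] by linarith
    qed
    moreover have "4 * w\<^sup>2 - 4 * \<bar>w\<bar> \<ge> L\<^sup>2 * (3 - 4 * \<phi> w)"
    proof -
      have "L\<^sup>2 * (3 - 4 * \<phi> w) = 4 * w\<^sup>2 - L\<^sup>2" using L2 by (simp add: \<phi>_def field_simps)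
      moreover have "4 * \<bar>w\<bar> \<le> L\<^sup>2"
        using mult_mono[OF L w] L by (simp add: power2_eq_square)
      ultimately show ?thesis by simp
    qed
    ultimately have "J\<^sup>2 * (L\<^sup>2 * (3 - 4 * \<phi> w)) \<le> J\<^sup>2 * (2 * w + J)\<^sup>2" by (intro mult_left_mono) auto
    also have "\<dots> = D\<^sup>2" by (simp add: D_def power2_eq_square algebra_simps)
    finally show ?thesis .
  qed
  then have "D\<^sup>2 / (L\<^sup>2)\<^sup>2 \<ge> J\<^sup>2 * (L\<^sup>2 * (3 - 4 * \<phi> w)) / (L\<^sup>2)\<^sup>2" using L2 by (intro divide_right_mono) auto
  moreover have "J\<^sup>2 * (L\<^sup>2 * (3 - 4 * \<phi> w)) / (L\<^sup>2)\<^sup>2 = J\<^sup>2 / L\<^sup>2 * (3 - 4 * \<phi> w)"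
    using L2 by (simp add: power2_eq_square)
  moreover have "- 2 * \<phi> w * D / L\<^sup>2 = - (4 * \<phi> w * w / L\<^sup>2) * J - J\<^sup>2 / L\<^sup>2 * (2 * \<phi> w)"
    by (simp add: D_def diff_divide_distrib add_divide_distrib power2_eq_square algebra_simps)
  moreover have "J\<^sup>2 / L\<^sup>2 * (3 - 6 * \<phi> w) = J\<^sup>2 / L\<^sup>2 * (3 - 4 * \<phi> w) - J\<^sup>2 / L\<^sup>2 * (2 * \<phi> w)"
    by (simp only: right_diff_distrib[symmetric]) simp
  ultimately show ?thesis by linarith
qed

text \<open>The generator at the state \<open>(Suc k, n)\<close> of a walk with the jumps (1,0),
  (0,1), (-1,0), (-1,1), (0,-1), (1,-1), in this order of the rates. The test functions live away
  from the axis where the first coordinate is 0, so only the boundary \<open>n = 0\<close> is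
  modelled.\<close>

definition walk_G :: "real \<Rightarrow> real \<Rightarrow> real \<Rightarrow> real \<Rightarrow> real \<Rightarrow> real \<Rightarrow> (nat \<Rightarrow> nat \<Rightarrow> real) \<Rightarrow> nat \<Rightarrow> nat \<Rightarrow> real" where
  "walk_G A1 A2 A3 A4 A5 A6 h k n =
     A1 * (h (Suc (Suc k)) n - h (Suc k) n) + A2 * (h (Suc k) (Suc n) - h (Suc k) n)
     + A3 * (h k n - h (Suc k) n) + A4 * (h k (Suc n) - h (Suc k) n)
     + (case n of 0 \<Rightarrow> 0 | Suc j \<Rightarrow> A5 * (h (Suc k) j - h (Suc k) n) + A6 * (h (Suc (Suc k)) j - h (Suc k) n))"

text \<open>The boundary \<open>n = 0\<close> does not break the identity when
  \<open>(x, y)\<close> lies on the line.\<close>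
lemma net_G_twist:
  assumes x: "x \<noteq> 0" "y \<noteq> 0" and n: "n = 0 \<Longrightarrow> y = b * x + 1 - b"
  shows "net_G l1 l2 m1 m2 a b (\<lambda>m n. x ^ m * y ^ n * h m n) (Suc k) n =
    x ^ Suc k * y ^ n * (walk_G (l1 * x) (l2 * y) (m1 * (1 - a) / x) (m1 * a * y / x) (m2 * (1 - b) / y) (m2 * b * x / y) h k n
      + net_R l1 l2 m1 m2 a b x y * h (Suc k) n)"
proof (cases n)
  case 0
  then have y: "b * x + 1 - b = y" using n by simp
  show ?thesis unfolding 0 net_G_def walk_G_def net_R_def y using x by (simp add: field_simps)
next
  case (Suc j)
  show ?thesis unfolding Suc net_G_def walk_G_def net_R_def using x by (simp add: field_simps)
qed

context two_queues begin

text \<open>A subsolution on its own support. Placing the support outside a box lets it avoid any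
  prescribed finite set of states.\<close>

definition test_function :: "real \<Rightarrow> nat \<Rightarrow> (nat \<Rightarrow> nat \<Rightarrow> real) \<Rightarrow> bool" where
  "test_function \<rho> N F \<longleftrightarrow> (\<forall>m n. 0 \<le> F m n) \<and> finite {(m, n). 0 < F m n} \<and> (\<exists>m n. 0 < F m n) \<and>
     (\<forall>m n. 0 < F m n \<longrightarrow> (N < m \<or> N < n) \<and> \<rho> * F m n \<le> G F m n)"

text \<open>The twisted walk with weights \<open>x ^ m * y ^ n\<close> is positive recurrent in the second coordinate and
  leaves the linear function \<open>m + c * n\<close> harmonic; the test function is a long bump in this
  direction, cut off in the second coordinate by an exponential supersolution.\<close>
lemma axis_test_function:
  assumes x: "0 < x" and st: "axis_stationary x y" and stable: "y * (l2 + m1 * a / x) < m2" and eps: "0 < \<epsilon>"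
  shows "\<exists>F. test_function (R x y - \<epsilon>) N F"
proof -
  have yx: "y = b * x + 1 - b" and crit: "(1 - a * b) * m1 = (l1 + l2 * b) * x\<^sup>2"
    using st by (simp_all add: axis_stationary_def)
  have y: "0 < y" unfolding yx by (rule line_pos[OF x])
  define A1 A2 A3 A4 A5 A6 where "A1 = l1 * x" and "A2 = l2 * y" and "A3 = m1 * (1 - a) / x"
    and "A4 = m1 * a * y / x" and "A5 = m2 * (1 - b) / y" and "A6 = m2 * b * x / y"
  note A = A1_def A2_def A3_def A4_def A5_def A6_def
  have nn: "0 \<le> A1" "0 \<le> A2" "0 \<le> A3" "0 \<le> A4" "0 \<le> A5" "0 \<le> A6"
    unfolding A using l1 l2 m1 m2 a b x y by simp_all
  have A56: "A5 + A6 = m2"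
  proof -
    have "A5 + A6 = m2 * (b * x + 1 - b) / y" unfolding A add_divide_distrib[symmetric] by (simp add: algebra_simps)
    then show ?thesis unfolding yx[symmetric] using y by simp
  qed
  \<comment> \<open>In the twisted walk a departure from queue 2 goes to queue 1 with probability
    \<open>b * x / y\<close>. Weighting the customers of queue 2 by this number makes such
    departures neutral for \<open>m + c * n\<close> on average, so the drift is the same on and off
    the axis \<open>n = 0\<close>.\<close>
  define c where "c = b * x / y"
  have c: "0 \<le> c" "c \<le> 1" "1 - c = (1 - b) / y"
    unfolding c_def using b x y yx by (auto simp: field_simps)
  have driftd: "A5 * (- c) + A6 * (1 - c) = 0"
    unfolding c(3) unfolding c_def A using y by (simp add: field_simps)
  \<comment> \<open>The jumps other than departures from queue 2 balance because the point is
    stationary along the line.\<close>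
  have drift0: "A1 + A2 * c - A3 + A4 * (c - 1) = 0"
  proof -
    have e1: "A1 + A2 * c = (l1 + l2 * b) * x" unfolding A c_def using y by (simp add: field_simps)
    have e2: "A4 * (c - 1) = - (m1 * a * (1 - b) / x)"
    proof -
      have "c - 1 = - ((1 - b) / y)" using c(3) by simp
      then show ?thesis unfolding A using y by simp
    qed
    have "(l1 + l2 * b) * x = (1 - a * b) * m1 / x" unfolding crit using x by (simp add: power2_eq_square)
    then have "A1 + A2 * c - A3 + A4 * (c - 1) = (1 - a * b) * m1 / x - m1 * (1 - a) / x - m1 * a * (1 - b) / x"
      using e1 e2 by (simp add: A3_def)
    also have "\<dots> = 0" using x by (simp add: field_simps)
    finally show ?thesis .
  qed
  \<comment> \<open>The variance rate of \<open>m + c * n\<close> on the axis, where queue 2 has no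
    departures; \<open>v1\<close> is the rate off the axis.\<close>
  define v0 where "v0 = A1 + A2 * c\<^sup>2 + A3 + A4 * (1 - c)\<^sup>2"
  have v0: "0 < v0"
  proof (cases "l1 = 0")
    case True
    then have "0 < l2 * b" using flow1 by simp
    then have "0 < A2" "0 < c" unfolding A c_def using l2 b x y by (auto simp: zero_less_mult_iff)
    then have "0 < A2 * c\<^sup>2" by simp
    then show ?thesis unfolding v0_def using nn by (simp add: add_nonneg_pos add_pos_nonneg)
  next
    case False
    then have "0 < A1" using l1 x unfolding A by simp
    then show ?thesis unfolding v0_def using nn by (simp add: add_pos_nonneg)
  qed
  define v1 where "v1 = v0 + A5 * c\<^sup>2 + A6 * (1 - c)\<^sup>2"
  have v1: "v0 \<le> v1" unfolding v1_def using nn by simp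
  define D where "D = A2 + A4"
  have Dm: "D < m2" "0 \<le> D" using stable nn unfolding D_def A by (simp_all add: algebra_simps)
  \<comment> \<open>Off the axis the drift of \<open>s ^ n\<close> with
    \<open>s = 1 + \<tau>\<close> is \<open>- \<kappa> * s ^ n\<close>, negative by the first bound.
    On the axis \<open>s ^ n\<close> grows at rate \<open>D * \<tau>\<close>; the second bound keeps
    this at most \<open>v0 / 9\<close>, so that the curvature of the bump can pay for it.\<close>
  define \<tau> where "\<tau> = min ((m2 - D) / (D + 1)) (v0 / (9 * (D + 1)))"
  have tau: "0 < \<tau>" unfolding \<tau>_def using Dm v0 by simp
  have tau1: "\<tau> * (D + 1) \<le> m2 - D" "9 * (\<tau> * (D + 1)) \<le> v0"
  proof -
    have "\<tau> \<le> (m2 - D) / (D + 1)" "\<tau> \<le> v0 / (9 * (D + 1))" unfolding \<tau>_def by simp_all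
    then show "\<tau> * (D + 1) \<le> m2 - D" "9 * (\<tau> * (D + 1)) \<le> v0" using Dm(2) by (simp_all add: field_simps)
  qed
  have tau2: "\<tau> * D < m2 - D" "9 * (\<tau> * D) \<le> v0"
    using tau1 tau by (simp_all add: distrib_left)
  define s where "s = 1 + \<tau>"
  have s: "1 < s" using tau by (simp add: s_def)
  define \<kappa> where "\<kappa> = m2 * (1 - 1 / s) - D * (s - 1)"
  have kappa: "0 < \<kappa>"
  proof -
    have "\<kappa> = \<tau> * (m2 - D * s) / s" unfolding \<kappa>_def using s by (simp add: s_def field_simps)
    moreover have "0 < m2 - D * s" using tau2 by (simp add: s_def algebra_simps)
    ultimately show ?thesis using tau s by simp
  qed
  define \<epsilon>' where "\<epsilon>' = min \<epsilon> (min \<kappa> (v0 / 9))"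
  have e': "0 < \<epsilon>'" "\<epsilon>' \<le> \<epsilon>" "\<epsilon>' \<le> \<kappa>" "\<epsilon>' \<le> v0 / 9" unfolding \<epsilon>'_def using eps kappa v0 by auto
  \<comment> \<open>The concavity of the bump costs at most order \<open>v1 / L\<^sup>2\<close>,
    which has to be small against \<open>\<epsilon>'\<close>.\<close>
  define L where "L = max 4 (9 * v1 / \<epsilon>')"
  have L4: "4 \<le> L" unfolding L_def by simp
  have L2e: "9 * v1 \<le> L\<^sup>2 * \<epsilon>'"
  proof -
    have "9 * v1 / \<epsilon>' \<le> L" unfolding L_def by simp
    also have "L \<le> L * L" using L4 by (simp add: mult_le_cancel_left1)
    finally show ?thesis using e' by (simp add: field_simps power2_eq_square)
  qed
  have L2: "0 < L\<^sup>2" using L4 by simp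
  \<comment> \<open>Positive \<open>h\<close> then forces \<open>\<phi> > 3 / L\<close>. A jump
    raises the square of \<open>w\<close> by at most \<open>3 * L\<close>, hence lowers
    \<open>\<phi>\<close> by at most \<open>3 / L\<close>, so every neighbour stays in the range
    \<open>\<bar>w\<bar> \<le> L\<close> where the bump formula bounds \<open>h\<close> from
    below.\<close>
  define \<delta> where "\<delta> = 9 / L\<^sup>2"
  have delta: "0 < \<delta>" unfolding \<delta>_def using L2 by simp
  obtain n1 where n1: "L\<^sup>2 < s ^ n1" using real_arch_pow[OF s] by blast
  \<comment> \<open>On the support \<open>n < n1\<close> and \<open>c \<le> 1\<close>, so this
    centre keeps the first coordinate beyond \<open>N\<close>.\<close>
  obtain Z :: nat where Z: "real N + L + real n1 < real Z" using reals_Archimedean2 by blast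
  define w where "w m n = real m + c * real n - real Z" for m n :: nat
  define \<phi> where "\<phi> u = 1 - u\<^sup>2 / L\<^sup>2" for u :: real
  define h where "h m n = (if \<bar>w m n\<bar> \<le> L then max 0 ((\<phi> (w m n))\<^sup>2 - \<delta> * s ^ n) else 0)" for m n
  have h0: "0 \<le> h m n" for m n unfolding h_def by simp
  have pos: "\<bar>w m n\<bar> \<le> L" "\<delta> * s ^ n < (\<phi> (w m n))\<^sup>2" "3 / L < \<phi> (w m n)" "\<phi> (w m n) \<le> 1" "n < n1" "N < m"
    if hp: "0 < h m n" for m n
  proof -
    show wL: "\<bar>w m n\<bar> \<le> L" using hp unfolding h_def by (simp split: if_splits)
    show d: "\<delta> * s ^ n < (\<phi> (w m n))\<^sup>2" using hp wL unfolding h_def by simp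
    have w2: "(w m n)\<^sup>2 \<le> L\<^sup>2" using wL by (rule abs_le_square_iff[THEN iffD1, of _ L, simplified, OF order_trans]) (use L4 in auto)
    have p0: "0 \<le> \<phi> (w m n)" unfolding \<phi>_def using w2 L2 by simp
    show p1: "\<phi> (w m n) \<le> 1" unfolding \<phi>_def by simp
    have "(3 / L)\<^sup>2 \<le> \<delta> * s ^ n"
      using s delta mult_left_mono[OF one_le_power[of s n], of \<delta>] by (simp add: \<delta>_def power_divide)
    then have "(3 / L)\<^sup>2 < (\<phi> (w m n))\<^sup>2" using d by simp
    then show "3 / L < \<phi> (w m n)" using p0 by (rule power_less_imp_less_base)
    have "(\<phi> (w m n))\<^sup>2 \<le> 1" using p0 p1 by (simp add: power_le_one)
    then have "\<delta> * s ^ n < 1" using d by simp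
    then have "s ^ n < L\<^sup>2" unfolding \<delta>_def using L2 by (simp add: field_simps) (smt (verit) zero_le_power s)
    then have "s ^ n < s ^ n1" using n1 by simp
    then show nn1: "n < n1" using s by (simp add: power_strict_increasing_iff)
    have "c * real n \<le> 1 * real n" using c by (intro mult_right_mono) auto
    moreover have "real n \<le> real n1" using nn1 by simp
    ultimately have "real N < real m" using wL Z unfolding w_def by linarith
    then show "N < m" by simp
  qed
  have nb: "h m' n' \<ge> (\<phi> (w m' n'))\<^sup>2 - \<delta> * s ^ n'"
    if hp: "0 < h m n" and J: "\<bar>w m' n' - w m n\<bar> \<le> 1" for m n m' n'
  proof -
    let ?w = "w m n" and ?w' = "w m' n'"
    have "?w'\<^sup>2 \<le> (\<bar>?w\<bar> + 1)\<^sup>2" by (rule abs_le_square_iff[THEN iffD1]) (use J in linarith)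
    also have "\<dots> = ?w\<^sup>2 + (2 * \<bar>?w\<bar> + 1)" by (simp add: power2_eq_square algebra_simps)
    also have "\<dots> \<le> ?w\<^sup>2 + 3 * L" using pos(1)[OF hp] L4 by simp
    also have "?w\<^sup>2 = L\<^sup>2 * (1 - \<phi> ?w)" unfolding \<phi>_def using L2 by simp
    also have "L\<^sup>2 * (1 - \<phi> ?w) + 3 * L \<le> L\<^sup>2"
    proof -
      have "L\<^sup>2 * (3 / L) \<le> L\<^sup>2 * \<phi> ?w" using pos(3)[OF hp] L2 by (intro mult_left_mono) auto
      then show ?thesis using L4 by (simp add: power2_eq_square algebra_simps)
    qed
    finally have "\<bar>?w'\<bar> \<le> L" using L4 abs_le_square_iff[of ?w' L] by simp
    then show ?thesis unfolding h_def by simp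
  qed
  have inc: "(\<phi> (w m n + J))\<^sup>2 - (\<phi> (w m n))\<^sup>2 \<ge> - (4 * \<phi> (w m n) * w m n / L\<^sup>2) * J + J\<^sup>2 * ((3 - 6 * \<phi> (w m n)) / L\<^sup>2)"
    if "0 < h m n" "\<bar>J\<bar> \<le> 1" for m n J
    using bump_increment[OF L4 pos(1)[OF that(1)] that(2)] unfolding \<phi>_def by simp
  have key: "walk_G A1 A2 A3 A4 A5 A6 h k n \<ge> - \<epsilon>' * h (Suc k) n" if hp: "0 < h (Suc k) n" for k n
  proof -
    define u where "u = w (Suc k) n"
    define e where "e = (3 - 6 * \<phi> u) / L\<^sup>2"
    define C where "C = 4 * \<phi> u * u / L\<^sup>2"
    have hv: "h (Suc k) n = (\<phi> u)\<^sup>2 - \<delta> * s ^ n"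
      using pos(1,2)[OF hp] unfolding h_def u_def by simp
    have inc': "(\<phi> (u + J))\<^sup>2 - (\<phi> u)\<^sup>2 \<ge> - C * J + J\<^sup>2 * e" if "\<bar>J\<bar> \<le> 1" for J
      using inc[OF hp that] unfolding u_def C_def e_def .
    have w1: "w (Suc (Suc k)) n = u + 1" and w2: "w (Suc k) (Suc n) = u + c" and w3: "w k n = u + (-1)"
      and w4: "w k (Suc n) = u + (c - 1)"
      unfolding u_def w_def by (simp_all add: algebra_simps)
    have J: "\<bar>1::real\<bar> \<le> 1" "\<bar>c\<bar> \<le> 1" "\<bar>-1::real\<bar> \<le> 1" "\<bar>c - 1\<bar> \<le> 1" "\<bar>- c\<bar> \<le> 1" "\<bar>1 - c\<bar> \<le> 1"
      using c(1,2) by auto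
    have hb: "h (Suc (Suc k)) n - h (Suc k) n \<ge> - C * 1 + 1\<^sup>2 * e"
       "h (Suc k) (Suc n) - h (Suc k) n \<ge> - C * c + c\<^sup>2 * e - \<delta> * s ^ n * (s - 1)"
       "h k n - h (Suc k) n \<ge> - C * (-1) + (-1)\<^sup>2 * e"
       "h k (Suc n) - h (Suc k) n \<ge> - C * (c - 1) + (c - 1)\<^sup>2 * e - \<delta> * s ^ n * (s - 1)"
      using nb[OF hp, of "Suc (Suc k)" n] nb[OF hp, of "Suc k" "Suc n"] nb[OF hp, of k n] nb[OF hp, of k "Suc n"]
        inc'[OF J(1)] inc'[OF J(2)] inc'[OF J(3)] inc'[OF J(4)] J
      unfolding w1 w2 w3 w4 u_def[symmetric] hv by (simp_all add: algebra_simps)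
    have q: "(1 - c)\<^sup>2 = (c - 1)\<^sup>2" by (simp add: power2_commute)
    have base: "A1 * (h (Suc (Suc k)) n - h (Suc k) n) + A2 * (h (Suc k) (Suc n) - h (Suc k) n)
     + A3 * (h k n - h (Suc k) n) + A4 * (h k (Suc n) - h (Suc k) n) \<ge> v0 * e - \<delta> * s ^ n * (D * (s - 1))"
    proof -
      have "A1 * (- C * 1 + 1\<^sup>2 * e) + A2 * (- C * c + c\<^sup>2 * e - \<delta> * s ^ n * (s - 1))
        + A3 * (- C * (-1) + (-1)\<^sup>2 * e) + A4 * (- C * (c - 1) + (c - 1)\<^sup>2 * e - \<delta> * s ^ n * (s - 1)) =
        - C * (A1 + A2 * c - A3 + A4 * (c - 1)) + v0 * e - \<delta> * s ^ n * (D * (s - 1))"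
        unfolding v0_def D_def q by (simp add: algebra_simps)
      also have "\<dots> = v0 * e - \<delta> * s ^ n * (D * (s - 1))" unfolding drift0 by simp
      finally have eq: "A1 * (- C * 1 + 1\<^sup>2 * e) + A2 * (- C * c + c\<^sup>2 * e - \<delta> * s ^ n * (s - 1))
        + A3 * (- C * (-1) + (-1)\<^sup>2 * e) + A4 * (- C * (c - 1) + (c - 1)\<^sup>2 * e - \<delta> * s ^ n * (s - 1)) =
        v0 * e - \<delta> * s ^ n * (D * (s - 1))" .
      show ?thesis unfolding eq[symmetric] by (intro add_mono mult_left_mono hb nn)
    qed
    have quad: "6 * t - 3 \<le> 3 * t\<^sup>2" for t :: real
      using zero_le_power2[of "t - 1"] by (simp add: power2_eq_square algebra_simps)
    show ?thesis
    proof (cases n)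
      case 0
      \<comment> \<open>On the axis nothing pulls \<open>s ^ n\<close> down. Its growth is paid out
        of the constant 3 in \<open>e\<close>, which leaves \<open>2 - 6 * \<phi> u\<close>.\<close>
      have dB: "\<delta> * (D * (s - 1)) \<le> v0 / L\<^sup>2"
        unfolding \<delta>_def s_def using tau2(2) L2 by (simp add: field_simps)
      have "v0 * e - \<delta> * (D * (s - 1)) \<ge> (v0 * (2 - 6 * \<phi> u)) / L\<^sup>2"
      proof -
        have "v0 * e = v0 * (2 - 6 * \<phi> u) / L\<^sup>2 + v0 / L\<^sup>2"
          unfolding e_def add_divide_distrib[symmetric] by (simp add: algebra_simps)
        then show ?thesis using dB by linarith
      qed
      moreover have "(v0 * (2 - 6 * \<phi> u)) / L\<^sup>2 \<ge> - \<epsilon>' * ((\<phi> u)\<^sup>2 - \<delta>)"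
      proof -
        have "9 * v0 \<le> L\<^sup>2 * \<epsilon>'" using L2e v1 by simp
        then have "9 * v0 * (\<phi> u)\<^sup>2 \<le> L\<^sup>2 * \<epsilon>' * (\<phi> u)\<^sup>2" by (intro mult_right_mono) auto
        moreover have "6 * \<phi> u \<le> 9 * (\<phi> u)\<^sup>2 + 1"
          using zero_le_power2[of "3 * \<phi> u - 1"] by (simp add: power2_eq_square algebra_simps)
        then have "v0 * (6 * \<phi> u) \<le> v0 * (9 * (\<phi> u)\<^sup>2 + 1)" using v0 by (intro mult_left_mono) auto
        moreover have "L\<^sup>2 * \<epsilon>' * \<delta> \<le> v0" unfolding \<delta>_def using e'(4) L2 by (simp add: field_simps)
        ultimately have "- (L\<^sup>2 * (\<epsilon>' * ((\<phi> u)\<^sup>2 - \<delta>))) \<le> v0 * (2 - 6 * \<phi> u)" by (simp add: algebra_simps)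
        then show ?thesis using L2 by (simp add: field_simps)
      qed
      ultimately show ?thesis using base hv unfolding walk_G_def 0 by simp
    next
      case (Suc j)
      have w5: "w (Suc k) j = u + (- c)" and w6: "w (Suc (Suc k)) j = u + (1 - c)"
        unfolding u_def w_def Suc by (simp_all add: algebra_simps)
      have sj: "s ^ j = s ^ n / s" unfolding Suc using s by simp
      have hb2: "h (Suc k) j - h (Suc k) n \<ge> - C * (- c) + (- c)\<^sup>2 * e + \<delta> * s ^ n * (1 - 1 / s)"
        "h (Suc (Suc k)) j - h (Suc k) n \<ge> - C * (1 - c) + (1 - c)\<^sup>2 * e + \<delta> * s ^ n * (1 - 1 / s)"
        using nb[OF hp, of "Suc k" j] nb[OF hp, of "Suc (Suc k)" j] inc'[OF J(5)] inc'[OF J(6)] J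
        unfolding w5 w6 u_def[symmetric] hv sj by (simp_all add: algebra_simps)
      have dep: "A5 * (h (Suc k) j - h (Suc k) n) + A6 * (h (Suc (Suc k)) j - h (Suc k) n) \<ge>
          (v1 - v0) * e + \<delta> * s ^ n * (m2 * (1 - 1 / s))"
      proof -
        have "A5 * (- C * (- c) + (- c)\<^sup>2 * e + \<delta> * s ^ n * t) + A6 * (- C * (1 - c) + (1 - c)\<^sup>2 * e + \<delta> * s ^ n * t) =
          - C * (A5 * (- c) + A6 * (1 - c)) + (v1 - v0) * e + \<delta> * s ^ n * ((A5 + A6) * t)" for t
          unfolding v1_def by (simp add: algebra_simps)
        note this[of "1 - 1 / s"]
        also have "- C * (A5 * (- c) + A6 * (1 - c)) + (v1 - v0) * e + \<delta> * s ^ n * ((A5 + A6) * (1 - 1 / s)) = (v1 - v0) * e + \<delta> * s ^ n * (m2 * (1 - 1 / s))" unfolding driftd A56 by simp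
        finally have eq: "A5 * (- C * (- c) + (- c)\<^sup>2 * e + \<delta> * s ^ n * (1 - 1 / s)) + A6 * (- C * (1 - c) + (1 - c)\<^sup>2 * e + \<delta> * s ^ n * (1 - 1 / s)) =
          (v1 - v0) * e + \<delta> * s ^ n * (m2 * (1 - 1 / s))" .
        show ?thesis unfolding eq[symmetric] by (intro add_mono mult_left_mono hb2 nn)
      qed
      \<comment> \<open>Off the axis the subtracted term \<open>s ^ n\<close> decreases on average,
        so it contributes a gain.\<close>
      have "walk_G A1 A2 A3 A4 A5 A6 h k n \<ge> v1 * e + \<delta> * s ^ n * \<kappa>"
        using base dep unfolding walk_G_def Suc \<kappa>_def by (simp add: algebra_simps)
      moreover have "v1 * e \<ge> - \<epsilon>' * (\<phi> u)\<^sup>2"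
      proof -
        have "v1 * (6 * \<phi> u - 3) \<le> v1 * (3 * (\<phi> u)\<^sup>2)" using quad[of "\<phi> u"] v0 v1 by (intro mult_left_mono) auto
        also have "\<dots> = 3 * v1 * (\<phi> u)\<^sup>2" by simp
        also have "\<dots> \<le> L\<^sup>2 * \<epsilon>' * (\<phi> u)\<^sup>2" using L2e v0 v1 by (intro mult_right_mono) auto
        finally show ?thesis unfolding e_def using L2 by (simp add: field_simps)
      qed
      moreover have "\<delta> * s ^ n * \<kappa> \<ge> \<delta> * s ^ n * \<epsilon>'" using e'(3) delta s by (intro mult_left_mono) auto
      ultimately show ?thesis unfolding hv by (simp add: algebra_simps)
    qed
  qed
  define F where "F m n = x ^ m * y ^ n * h m n" for m n
  have Fp: "0 < F m n \<longleftrightarrow> 0 < h m n" for m n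
  proof -
    have "0 < x ^ m * y ^ n" using x y by simp
    then show ?thesis using h0[of m n] by (auto simp: F_def zero_less_mult_iff)
  qed
  have "test_function (R x y - \<epsilon>) N F"
    unfolding test_function_def
  proof (intro conjI allI impI)
    show "0 \<le> F m n" for m n unfolding F_def using x y h0 by simp
    show "finite {(m, n). 0 < F m n}"
    proof (rule finite_subset)
      show "{(m, n). 0 < F m n} \<subseteq> {..nat \<lceil>real Z + L\<rceil>} \<times> {..n1}"
      proof clarify
        fix m n assume "0 < F m n"
        then have hp: "0 < h m n" by (simp add: Fp)
        have "0 \<le> c * real n" using c by simp
        then have "real m \<le> real Z + L" using pos(1)[OF hp] unfolding w_def by linarith
        then have "m \<le> nat \<lceil>real Z + L\<rceil>" by linarith
        then show "m \<in> {..nat \<lceil>real Z + L\<rceil>} \<and> n \<in> {..n1}" using pos(5)[OF hp] by simp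
      qed
    qed simp
    have "h Z 0 = 1 - \<delta>"
    proof -
      have "\<delta> < 1" unfolding \<delta>_def using L4 mult_mono[OF L4 L4] by (simp add: power2_eq_square field_simps)
      then show ?thesis unfolding h_def w_def \<phi>_def using L4 by simp
    qed
    moreover have "\<delta> < 1" unfolding \<delta>_def using L4 mult_mono[OF L4 L4] by (simp add: power2_eq_square field_simps)
    ultimately show "\<exists>m n. 0 < F m n" unfolding Fp by (intro exI[of _ Z] exI[of _ 0]) simp
    fix m n assume "0 < F m n"
    then have hp: "0 < h m n" by (simp add: Fp)
    show "N < m \<or> N < n" using pos(6)[OF hp] ..
    then obtain k where k: "m = Suc k" using pos(6)[OF hp] by (cases m) auto
    have "(R x y - \<epsilon>) * F m n = x ^ m * y ^ n * (- \<epsilon> * h m n + R x y * h m n)"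
      unfolding F_def by (simp add: algebra_simps)
    also have "\<dots> \<le> x ^ m * y ^ n * (walk_G A1 A2 A3 A4 A5 A6 h k n + R x y * h m n)"
    proof (intro mult_left_mono add_right_mono)
      have "- \<epsilon> * h m n \<le> - \<epsilon>' * h m n" using e'(2) h0 by (simp add: mult_right_mono)
      also have "\<dots> \<le> walk_G A1 A2 A3 A4 A5 A6 h k n" using key hp unfolding k by simp
      finally show "- \<epsilon> * h m n \<le> walk_G A1 A2 A3 A4 A5 A6 h k n" .
    qed (use x y in auto)
    also have "\<dots> = G F m n"
      unfolding F_def k A using net_G_twist[of x y n b l1 l2 m1 m2 a h k] x y yx by simp
    finally show "(R x y - \<epsilon>) * F m n \<le> G F m n" .
  qed
  then show ?thesis by blast
qed

end

text \<open>The squared norm of \<open>w\<close> changes by \<open>2 * p + r\<close>, where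
  \<open>p\<close> is the inner product with the jump and \<open>r \<le> 2\<close>. The square of
  this change keeps the convex part \<open>4 * p\<^sup>2\<close>, which turns into the covariance
  form when averaged over the jumps; the cross term with \<open>r\<close> is the error linear in
  \<open>L\<close>.\<close>

lemma bump2_increment:
  fixes w1 w2 i j L :: real
  assumes L: "1 \<le> L" and w: "w1\<^sup>2 + w2\<^sup>2 \<le> L\<^sup>2" and J: "\<bar>i\<bar> \<le> 1" "\<bar>j\<bar> \<le> 1"
  defines "\<phi> \<equiv> \<lambda>u v. 1 - (u\<^sup>2 + v\<^sup>2) / L\<^sup>2"
  shows "(\<phi> (w1 + i) (w2 + j))\<^sup>2 - (\<phi> w1 w2)\<^sup>2 \<ge>
      - (4 * \<phi> w1 w2 / L\<^sup>2) * (w1 * i + w2 * j) + (4 / (L\<^sup>2)\<^sup>2) * (w1 * i + w2 * j)\<^sup>2 - (4 * \<phi> w1 w2 / L\<^sup>2 + 16 * L / (L\<^sup>2)\<^sup>2)"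
    and "\<phi> (w1 + i) (w2 + j) \<ge> \<phi> w1 w2 - (4 * L + 2) / L\<^sup>2"
proof -
  have L2: "0 < L\<^sup>2" using L by simp
  define p where "p = w1 * i + w2 * j"
  define r where "r = i\<^sup>2 + j\<^sup>2"
  define f where "f = \<phi> w1 w2"
  define D where "D = 2 * p + r"
  have ij: "i\<^sup>2 \<le> 1" "j\<^sup>2 \<le> 1" using J by (simp_all add: abs_square_le_1)
  have r: "0 \<le> r" "r \<le> 2" unfolding r_def using ij by simp_all
  have w12: "\<bar>w1\<bar> \<le> L" "\<bar>w2\<bar> \<le> L"
  proof -
    have "w1\<^sup>2 \<le> L\<^sup>2" "w2\<^sup>2 \<le> L\<^sup>2" using w zero_le_power2[of w1] zero_le_power2[of w2] by linarith+
    then show "\<bar>w1\<bar> \<le> L" "\<bar>w2\<bar> \<le> L" using L abs_le_square_iff[of w1 L] abs_le_square_iff[of w2 L] by simp_all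
  qed
  have "\<bar>w1 * i\<bar> \<le> L * 1" "\<bar>w2 * j\<bar> \<le> L * 1"
    unfolding abs_mult using w12 J L by (intro mult_mono; simp)+
  then have p: "\<bar>p\<bar> \<le> 2 * L" unfolding p_def by linarith
  have f0: "0 \<le> f" unfolding f_def \<phi>_def using w L2 by simp
  have phi: "\<phi> (w1 + i) (w2 + j) = f - D / L\<^sup>2"
  proof -
    have "(w1 + i)\<^sup>2 + (w2 + j)\<^sup>2 = w1\<^sup>2 + w2\<^sup>2 + D"
      by (simp add: D_def p_def r_def power2_eq_square algebra_simps)
    then have "((w1 + i)\<^sup>2 + (w2 + j)\<^sup>2) / L\<^sup>2 = (w1\<^sup>2 + w2\<^sup>2) / L\<^sup>2 + D / L\<^sup>2" by (simp only: add_divide_distrib)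
    then show ?thesis by (simp only: f_def \<phi>_def diff_diff_eq)
  qed
  have "D \<le> 4 * L + 2" using p r unfolding D_def by linarith
  then show "\<phi> (w1 + i) (w2 + j) \<ge> \<phi> w1 w2 - (4 * L + 2) / L\<^sup>2"
    unfolding phi f_def[symmetric] using L2 by (simp add: divide_right_mono)
  have "(\<phi> (w1 + i) (w2 + j))\<^sup>2 - f\<^sup>2 = - 2 * f * D / L\<^sup>2 + D\<^sup>2 / (L\<^sup>2)\<^sup>2"
    unfolding phi by (simp add: power2_diff power_divide)
  moreover have "- 2 * f * D / L\<^sup>2 \<ge> - (4 * f / L\<^sup>2) * p - 4 * f / L\<^sup>2"
  proof -
    have "2 * f * r \<le> 2 * f * 2" using r f0 by (intro mult_left_mono) auto
    then have "- 2 * f * D \<ge> - (4 * f * p) - 4 * f" unfolding D_def by (simp add: algebra_simps)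
    then have "- 2 * f * D / L\<^sup>2 \<ge> (- (4 * f * p) - 4 * f) / L\<^sup>2" using L2 by (intro divide_right_mono) auto
    then show ?thesis by (simp add: diff_divide_distrib)
  qed
  moreover have "D\<^sup>2 / (L\<^sup>2)\<^sup>2 \<ge> (4 / (L\<^sup>2)\<^sup>2) * p\<^sup>2 - 16 * L / (L\<^sup>2)\<^sup>2"
  proof -
    have "\<bar>p * r\<bar> \<le> (2 * L) * 2" unfolding abs_mult using p r L by (intro mult_mono) auto
    then have "- (4 * L) \<le> p * r" by linarith
    moreover have "D\<^sup>2 = 4 * p\<^sup>2 + 4 * (p * r) + r\<^sup>2" by (simp add: D_def power2_eq_square algebra_simps)
    ultimately have "4 * p\<^sup>2 - 16 * L \<le> D\<^sup>2" using zero_le_power2[of r] by linarith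
    then have "(4 * p\<^sup>2 - 16 * L) / (L\<^sup>2)\<^sup>2 \<le> D\<^sup>2 / (L\<^sup>2)\<^sup>2" by (intro divide_right_mono) auto
    then show ?thesis by (simp add: diff_divide_distrib)
  qed
  ultimately show "(\<phi> (w1 + i) (w2 + j))\<^sup>2 - (\<phi> w1 w2)\<^sup>2 \<ge>
      - (4 * \<phi> w1 w2 / L\<^sup>2) * (w1 * i + w2 * j) + (4 / (L\<^sup>2)\<^sup>2) * (w1 * i + w2 * j)\<^sup>2 - (4 * \<phi> w1 w2 / L\<^sup>2 + 16 * L / (L\<^sup>2)\<^sup>2)"
    unfolding f_def[symmetric] p_def[symmetric] by linarith
qed

text \<open>The three squares belong to the three jump directions of the twisted walk; any two of
  them control both coordinates.\<close>

lemma quadratic_form_definite: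
  fixes A B C :: real
  assumes "0 \<le> A" "0 \<le> B" "0 \<le> C" and two: "0 < A \<and> 0 < B \<or> 0 < A \<and> 0 < C \<or> 0 < B \<and> 0 < C"
  obtains k where "0 < k" "\<And>u v. k * (u\<^sup>2 + v\<^sup>2) \<le> A * u\<^sup>2 + B * v\<^sup>2 + C * (u - v)\<^sup>2"
proof -
  have diff: "v\<^sup>2 \<le> 2 * u\<^sup>2 + 2 * (u - v)\<^sup>2" for u v :: real
    using zero_le_power2[of "2 * u - v"] by (simp add: power2_eq_square algebra_simps)
  consider (AB) "0 < A" "0 < B" | (AC) "0 < A" "0 < C" | (BC) "0 < B" "0 < C" using two by blast
  then show ?thesis
  proof cases
    case AB
    show ?thesis
    proof (rule that[of "min A B"])
      fix u v
      have "min A B * u\<^sup>2 \<le> A * u\<^sup>2" "min A B * v\<^sup>2 \<le> B * v\<^sup>2" "0 \<le> C * (u - v)\<^sup>2" using assms by (simp_all add: mult_right_mono)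
      then show "min A B * (u\<^sup>2 + v\<^sup>2) \<le> A * u\<^sup>2 + B * v\<^sup>2 + C * (u - v)\<^sup>2" by (simp add: distrib_left)
    qed (use AB in simp)
  next
    case AC
    show ?thesis
    proof (rule that[of "min A C / 3"])
      fix u v
      have "min A C * u\<^sup>2 \<le> A * u\<^sup>2" "0 \<le> B * v\<^sup>2" "min A C * (u - v)\<^sup>2 \<le> C * (u - v)\<^sup>2" using assms by (simp_all add: mult_right_mono)
      moreover have "min A C / 3 * (u\<^sup>2 + v\<^sup>2) \<le> min A C / 3 * (3 * u\<^sup>2 + 3 * (u - v)\<^sup>2)"
        using AC diff[of v u] zero_le_power2[of "u - v"] by (intro mult_left_mono) (linarith, simp)
      moreover have "min A C / 3 * (3 * u\<^sup>2 + 3 * (u - v)\<^sup>2) = min A C * u\<^sup>2 + min A C * (u - v)\<^sup>2" by (simp add: algebra_simps)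
      ultimately show "min A C / 3 * (u\<^sup>2 + v\<^sup>2) \<le> A * u\<^sup>2 + B * v\<^sup>2 + C * (u - v)\<^sup>2" by linarith
    qed (use AC in simp)
  next
    case BC
    show ?thesis
    proof (rule that[of "min B C / 3"])
      fix u v
      have "min B C * v\<^sup>2 \<le> B * v\<^sup>2" "0 \<le> A * u\<^sup>2" "min B C * (u - v)\<^sup>2 \<le> C * (u - v)\<^sup>2" using assms by (simp_all add: mult_right_mono)
      moreover have "min B C / 3 * (u\<^sup>2 + v\<^sup>2) \<le> min B C / 3 * (3 * v\<^sup>2 + 3 * (u - v)\<^sup>2)"
      proof (rule mult_left_mono)
        show "u\<^sup>2 + v\<^sup>2 \<le> 3 * v\<^sup>2 + 3 * (u - v)\<^sup>2"
          using diff[of u v] zero_le_power2[of "u - v"] unfolding power2_commute[of v u] by linarith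
      qed (use BC in simp)
      moreover have "min B C / 3 * (3 * v\<^sup>2 + 3 * (u - v)\<^sup>2) = min B C * v\<^sup>2 + min B C * (u - v)\<^sup>2" by (simp add: algebra_simps)
      ultimately show "min B C / 3 * (u\<^sup>2 + v\<^sup>2) \<le> A * u\<^sup>2 + B * v\<^sup>2 + C * (u - v)\<^sup>2" by linarith
    qed (use BC in simp)
  qed
qed

text \<open>Without drift only the covariance form remains. It is definite, so near the rim of a
  large round bump the convexity term is positive of order \<open>1 / L\<^sup>2\<close>. The bump is
  centred at \<open>(Z, Z)\<close>, far from both axes.\<close>

lemma (in two_queues) interior_test_function:
  assumes x: "0 < x" and y: "0 < y" and st: "stationary x y" and eps: "0 < \<epsilon>"
  shows "\<exists>F. test_function (R x y - \<epsilon>) N F"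
proof -
  define A1 A2 A3 A4 A5 A6 where "A1 = l1 * x" and "A2 = l2 * y" and "A3 = m1 * (1 - a) / x"
    and "A4 = m1 * a * y / x" and "A5 = m2 * (1 - b) / y" and "A6 = m2 * b * x / y"
  note A = A1_def A2_def A3_def A4_def A5_def A6_def
  have nn: "0 \<le> A1" "0 \<le> A2" "0 \<le> A3" "0 \<le> A4" "0 \<le> A5" "0 \<le> A6"
    unfolding A using l1 l2 m1 m2 a b x y by simp_all
  have st1: "A1 + A6 = A3 + A4"
    using st unfolding stationary_def A by (simp add: add_divide_distrib diff_divide_distrib algebra_simps)
  have st2: "A2 + A4 = A5 + A6"
    using st unfolding stationary_def A by (simp add: add_divide_distrib diff_divide_distrib algebra_simps)
  have a1: "0 < A3" if "a < 1" unfolding A using that m1 x by simp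
  have b1: "0 < A5" if "b < 1" unfolding A using that m2 y by simp
  have ac: "0 < A4" if "0 < a" unfolding A using that m1 x y by simp
  have bc: "0 < A6" if "0 < b" unfolding A using that m2 x y by simp
  \<comment> \<open>\<open>a * b < 1\<close> excludes that each queue sends all its customers to the
    other, where \<open>A3\<close> and \<open>A5\<close> would both vanish.\<close>
  have two: "0 < A1 + A3 \<and> 0 < A2 + A5 \<or> 0 < A1 + A3 \<and> 0 < A4 + A6 \<or> 0 < A2 + A5 \<and> 0 < A4 + A6"
  proof (cases "a < 1")
    case True
    then show ?thesis using a1 b1 bc nn b by (cases "b < 1") (auto intro: add_nonneg_pos)
  next
    case False
    then have "a = 1" "b < 1" using a ab b by auto
    then show ?thesis using b1 ac nn by (auto intro: add_nonneg_pos add_pos_nonneg)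
  qed
  obtain k0 where k0: "0 < k0"
    and kq: "\<And>u v. k0 * (u\<^sup>2 + v\<^sup>2) \<le> (A1 + A3) * u\<^sup>2 + (A2 + A5) * v\<^sup>2 + (A4 + A6) * (u - v)\<^sup>2"
    by (rule quadratic_form_definite[of "A1 + A3" "A2 + A5" "A4 + A6"]) (use nn two that in auto)
  define V where "V = A1 + A2 + A3 + A4 + A5 + A6"
  have V: "0 \<le> V" unfolding V_def using nn by simp
  define \<epsilon>' where "\<epsilon>' = min \<epsilon> (k0 / 25)"
  have e': "0 < \<epsilon>'" "\<epsilon>' \<le> \<epsilon>" "25 * \<epsilon>' \<le> k0" unfolding \<epsilon>'_def using eps k0 by auto
  \<comment> \<open>The convexity provides \<open>4 * k0\<close>. The error
    \<open>16 * (V / L)\<close> may use \<open>2 * k0\<close> of it, the shift by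
    \<open>\<delta>\<close> uses \<open>k0\<close>, and the cost linear in \<open>\<phi>\<close>
    uses the last \<open>k0\<close> after completing a square against
    \<open>\<epsilon>' * L\<^sup>2 * \<phi>\<^sup>2\<close>.\<close>
  define L where "L = max 6 (max (8 * V / k0) (4 * (k0 + V)\<^sup>2 / (k0 * \<epsilon>')))"
  have L6: "6 \<le> L" unfolding L_def by simp
  have L2: "0 < L\<^sup>2" using L6 by simp
  have LV: "8 * V \<le> k0 * L"
  proof -
    have "8 * V / k0 \<le> L" unfolding L_def by simp
    then show ?thesis using k0 by (simp add: field_simps)
  qed
  have Le: "4 * (k0 + V)\<^sup>2 \<le> k0 * (\<epsilon>' * L\<^sup>2)"
  proof -
    have "4 * (k0 + V)\<^sup>2 / (k0 * \<epsilon>') \<le> L" unfolding L_def by simp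
    also have "L \<le> L\<^sup>2" using L6 by (simp add: power2_eq_square mult_le_cancel_left1)
    finally show ?thesis using k0 e' by (simp add: field_simps)
  qed
  \<comment> \<open>Positive \<open>h\<close> then means \<open>\<phi> > 5 / L\<close>, while one
    jump lowers \<open>\<phi>\<close> by at most
    \<open>(4 * L + 2) / L\<^sup>2 \<le> 5 / L\<close>.\<close>
  define \<delta> where "\<delta> = 25 / L\<^sup>2"
  have delta: "0 < \<delta>" unfolding \<delta>_def using L2 by simp
  obtain Z :: nat where Z: "real N + L < real Z" using reals_Archimedean2 by blast
  define w where "w m = real m - real Z" for m :: nat
  define \<phi> where "\<phi> u v = 1 - (u\<^sup>2 + v\<^sup>2) / L\<^sup>2" for u v :: real
  define h where "h m n = (if (w m)\<^sup>2 + (w n)\<^sup>2 \<le> L\<^sup>2 then max 0 ((\<phi> (w m) (w n))\<^sup>2 - \<delta>) else 0)" for m n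
  have h0: "0 \<le> h m n" for m n unfolding h_def by simp
  have inside: "(w m)\<^sup>2 + (w n)\<^sup>2 \<le> L\<^sup>2" "h m n = (\<phi> (w m) (w n))\<^sup>2 - \<delta>" "5 / L < \<phi> (w m) (w n)"
    if hp: "0 < h m n" for m n
  proof -
    show wL: "(w m)\<^sup>2 + (w n)\<^sup>2 \<le> L\<^sup>2" using hp unfolding h_def by (simp split: if_splits)
    show "h m n = (\<phi> (w m) (w n))\<^sup>2 - \<delta>" using hp wL unfolding h_def by (simp add: max_def split: if_splits)
    then have "(5 / L)\<^sup>2 < (\<phi> (w m) (w n))\<^sup>2" using hp by (simp add: \<delta>_def power_divide)
    moreover have "0 \<le> \<phi> (w m) (w n)" unfolding \<phi>_def using wL L2 by simp
    ultimately show "5 / L < \<phi> (w m) (w n)" by (rule power_less_imp_less_base)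
  qed
  have big: "N < m" "N < n" "real m \<le> real Z + L" "real n \<le> real Z + L" if hp: "0 < h m n" for m n
  proof -
    have "(w m)\<^sup>2 \<le> L\<^sup>2" "(w n)\<^sup>2 \<le> L\<^sup>2"
      using inside(1)[OF hp] zero_le_power2[of "w m"] zero_le_power2[of "w n"] by linarith+
    then have "\<bar>w m\<bar> \<le> L" "\<bar>w n\<bar> \<le> L" using L6 abs_le_square_iff[of "w m" L] abs_le_square_iff[of "w n" L] by simp_all
    then have "real N < real m" "real N < real n" "real m \<le> real Z + L" "real n \<le> real Z + L"
      using Z unfolding w_def by linarith+
    then show "N < m" "N < n" "real m \<le> real Z + L" "real n \<le> real Z + L" by simp_all
  qed
  have key: "walk_G A1 A2 A3 A4 A5 A6 h k (Suc l) \<ge> - \<epsilon>' * h (Suc k) (Suc l)" if hp: "0 < h (Suc k) (Suc l)" for k l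
  proof -
    define u v where "u = w (Suc k)" and "v = w (Suc l)"
    define f where "f = \<phi> u v"
    define c1 c2 c3 where "c1 = 4 * f / L\<^sup>2" and "c2 = 4 / (L\<^sup>2)\<^sup>2" and "c3 = 4 * f / L\<^sup>2 + 16 * L / (L\<^sup>2)\<^sup>2"
    have uv: "u\<^sup>2 + v\<^sup>2 \<le> L\<^sup>2" and hv: "h (Suc k) (Suc l) = f\<^sup>2 - \<delta>" and f5: "5 / L < f"
      using inside[OF hp] unfolding u_def v_def f_def by simp_all
    have step: "h m' n' - h (Suc k) (Suc l) \<ge> - c1 * (u * i + v * j) + c2 * (u * i + v * j)\<^sup>2 - c3"
      if w': "w m' = u + i" "w n' = v + j" and ij: "\<bar>i\<bar> \<le> 1" "\<bar>j\<bar> \<le> 1" for m' n' i j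
    proof -
      have L1: "1 \<le> L" using L6 by simp
      have inc: "(\<phi> (u + i) (v + j))\<^sup>2 - f\<^sup>2 \<ge> - c1 * (u * i + v * j) + c2 * (u * i + v * j)\<^sup>2 - c3"
        using bump2_increment(1)[OF L1 uv ij] unfolding c1_def c2_def c3_def f_def \<phi>_def .
      have "\<phi> (u + i) (v + j) \<ge> f - (4 * L + 2) / L\<^sup>2"
        using bump2_increment(2)[OF L1 uv ij] unfolding f_def \<phi>_def .
      moreover have "(4 * L + 2) / L\<^sup>2 \<le> 5 / L" using L6 by (simp add: power2_eq_square field_simps)
      ultimately have "0 \<le> \<phi> (u + i) (v + j)" using f5 by linarith
      then have "(w m')\<^sup>2 + (w n')\<^sup>2 \<le> L\<^sup>2" unfolding \<phi>_def w' using L2 by (simp add: field_simps)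
      then have "h m' n' \<ge> (\<phi> (u + i) (v + j))\<^sup>2 - \<delta>" unfolding h_def w' by simp
      then show ?thesis using inc hv by linarith
    qed
    have s1: "h (Suc (Suc k)) (Suc l) - h (Suc k) (Suc l) \<ge> - c1 * (u * 1 + v * 0) + c2 * (u * 1 + v * 0)\<^sup>2 - c3"
      by (rule step) (simp_all add: u_def v_def w_def)
    have s2: "h (Suc k) (Suc (Suc l)) - h (Suc k) (Suc l) \<ge> - c1 * (u * 0 + v * 1) + c2 * (u * 0 + v * 1)\<^sup>2 - c3"
      by (rule step) (simp_all add: u_def v_def w_def)
    have s3: "h k (Suc l) - h (Suc k) (Suc l) \<ge> - c1 * (u * (-1) + v * 0) + c2 * (u * (-1) + v * 0)\<^sup>2 - c3"
      by (rule step) (simp_all add: u_def v_def w_def)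
    have s4: "h k (Suc (Suc l)) - h (Suc k) (Suc l) \<ge> - c1 * (u * (-1) + v * 1) + c2 * (u * (-1) + v * 1)\<^sup>2 - c3"
      by (rule step) (simp_all add: u_def v_def w_def)
    have s5: "h (Suc k) l - h (Suc k) (Suc l) \<ge> - c1 * (u * 0 + v * (-1)) + c2 * (u * 0 + v * (-1))\<^sup>2 - c3"
      by (rule step) (simp_all add: u_def v_def w_def)
    have s6: "h (Suc (Suc k)) l - h (Suc k) (Suc l) \<ge> - c1 * (u * 1 + v * (-1)) + c2 * (u * 1 + v * (-1))\<^sup>2 - c3"
      by (rule step) (simp_all add: u_def v_def w_def)
    have "walk_G A1 A2 A3 A4 A5 A6 h k (Suc l) \<ge>
       A1 * (- c1 * (u * 1 + v * 0) + c2 * (u * 1 + v * 0)\<^sup>2 - c3) + A2 * (- c1 * (u * 0 + v * 1) + c2 * (u * 0 + v * 1)\<^sup>2 - c3)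
     + A3 * (- c1 * (u * (-1) + v * 0) + c2 * (u * (-1) + v * 0)\<^sup>2 - c3) + A4 * (- c1 * (u * (-1) + v * 1) + c2 * (u * (-1) + v * 1)\<^sup>2 - c3)
     + (A5 * (- c1 * (u * 0 + v * (-1)) + c2 * (u * 0 + v * (-1))\<^sup>2 - c3) + A6 * (- c1 * (u * 1 + v * (-1)) + c2 * (u * 1 + v * (-1))\<^sup>2 - c3))"
      unfolding walk_G_def nat.case by (intro add_mono mult_left_mono s1 s2 s3 s4 s5 s6 nn)
    also have "A1 * (- c1 * (u * 1 + v * 0) + c2 * (u * 1 + v * 0)\<^sup>2 - c3) + A2 * (- c1 * (u * 0 + v * 1) + c2 * (u * 0 + v * 1)\<^sup>2 - c3)
     + A3 * (- c1 * (u * (-1) + v * 0) + c2 * (u * (-1) + v * 0)\<^sup>2 - c3) + A4 * (- c1 * (u * (-1) + v * 1) + c2 * (u * (-1) + v * 1)\<^sup>2 - c3)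
     + (A5 * (- c1 * (u * 0 + v * (-1)) + c2 * (u * 0 + v * (-1))\<^sup>2 - c3) + A6 * (- c1 * (u * 1 + v * (-1)) + c2 * (u * 1 + v * (-1))\<^sup>2 - c3))
     = - c1 * (((A1 + A6) - (A3 + A4)) * u + ((A2 + A4) - (A5 + A6)) * v)
       + c2 * ((A1 + A3) * u\<^sup>2 + (A2 + A5) * v\<^sup>2 + (A4 + A6) * (u - v)\<^sup>2) - V * c3"
      unfolding V_def by (simp add: power2_eq_square algebra_simps)
    also have "\<dots> = c2 * ((A1 + A3) * u\<^sup>2 + (A2 + A5) * v\<^sup>2 + (A4 + A6) * (u - v)\<^sup>2) - V * c3"
      using st1 st2 by simp
    finally have low: "walk_G A1 A2 A3 A4 A5 A6 h k (Suc l) \<ge>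
      c2 * ((A1 + A3) * u\<^sup>2 + (A2 + A5) * v\<^sup>2 + (A4 + A6) * (u - v)\<^sup>2) - V * c3" .
    have "c2 * (k0 * (u\<^sup>2 + v\<^sup>2)) \<le> c2 * ((A1 + A3) * u\<^sup>2 + (A2 + A5) * v\<^sup>2 + (A4 + A6) * (u - v)\<^sup>2)"
      unfolding c2_def by (intro mult_left_mono kq) simp
    moreover have "u\<^sup>2 + v\<^sup>2 = L\<^sup>2 * (1 - f)" unfolding f_def \<phi>_def using L2 by simp
    moreover have "c2 * (k0 * (L\<^sup>2 * (1 - f))) - V * c3 = (4 * k0 - 4 * (k0 + V) * f - 16 * (V / L)) / L\<^sup>2"
      unfolding c2_def c3_def using L6 by (simp add: field_simps power2_eq_square)
    moreover have "(4 * k0 - 4 * (k0 + V) * f - 16 * (V / L)) / L\<^sup>2 \<ge> - \<epsilon>' * (f\<^sup>2 - \<delta>)"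
    proof -
      have "16 * (V / L) \<le> 2 * k0" using LV L6 by (simp add: field_simps)
      moreover have "L\<^sup>2 * \<epsilon>' * \<delta> \<le> k0" unfolding \<delta>_def using e'(3) L2 by simp
      moreover have "4 * (k0 + V) * f \<le> \<epsilon>' * L\<^sup>2 * f\<^sup>2 + k0"
      proof -
        have "4 * (k0 * ((k0 + V) * f)) \<le> 4 * ((k0 + V) * f)\<^sup>2 + k0\<^sup>2"
          using zero_le_power2[of "2 * ((k0 + V) * f) - k0"] by (simp add: power2_eq_square algebra_simps)
        also have "4 * ((k0 + V) * f)\<^sup>2 = 4 * (k0 + V)\<^sup>2 * f\<^sup>2" by (simp add: power_mult_distrib)
        also have "4 * (k0 + V)\<^sup>2 * f\<^sup>2 \<le> k0 * (\<epsilon>' * L\<^sup>2) * f\<^sup>2" by (intro mult_right_mono Le) simp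
        finally have "k0 * (4 * (k0 + V) * f) \<le> k0 * (\<epsilon>' * L\<^sup>2 * f\<^sup>2 + k0)" by (simp add: power2_eq_square algebra_simps)
        then show ?thesis using k0 by simp
      qed
      ultimately have "- (L\<^sup>2 * (\<epsilon>' * (f\<^sup>2 - \<delta>))) \<le> 4 * k0 - 4 * (k0 + V) * f - 16 * (V / L)"
        by (simp add: right_diff_distrib mult_ac)
      then show ?thesis using L2 by (simp add: pos_le_divide_eq mult_ac)
    qed
    ultimately show ?thesis using low hv by simp
  qed
  define F where "F m n = x ^ m * y ^ n * h m n" for m n
  have Fp: "0 < F m n \<longleftrightarrow> 0 < h m n" for m n
  proof -
    have "0 < x ^ m * y ^ n" using x y by simp
    then show ?thesis using h0[of m n] by (auto simp: F_def zero_less_mult_iff)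
  qed
  have "test_function (R x y - \<epsilon>) N F"
    unfolding test_function_def
  proof (intro conjI allI impI)
    show "0 \<le> F m n" for m n unfolding F_def using x y h0 by simp
    show "finite {(m, n). 0 < F m n}"
    proof (rule finite_subset)
      show "{(m, n). 0 < F m n} \<subseteq> {..nat \<lceil>real Z + L\<rceil>} \<times> {..nat \<lceil>real Z + L\<rceil>}"
      proof clarify
        fix m n assume "0 < F m n"
        then have hp: "0 < h m n" by (simp add: Fp)
        have "m \<le> nat \<lceil>real Z + L\<rceil>" "n \<le> nat \<lceil>real Z + L\<rceil>" using big(3,4)[OF hp] by linarith+
        then show "m \<in> {..nat \<lceil>real Z + L\<rceil>} \<and> n \<in> {..nat \<lceil>real Z + L\<rceil>}" by simp
      qed
    qed simp
    have "\<delta> < 1" unfolding \<delta>_def using mult_mono[OF L6 L6] L6 by (simp add: power2_eq_square field_simps)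
    moreover have "h Z Z = max 0 (1 - \<delta>)" unfolding h_def w_def \<phi>_def using L2 by simp
    ultimately show "\<exists>m n. 0 < F m n" unfolding Fp by (intro exI[of _ Z]) simp
    fix m n assume "0 < F m n"
    then have hp: "0 < h m n" by (simp add: Fp)
    show "N < m \<or> N < n" using big(1)[OF hp] ..
    obtain k l where kl: "m = Suc k" "n = Suc l" using big(1,2)[OF hp] by (cases m; cases n) auto
    have "(R x y - \<epsilon>) * F m n = x ^ m * y ^ n * (- \<epsilon> * h m n + R x y * h m n)"
      unfolding F_def by (simp add: algebra_simps)
    also have "\<dots> \<le> x ^ m * y ^ n * (walk_G A1 A2 A3 A4 A5 A6 h k n + R x y * h m n)"
    proof (intro mult_left_mono add_right_mono)
      have "- \<epsilon> * h m n \<le> - \<epsilon>' * h m n" using e'(2) h0 by (simp add: mult_right_mono)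
      also have "\<dots> \<le> walk_G A1 A2 A3 A4 A5 A6 h k n" using key hp unfolding kl by simp
      finally show "- \<epsilon> * h m n \<le> walk_G A1 A2 A3 A4 A5 A6 h k n" .
    qed (use x y in auto)
    also have "\<dots> = G F m n"
      unfolding F_def kl A using net_G_twist[of x y "Suc l" b l1 l2 m1 m2 a h k] x y by simp
    finally show "(R x y - \<epsilon>) * F m n \<le> G F m n" .
  qed
  then show ?thesis by blast
qed

section \<open>Critical points\<close>

lemma (in two_queues) R_swap: "net_R l2 l1 m2 m1 b a y x = R x y"
  by (rule net_R_swap)

lemma (in two_queues) test_function_swap:
  assumes "two_queues.test_function l2 l1 m2 m1 b a \<rho> N F"
  shows "test_function \<rho> N (\<lambda>m n. F n m)"
proof -
  interpret S: two_queues l2 l1 m2 m1 b a by (rule swapped)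
  have F: "\<And>m n. 0 \<le> F m n" "finite {(m, n). 0 < F m n}" "\<exists>m n. 0 < F m n"
    "\<And>m n. 0 < F m n \<Longrightarrow> (N < m \<or> N < n) \<and> \<rho> * F m n \<le> S.G F m n"
    using assms unfolding S.test_function_def by blast+
  have "{(m, n). 0 < F n m} = prod.swap ` {(m, n). 0 < F m n}" by force
  then have fin: "finite {(m, n). 0 < F n m}" using F(2) by simp
  have SG: "S.G F n m = G (\<lambda>m n. F n m) m n" for m n
    using net_G_swap[of l2 l1 m2 m1 b a "\<lambda>m n. F n m" n m] by simp
  show ?thesis
    unfolding test_function_def
  proof (intro conjI allI impI)
    show "finite {(m, n). 0 < F n m}" by (rule fin)
    show "\<exists>m n. 0 < F n m" using F(3) by blast
    fix m n
    show "0 \<le> F n m" by (rule F(1))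
    assume "0 < F n m"
    from F(4)[OF this] show "N < m \<or> N < n" "\<rho> * F n m \<le> G (\<lambda>m n. F n m) m n" by (auto simp: SG)
  qed
qed

context two_queues begin

definition critical :: "real \<Rightarrow> real \<Rightarrow> bool" where
  "critical x y \<longleftrightarrow> stationary x y \<or> (axis_stationary x y \<and> y * (l2 + m1 * a / x) < m2) \<or>
     (two_queues.axis_stationary l2 l1 m2 b a y x \<and> x * (l1 + m2 * b / y) < m1)"

text \<open>In the case of equality the derivative across the line vanishes too, so the point is
  stationary in both coordinates. The round bump then replaces the axis construction, whose cut-off
  needs strict stability.\<close>

lemma axis_stationary_critical:
  assumes x: "0 < x" and st: "axis_stationary x y" and le: "y * (l2 + m1 * a / x) \<le> m2"
  shows "critical x y"
proof (cases "y * (l2 + m1 * a / x) < m2")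
  case True then show ?thesis using st by (simp add: critical_def)
next
  case False
  then have eq: "y * (l2 + m1 * a / x) = m2" using le by simp
  have y: "y = b * x + 1 - b" "(1 - a * b) * m1 = (l1 + l2 * b) * x\<^sup>2"
    using st by (simp_all add: axis_stationary_def)
  have yp: "0 < y" unfolding y by (rule line_pos[OF x])
  have "l2 * y + m1 * a * y / x = m2" using eq by (simp add: algebra_simps)
  moreover have "m2 * (b * x + 1 - b) / y = m2" unfolding y(1)[symmetric] using yp by simp
  moreover have "l1 * x + m2 * b * x / y = m1 * (a * y + 1 - a) / x"
  proof -
    have "l1 * x + m2 * b * x / y = l1 * x + b * x * (l2 + m1 * a / x)" unfolding eq[symmetric] using yp by simp
    also have "\<dots> = (l1 + l2 * b) * x + m1 * a * b" using x by (simp add: field_simps)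
    also have "\<dots> = (1 - a * b) * m1 / x + m1 * a * b" unfolding y(2) using x by (simp add: power2_eq_square)
    also have "\<dots> = m1 * (a * y + 1 - a) / x" unfolding y(1) using x by (simp add: field_simps)
    finally show ?thesis .
  qed
  ultimately show ?thesis by (simp add: critical_def stationary_def)
qed

lemma stationary_swap: "two_queues.stationary l2 l1 m2 m1 b a y x \<longleftrightarrow> stationary x y"
  unfolding two_queues.stationary_def[OF swapped] stationary_def by (auto simp: mult.commute)

lemma critical_swap: "two_queues.critical l2 l1 m2 m1 b a y x \<longleftrightarrow> critical x y"
proof -
  interpret S: two_queues l2 l1 m2 m1 b a by (rule swapped)
  have "S.critical y x \<longleftrightarrow> S.stationary y x \<or> (S.axis_stationary y x \<and> x * (l1 + m2 * b / y) < m1) \<or>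
      (axis_stationary x y \<and> y * (l2 + m1 * a / x) < m2)" by (rule S.critical_def)
  moreover have "S.stationary y x \<longleftrightarrow> stationary x y" by (rule stationary_swap)
  moreover note critical_def[of x y]
  ultimately show ?thesis by argo
qed

lemma critical_test_function:
  assumes xy: "0 < x" "0 < y" and cr: "critical x y" and eps: "0 < \<epsilon>"
  shows "\<exists>F. test_function (R x y - \<epsilon>) N F"
proof -
  interpret S: two_queues l2 l1 m2 m1 b a by (rule swapped)
  consider "stationary x y" | "axis_stationary x y" "y * (l2 + m1 * a / x) < m2"
    | "S.axis_stationary y x" "x * (l1 + m2 * b / y) < m1" using cr unfolding critical_def by blast
  then show ?thesis
  proof cases
    case 1 then show ?thesis by (rule interior_test_function[OF xy _ eps])
  next
    case 2 then show ?thesis by (intro axis_test_function xy eps)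
  next
    case 3
    obtain F where "S.test_function (S.R y x - \<epsilon>) N F" using S.axis_test_function[OF xy(2) 3 eps] by blast
    from test_function_swap[OF this] show ?thesis unfolding R_swap by blast
  qed
qed

text \<open>The line that carries the point decides which half-plane is covered; a fully stationary
  point is minimal on the whole quadrant.\<close>

lemma critical_minimal:
  assumes xy: "0 < x" "0 < y" and cr: "critical x y"
  shows "(\<forall>u v. 0 < u \<longrightarrow> 0 < v \<longrightarrow> v \<le> b * u + 1 - b \<longrightarrow> R x y \<le> R u v) \<or>
    (\<forall>u v. 0 < u \<longrightarrow> 0 < v \<longrightarrow> u \<le> a * v + 1 - a \<longrightarrow> R x y \<le> R u v)"
proof -
  interpret S: two_queues l2 l1 m2 m1 b a by (rule swapped)
  consider "stationary x y" | "axis_stationary x y" "y * (l2 + m1 * a / x) < m2"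
    | "S.axis_stationary y x" "x * (l1 + m2 * b / y) < m1" using cr unfolding critical_def by blast
  then show ?thesis
  proof cases
    case 1 then show ?thesis using stationary_minimal[OF xy] by blast
  next
    case 2 then show ?thesis using axis_stationary_minimal[OF xy(1)] by (auto intro: less_imp_le)
  next
    case 3 then show ?thesis
      using S.axis_stationary_minimal[OF xy(2) 3(1) less_imp_le[OF 3(2)]] unfolding R_swap by blast
  qed
qed

section \<open>Minimisers of R over the wedge\<close>

lemma R_coercive:
  obtains c where "0 < c" "\<And>x y. 0 < x \<Longrightarrow> 0 < y \<Longrightarrow> R x y \<le> 0 \<Longrightarrow> c \<le> x \<and> c \<le> y"
proof -
  interpret S: two_queues l2 l1 m2 m1 b a by (rule swapped)
  \<comment> \<open>\<open>R + M\<close> is a sum of six nonnegative terms, so each is at most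
    \<open>M\<close> where \<open>R \<le> 0\<close>. The terms in \<open>1 / x\<close> and
    \<open>1 / y\<close> bound the variables below; if \<open>a = 1\<close> or \<open>b = 1\<close>
    one of them is absent, and the bound is passed on through the ratio of \<open>x\<close> and
    \<open>y\<close>.\<close>
  define M where "M = m1 + m2 + l1 + l2"
  have M: "0 < M" unfolding M_def using m1 m2 l1 l2 by simp
  have bnd: "m1 * (1 - a) / x \<le> M \<and> m1 * a * y / x \<le> M \<and> m2 * (1 - b) / y \<le> M \<and> m2 * b * x / y \<le> M"
    if xy: "0 < x" "0 < y" and R0: "R x y \<le> 0" for x y
  proof -
    have "0 \<le> m1 * (1 - a) / x" "0 \<le> m1 * a * y / x" "0 \<le> m2 * (1 - b) / y" "0 \<le> m2 * b * x / y" "0 \<le> l1 * x" "0 \<le> l2 * y"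
      using xy l1 l2 m1 m2 a b by simp_all
    moreover have "R x y = m1 * (1 - a) / x + m1 * a * y / x + m2 * (1 - b) / y + m2 * b * x / y + l1 * x + l2 * y - M"
      unfolding net_R_def M_def using xy by (simp add: field_simps)
    ultimately show ?thesis using R0 by linarith
  qed
  show ?thesis
  proof (cases "a < 1")
    case a1: True
    define cx where "cx = m1 * (1 - a) / M"
    have cx: "0 < cx" unfolding cx_def using a1 m1 M by simp
    have cx': "cx \<le> x" if "0 < x" "0 < y" "R x y \<le> 0" for x y
      using bnd[OF that] that M unfolding cx_def by (simp add: field_simps)
    show ?thesis
    proof (cases "b < 1")
      case True
      show ?thesis
      proof (rule that[of "min cx (m2 * (1 - b) / M)"])
        show "0 < min cx (m2 * (1 - b) / M)" using cx True m2 M by simp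
        fix x y assume xy: "0 < x" "0 < y" "R x y \<le> 0"
        have "m2 * (1 - b) / M \<le> y" using bnd[OF xy] xy M by (simp add: field_simps)
        then show "min cx (m2 * (1 - b) / M) \<le> x \<and> min cx (m2 * (1 - b) / M) \<le> y" using cx'[OF xy] by (auto simp: min_le_iff_disj)
      qed
    next
      case False
      then have b1: "b = 1" using b by simp
      show ?thesis
      proof (rule that[of "min cx (m2 * cx / M)"])
        show "0 < min cx (m2 * cx / M)" using cx m2 M by simp
        fix x y assume xy: "0 < x" "0 < y" "R x y \<le> 0"
        have "m2 * cx \<le> m2 * x" using cx'[OF xy] m2 by simp
        also have "m2 * x \<le> y * M" using bnd[OF xy] xy b1 by (simp add: field_simps)
        finally have "m2 * cx / M \<le> y" using M by (simp add: field_simps)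
        then show "min cx (m2 * cx / M) \<le> x \<and> min cx (m2 * cx / M) \<le> y" using cx'[OF xy] by (auto simp: min_le_iff_disj)
      qed
    qed
  next
    case False
    then have a1: "a = 1" "b < 1" using a b ab by auto
    define cy where "cy = m2 * (1 - b) / M"
    have cy: "0 < cy" unfolding cy_def using a1 m2 M by simp
    have cy': "cy \<le> y" if "0 < x" "0 < y" "R x y \<le> 0" for x y
      using bnd[OF that] that M unfolding cy_def by (simp add: field_simps)
    show ?thesis
    proof (rule that[of "min cy (m1 * cy / M)"])
      show "0 < min cy (m1 * cy / M)" using cy m1 M by simp
      fix x y assume xy: "0 < x" "0 < y" "R x y \<le> 0"
      have "m1 * cy \<le> m1 * y" using cy'[OF xy] m1 by simp
      also have "m1 * y \<le> x * M" using bnd[OF xy] xy a1 by (simp add: field_simps)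
      finally have "m1 * cy / M \<le> x" using M by (simp add: field_simps)
      then show "min cy (m1 * cy / M) \<le> x \<and> min cy (m1 * cy / M) \<le> y" using cy'[OF xy] by (auto simp: min_le_iff_disj)
    qed
  qed
qed

lemma R_one [simp]: "R 1 1 = 0" by (simp add: net_R_def)

lemma wedge_le_1:
  assumes "x \<le> a * y + 1 - a" "y \<le> b * x + 1 - b"
  shows "x \<le> 1" "y \<le> 1"
proof -
  have "a * y \<le> a * (b * x + 1 - b)" using assms a by (intro mult_left_mono) auto
  then have "(1 - a * b) * x \<le> (1 - a * b) * 1" using assms by (simp add: algebra_simps)
  then show x: "x \<le> 1" using ab by simp
  have "b * x \<le> b * 1" using x b by (intro mult_left_mono) auto
  then show "y \<le> 1" using assms by simp
qed

text \<open>The vertex \<open>(1, 1)\<close> bounds the wedge from above. Points with a small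
  coordinate do not compete, because \<open>R\<close> is positive there while
  \<open>R 1 1 = 0\<close>; what is left is compact.\<close>

lemma R_attains_min:
  obtains x y where "0 < x" "0 < y" "x \<le> a * y + 1 - a" "y \<le> b * x + 1 - b"
    "\<And>u v. 0 < u \<Longrightarrow> 0 < v \<Longrightarrow> u \<le> a * v + 1 - a \<Longrightarrow> v \<le> b * u + 1 - b \<Longrightarrow> R x y \<le> R u v"
proof -
  obtain c where c: "0 < c" and cc: "\<And>x y. 0 < x \<Longrightarrow> 0 < y \<Longrightarrow> R x y \<le> 0 \<Longrightarrow> c \<le> x \<and> c \<le> y"
    by (rule R_coercive) (rule that)
  have c1: "c \<le> 1" using cc[of 1 1] by simp
  define K where "K = {z. c \<le> fst z \<and> c \<le> snd z \<and> fst z \<le> 1 \<and> snd z \<le> 1 \<and> fst z \<le> a * snd z + 1 - a \<and> snd z \<le> b * fst z + 1 - b}"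
  have "closed K" unfolding K_def
    by (intro closed_Collect_conj closed_Collect_le continuous_intros)
  moreover have "K \<subseteq> cbox (c, c) (1, 1)" unfolding K_def by (auto simp: mem_box cbox_Pair_eq)
  then have "bounded K" by (rule bounded_subset[OF bounded_cbox])
  ultimately have "compact K" by (simp add: compact_eq_bounded_closed)
  moreover have "(1, 1) \<in> K" unfolding K_def using c1 by simp
  moreover have "continuous_on K (\<lambda>z. R (fst z) (snd z))"
    unfolding net_R_def by (intro continuous_intros) (use c in \<open>auto simp: K_def\<close>)
  ultimately obtain z where z: "z \<in> K" "\<And>w. w \<in> K \<Longrightarrow> R (fst z) (snd z) \<le> R (fst w) (snd w)"
    using continuous_attains_inf[of K "\<lambda>z. R (fst z) (snd z)"] by blast
  have le0: "R (fst z) (snd z) \<le> 0" using z(2)[OF \<open>(1, 1) \<in> K\<close>] by simp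
  show ?thesis
  proof (rule that[of "fst z" "snd z"])
    show "0 < fst z" "0 < snd z" "fst z \<le> a * snd z + 1 - a" "snd z \<le> b * fst z + 1 - b"
      using z(1) c unfolding K_def by auto
    fix u v assume uv: "0 < u" "0 < v" "u \<le> a * v + 1 - a" "v \<le> b * u + 1 - b"
    show "R (fst z) (snd z) \<le> R u v"
    proof (cases "R u v \<le> 0")
      case True
      then have "(u, v) \<in> K" unfolding K_def using cc[OF uv(1,2)] wedge_le_1[OF uv(3,4)] uv by simp
      from z(2)[OF this] show ?thesis by simp
    next
      case False then show ?thesis using le0 by simp
    qed
  qed
qed

lemma DERIV_R_1: "x \<noteq> 0 \<Longrightarrow> y \<noteq> 0 \<Longrightarrow> ((\<lambda>t. R t y) has_real_derivative (l1 + m2 * b / y - m1 * (a * y + 1 - a) / x\<^sup>2)) (at x)"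
  unfolding net_R_def by (auto intro!: derivative_eq_intros simp: power2_eq_square field_simps)

lemma DERIV_R_2: "x \<noteq> 0 \<Longrightarrow> y \<noteq> 0 \<Longrightarrow> ((\<lambda>t. R x t) has_real_derivative (l2 + m1 * a / x - m2 * (b * x + 1 - b) / y\<^sup>2)) (at y)"
  unfolding net_R_def by (auto intro!: derivative_eq_intros simp: power2_eq_square field_simps)

definition line_R :: "real \<Rightarrow> real" where
  "line_R t = (1 - a * b) * m1 * (1 / t - 1) + (l1 + l2 * b) * (t - 1)"

lemma DERIV_line_R: "x \<noteq> 0 \<Longrightarrow> (line_R has_real_derivative (l1 + l2 * b - (1 - a * b) * m1 / x\<^sup>2)) (at x)"
  unfolding line_R_def by (auto intro!: derivative_eq_intros simp: power2_eq_square)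

lemma on_line_in_wedge:
  assumes "t \<le> 1" shows "t \<le> a * (b * t + 1 - b) + 1 - a"
proof -
  have "(1 - a * b) * t \<le> (1 - a * b) * 1" using assms ab by (intro mult_left_mono) auto
  then show ?thesis by (simp add: algebra_simps)
qed

end

lemma deriv_nonpos_if_left_min:
  fixes f :: "real \<Rightarrow> real"
  assumes "(f has_real_derivative l) (at x)" "0 < d" "\<And>t. x - d < t \<Longrightarrow> t < x \<Longrightarrow> f x \<le> f t"
  shows "l \<le> 0"
proof (rule ccontr)
  assume "\<not> l \<le> 0"
  then obtain e where e: "0 < e" "\<forall>h>0. h < e \<longrightarrow> f (x - h) < f x"
    using DERIV_pos_inc_left[OF assms(1)] by auto
  define h where "h = min d e / 2"
  have "0 < h" "h < e" "h < d" using e(1) assms(2) by (auto simp: h_def)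
  then have "f (x - h) < f x" "f x \<le> f (x - h)" using e(2) assms(3)[of "x - h"] by auto
  then show False by simp
qed

context two_queues begin

text \<open>From a point of the line below the vertex one may move along the line both ways and,
  across it, towards smaller \<open>y\<close>. The former gives stationarity along the line, the
  latter a one-sided derivative, which is the stability inequality.\<close>

lemma line_minimiser_critical:
  assumes x: "0 < x" "x < 1" and y: "y = b * x + 1 - b"
    and min: "\<And>u v. 0 < u \<Longrightarrow> 0 < v \<Longrightarrow> u \<le> a * v + 1 - a \<Longrightarrow> v \<le> b * u + 1 - b \<Longrightarrow> R x y \<le> R u v"
  shows "critical x y"
proof -
  have yp: "0 < y" unfolding y by (rule line_pos[OF x(1)])
  have "l1 + l2 * b - (1 - a * b) * m1 / x\<^sup>2 = 0"
  proof (rule DERIV_local_min[OF DERIV_line_R])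
    show "0 < min x (1 - x)" using x by simp
    show "\<forall>t. \<bar>x - t\<bar> < min x (1 - x) \<longrightarrow> line_R x \<le> line_R t"
    proof (intro allI impI)
      fix t assume "\<bar>x - t\<bar> < min x (1 - x)"
      then have t: "0 < t" "t < 1" by auto
      have "R x y \<le> R t (b * t + 1 - b)"
        using t by (intro min line_pos on_line_in_wedge) auto
      then show "line_R x \<le> line_R t"
        unfolding y R_on_line[OF x(1)] R_on_line[OF t(1)] line_R_def .
    qed
  qed (use x in simp)
  then have st: "axis_stationary x y" unfolding axis_stationary_def using x y by (simp add: field_simps)
  have strict: "x < a * y + 1 - a"
  proof -
    have "(1 - a * b) * x < (1 - a * b) * 1" using x ab by (intro mult_strict_left_mono) auto
    then show ?thesis unfolding y by (simp add: algebra_simps)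
  qed
  have "l2 + m1 * a / x - m2 * (b * x + 1 - b) / y\<^sup>2 \<le> 0"
  proof (rule deriv_nonpos_if_left_min[OF DERIV_R_2])
    show "x \<noteq> 0" "y \<noteq> 0" using x yp by simp_all
    show "0 < min y (a * y + 1 - a - x)" using yp strict by simp
    fix t assume t: "y - min y (a * y + 1 - a - x) < t" "t < y"
    have "a * (y - t) \<le> 1 * (y - t)" using a t by (intro mult_right_mono) auto
    moreover have "y - t < a * y + 1 - a - x" using t by simp
    ultimately have "x \<le> a * t + 1 - a" by (simp add: algebra_simps)
    then show "R x y \<le> R x t" using t x y by (intro min) auto
  qed
  then have "l2 + m1 * a / x \<le> m2 / y" unfolding y[symmetric] using yp by (simp add: power2_eq_square)
  then have "y * (l2 + m1 * a / x) \<le> m2" using yp by (simp add: field_simps)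
  then show ?thesis by (rule axis_stationary_critical[OF x(1) st])
qed

text \<open>At the vertex the line leads into the wedge in one direction only, so minimality gives
  an inequality: queue 1 is not overloaded.\<close>

lemma corner_derivative:
  assumes min: "\<And>u v. 0 < u \<Longrightarrow> 0 < v \<Longrightarrow> u \<le> a * v + 1 - a \<Longrightarrow> v \<le> b * u + 1 - b \<Longrightarrow> R 1 1 \<le> R u v"
  shows "l1 + l2 * b \<le> (1 - a * b) * m1"
proof -
  have "l1 + l2 * b - (1 - a * b) * m1 / 1\<^sup>2 \<le> 0"
  proof (rule deriv_nonpos_if_left_min[OF DERIV_line_R])
    fix t :: real assume t: "1 - 1 < t" "t < 1"
    have "R 1 1 \<le> R t (b * t + 1 - b)"
      using t by (intro min line_pos on_line_in_wedge) auto
    then show "line_R 1 \<le> line_R t" using t R_on_line[of t] by (simp add: line_R_def)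
  qed simp_all
  then show ?thesis by simp
qed

text \<open>If queue 1 is exactly balanced, the untwisted walk is already stationary along the line,
  and the load condition on queue 2 becomes the stability inequality.\<close>

lemma corner_critical:
  assumes "(1 - a * b) * m1 = l1 + l2 * b" "l2 + l1 * a \<le> (1 - a * b) * m2"
  shows "critical 1 1"
proof (rule axis_stationary_critical)
  show "axis_stationary 1 1" using assms by (simp add: axis_stationary_def)
  have "(1 - a * b) * (l2 + m1 * a) = l2 * (1 - a * b) + a * ((1 - a * b) * m1)" by (simp add: algebra_simps)
  also have "\<dots> = l2 + l1 * a" unfolding assms by (simp add: algebra_simps)
  also have "\<dots> \<le> (1 - a * b) * m2" by (rule assms)
  finally show "1 * (l2 + m1 * a / 1) \<le> m2" using ab by simp
qed simp

text \<open>The minimiser over the wedge lies inside, on one of the lines, or at the vertex. The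
  hypothesis enters at the vertex: minimality there excludes overload, so some queue is exactly
  balanced.\<close>

lemma nonergodic_critical:
  assumes ne: "(1 - a * b) * m1 \<le> l1 + l2 * b \<or> (1 - a * b) * m2 \<le> l2 + l1 * a"
  obtains x y where "0 < x" "0 < y" "x \<le> a * y + 1 - a" "y \<le> b * x + 1 - b" "critical x y"
proof -
  interpret S: two_queues l2 l1 m2 m1 b a by (rule swapped)
  obtain x y where xy: "0 < x" "0 < y" "x \<le> a * y + 1 - a" "y \<le> b * x + 1 - b"
    and min: "\<And>u v. 0 < u \<Longrightarrow> 0 < v \<Longrightarrow> u \<le> a * v + 1 - a \<Longrightarrow> v \<le> b * u + 1 - b \<Longrightarrow> R x y \<le> R u v"
    by (rule R_attains_min) (rule that)
  have smin: "S.R y x \<le> S.R v u" if "0 < v" "0 < u" "v \<le> b * u + 1 - b" "u \<le> a * v + 1 - a" for u v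
    unfolding R_swap by (rule min) (use that in auto)
  have le1: "x \<le> 1" "y \<le> 1" using wedge_le_1[OF xy(3,4)] by auto
  consider (inner) "x < a * y + 1 - a" "y < b * x + 1 - b" | (low) "y = b * x + 1 - b" "x < 1"
    | (left) "x = a * y + 1 - a" "y < 1" | (corner) "x = 1" "y = 1"
  proof -
    have "y = 1" if "y = b * x + 1 - b" "x = 1" using that by simp
    moreover have "x = 1" if "x = a * y + 1 - a" "y = 1" using that by simp
    ultimately show ?thesis using xy(3,4) le1 that by argo
  qed
  then have "critical x y"
  proof cases
    case inner
    have "l1 + m2 * b / y - m1 * (a * y + 1 - a) / x\<^sup>2 = 0"
    proof (rule DERIV_local_min[OF DERIV_R_1])
      define d where "d = Min {x, a * y + 1 - a - x, b * x + 1 - b - y}"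
      show "0 < d" using inner xy by (simp add: d_def)
      show "\<forall>t. \<bar>x - t\<bar> < d \<longrightarrow> R x y \<le> R t y"
      proof (intro allI impI min)
        fix t assume "\<bar>x - t\<bar> < d"
        then have t: "\<bar>x - t\<bar> < x" "\<bar>x - t\<bar> < a * y + 1 - a - x" "\<bar>x - t\<bar> < b * x + 1 - b - y" unfolding d_def by simp_all
        show "0 < t" "t \<le> a * y + 1 - a" using t by auto
        have "\<bar>b * (x - t)\<bar> \<le> 1 * \<bar>x - t\<bar>" unfolding abs_mult using b by (intro mult_right_mono) auto
        then show "y \<le> b * t + 1 - b" using t by (simp add: right_diff_distrib)
      qed (use xy in auto)
    qed (use xy in simp_all)
    moreover have "l2 + m1 * a / x - m2 * (b * x + 1 - b) / y\<^sup>2 = 0"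
    proof (rule DERIV_local_min[OF DERIV_R_2])
      define d where "d = Min {y, a * y + 1 - a - x, b * x + 1 - b - y}"
      show "0 < d" using inner xy by (simp add: d_def)
      show "\<forall>t. \<bar>y - t\<bar> < d \<longrightarrow> R x y \<le> R x t"
      proof (intro allI impI min)
        fix t assume "\<bar>y - t\<bar> < d"
        then have t: "\<bar>y - t\<bar> < y" "\<bar>y - t\<bar> < a * y + 1 - a - x" "\<bar>y - t\<bar> < b * x + 1 - b - y" unfolding d_def by simp_all
        show "0 < t" "t \<le> b * x + 1 - b" using t by auto
        have "\<bar>a * (y - t)\<bar> \<le> 1 * \<bar>y - t\<bar>" unfolding abs_mult using a by (intro mult_right_mono) auto
        then show "x \<le> a * t + 1 - a" using t by (simp add: right_diff_distrib)
      qed (use xy in auto)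
    qed (use xy in simp_all)
    ultimately have "stationary x y" unfolding stationary_def using xy by (simp add: field_simps power2_eq_square)
    then show ?thesis by (simp add: critical_def)
  next
    case low
    then show ?thesis using min by (intro line_minimiser_critical xy)
  next
    case left
    have "S.critical y x" using left smin by (intro S.line_minimiser_critical xy)
    then show ?thesis by (simp add: critical_swap)
  next
    case corner
    have 1: "l1 + l2 * b \<le> (1 - a * b) * m1" using min unfolding corner by (rule corner_derivative)
    have 2: "l2 + l1 * a \<le> (1 - b * a) * m2" using smin unfolding corner by (rule S.corner_derivative)
    show ?thesis
    proof (cases "(1 - a * b) * m1 \<le> l1 + l2 * b")
      case True
      then show ?thesis unfolding corner using 1 2 by (intro corner_critical) (auto simp: mult.commute)
    next
      case False
      then have "S.critical 1 1" using ne 1 2 by (intro S.corner_critical) (auto simp: mult.commute)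
      then show ?thesis unfolding corner by (simp add: critical_swap)
    qed
  qed
  with xy show ?thesis by (rule that)
qed

lemma G_product:
  assumes "x \<noteq> 0" "y \<noteq> 0"
  shows "G (\<lambda>m n. x ^ m * y ^ n) m n =
    (R x y - (if m = 0 then m1 * ((a * y + 1 - a) / x - 1) else 0) - (if n = 0 then m2 * ((b * x + 1 - b) / y - 1) else 0))
      * (x ^ m * y ^ n)"
  using assms unfolding net_G_def net_R_def by (cases m; cases n) (simp_all add: field_simps)

lemma G_product_wedge:
  assumes xy: "0 < x" "0 < y" "x \<le> a * y + 1 - a" "y \<le> b * x + 1 - b"
  shows "G (\<lambda>m n. x ^ m * y ^ n) m n \<le> R x y * (x ^ m * y ^ n)"
proof -
  have "0 \<le> m1 * ((a * y + 1 - a) / x - 1)" "0 \<le> m2 * ((b * x + 1 - b) / y - 1)"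
    using xy m1 m2 by simp_all
  then show ?thesis using xy by (subst G_product) (auto intro!: mult_right_mono)
qed

lemma G_add: "G (\<lambda>m n. f m n + g m n) m n = G f m n + G g m n"
  unfolding net_G_def by (cases m; cases n) (simp_all add: algebra_simps)

text \<open>Overload of queue 1 makes \<open>R\<close> negative on the line just below the vertex.
  There \<open>x ^ m * y ^ n\<close> is superharmonic, equal to 1 at the empty state and at most 1
  elsewhere, a certificate of transience. The last inequality says that the first arrival already
  lowers it on average.\<close>

lemma transient_weights_1:
  assumes "(1 - a * b) * m1 < l1 + l2 * b"
  shows "\<exists>x y. 0 < x \<and> 0 < y \<and> x \<le> a * y + 1 - a \<and> y \<le> b * x + 1 - b \<and> R x y \<le> 0 \<and> 0 < l1 * (1 - x) + l2 * (1 - y)"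
proof -
  have "0 < l1 + l2 * b - (1 - a * b) * m1 / 1\<^sup>2" using assms by simp
  from DERIV_pos_inc_left[OF DERIV_line_R this] obtain e where e: "0 < e" "\<forall>h>0. h < e \<longrightarrow> line_R (1 - h) < line_R 1"
    by auto
  define h where "h = min e 1 / 2"
  have h: "0 < h" "h < e" "h < 1" using e(1) by (auto simp: h_def)
  define x where "x = 1 - h"
  have x: "0 < x" "x < 1" using h by (auto simp: x_def)
  have "line_R x < 0" using e(2) h unfolding x_def by (simp add: line_R_def)
  moreover have "R x (b * x + 1 - b) = line_R x" unfolding R_on_line[OF x(1)] line_R_def ..
  moreover have "l1 * (1 - x) + l2 * (1 - (b * x + 1 - b)) = (l1 + l2 * b) * (1 - x)" by (simp add: algebra_simps)
  moreover have "0 < (l1 + l2 * b) * (1 - x)" using flow1 x by simp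
  ultimately show ?thesis
    using x on_line_in_wedge[of x] line_pos[OF x(1)] by (intro exI[of _ x] exI[of _ "b * x + 1 - b"]) simp
qed

lemma transient_weights:
  assumes "(1 - a * b) * m1 < l1 + l2 * b \<or> (1 - a * b) * m2 < l2 + l1 * a"
  obtains x y where "0 < x" "0 < y" "x \<le> a * y + 1 - a" "y \<le> b * x + 1 - b" "R x y \<le> 0" "0 < l1 * (1 - x) + l2 * (1 - y)"
proof -
  interpret S: two_queues l2 l1 m2 m1 b a by (rule swapped)
  from assms have "\<exists>x y. 0 < x \<and> 0 < y \<and> x \<le> a * y + 1 - a \<and> y \<le> b * x + 1 - b \<and> R x y \<le> 0 \<and> 0 < l1 * (1 - x) + l2 * (1 - y)"
  proof
    assume "(1 - a * b) * m1 < l1 + l2 * b"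
    then show ?thesis by (rule transient_weights_1)
  next
    assume "(1 - a * b) * m2 < l2 + l1 * a"
    then have "\<exists>y x. 0 < y \<and> 0 < x \<and> y \<le> b * x + 1 - b \<and> x \<le> a * y + 1 - a \<and> S.R y x \<le> 0 \<and> 0 < l2 * (1 - y) + l1 * (1 - x)"
      by (intro S.transient_weights_1) (simp add: mult.commute)
    then show ?thesis unfolding R_swap by (auto simp: add.commute)
  qed
  then show ?thesis using that by blast
qed

text \<open>\<open>r\<close> is the square root of the traffic through queue 1 and \<open>s\<close>
  a slack of \<open>sqrt m1\<close> above it. For \<open>m1 = (r + s)\<^sup>2\<close> the minimiser
  of \<open>R\<close> along the line is \<open>sqrt m1 / r = 1 + s / r\<close>; since this is at
  least 1, a larger \<open>m1\<close> can only lower the value there.\<close>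

lemma line_value:
  assumes r: "0 < r" "l1 + l2 * b = (1 - a * b) * r\<^sup>2" and s: "0 \<le> s" and m: "(r + s)\<^sup>2 \<le> m1"
  shows "R (1 + s / r) (b * (1 + s / r) + 1 - b) \<le> - (1 - a * b) * s\<^sup>2"
    and "m1 = (r + s)\<^sup>2 \<Longrightarrow> R (1 + s / r) (b * (1 + s / r) + 1 - b) = - (1 - a * b) * s\<^sup>2"
proof -
  let ?x = "1 + s / r"
  have x: "0 < ?x" using r s by (simp add: add_pos_nonneg)
  have inv: "1 / ?x - 1 = - (s / (r + s))" using r s by (simp add: field_simps)
  have "R ?x (b * ?x + 1 - b) = (1 - a * b) * (m1 * (- (s / (r + s))) + r\<^sup>2 * (s / r))"
  proof -
    have "R ?x (b * ?x + 1 - b) = (1 - a * b) * (m1 * (1 / ?x - 1) + r\<^sup>2 * (?x - 1))"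
      unfolding R_on_line[OF x] r(2) by (simp only: distrib_left mult.assoc)
    then show ?thesis unfolding inv by simp
  qed
  also have "r\<^sup>2 * (s / r) = r * s" using r by (simp add: power2_eq_square)
  finally have eq: "R ?x (b * ?x + 1 - b) = (1 - a * b) * (m1 * (- (s / (r + s))) + r * s)" .
  have sq: "(r + s)\<^sup>2 * (- (s / (r + s))) + r * s = - s\<^sup>2" using r s by (simp add: power2_eq_square field_simps)
  have "m1 * (- (s / (r + s))) \<le> (r + s)\<^sup>2 * (- (s / (r + s)))"
    using m r s by (intro mult_right_mono_neg) simp_all
  then have "m1 * (- (s / (r + s))) + r * s \<le> - s\<^sup>2" using sq by linarith
  then have "(1 - a * b) * (m1 * (- (s / (r + s))) + r * s) \<le> (1 - a * b) * (- s\<^sup>2)" using ab by (intro mult_left_mono) auto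
  then show "R ?x (b * ?x + 1 - b) \<le> - (1 - a * b) * s\<^sup>2" unfolding eq by (simp only: mult_minus_left mult_minus_right)
  show "R ?x (b * ?x + 1 - b) = - (1 - a * b) * s\<^sup>2" if "m1 = (r + s)\<^sup>2"
    unfolding eq sq[folded that] by (simp only: mult_minus_left mult_minus_right)
qed

end

text \<open>\<open>r1\<close> and \<open>r2\<close> are the square roots of the solution of the
  traffic equations, so that the bottleneck value becomes a polynomial in them and the
  slack.\<close>

locale two_queues_flow = two_queues +
  fixes r1 r2 :: real
  assumes r1: "0 < r1" and r2: "0 < r2"
    and flow_r1: "r1\<^sup>2 = l1 + r2\<^sup>2 * b" and flow_r2: "r2\<^sup>2 = l2 + r1\<^sup>2 * a"
begin

lemma swapped_flow: "two_queues_flow l2 l1 m2 m1 b a r2 r1"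
  using swapped r1 r2 flow_r1 flow_r2 by (simp add: two_queues_flow_def two_queues_flow_axioms_def)

lemma flow_sum_1: "l1 + l2 * b = (1 - a * b) * r1\<^sup>2"
proof -
  have "r2\<^sup>2 * b = l2 * b + r1\<^sup>2 * a * b" unfolding flow_r2 by (simp add: distrib_right)
  then show ?thesis using flow_r1 by (simp add: algebra_simps)
qed

lemma a_r1_le: "a * r1 \<le> r2"
proof -
  have "(a * r1)\<^sup>2 = a * (r1\<^sup>2 * a)" by (simp add: power2_eq_square)
  also have "\<dots> \<le> 1 * r2\<^sup>2" using flow_r2 l2 a by (intro mult_mono) auto
  finally have "(a * r1)\<^sup>2 \<le> r2\<^sup>2" by simp
  then show ?thesis using r2 by (rule power2_le_imp_le[OF _ less_imp_le])
qed

text \<open>Each queue receives at least what the other sends to it. The inequality handles the term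
  linear in \<open>s\<close> when the load of queue 2 at the bottleneck point is compared with
  \<open>(r2 + s)\<^sup>2\<close>.\<close>

lemma cross_terms: "a * r1\<^sup>2 + b * r2\<^sup>2 \<le> 2 * (r1 * r2)"
proof -
  have 1: "a * r1\<^sup>2 \<le> r2\<^sup>2" using flow_r2 l2 by (simp add: mult.commute)
  have 2: "b * r2\<^sup>2 \<le> r1\<^sup>2" using flow_r1 l1 by (simp add: mult.commute)
  have 3: "b * r2\<^sup>2 \<le> 1 * r2\<^sup>2" "a * r1\<^sup>2 \<le> 1 * r1\<^sup>2" using a b by (intro mult_right_mono; simp)+
  show ?thesis
  proof (cases "r2 \<le> r1")
    case True
    then have "r2\<^sup>2 \<le> r1 * r2" using r2 by (simp add: power2_eq_square)
    then show ?thesis using 1 3 by simp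
  next
    case False
    then have "r1\<^sup>2 \<le> r1 * r2" using r1 by (simp add: power2_eq_square)
    then show ?thesis using 2 3 by simp
  qed
qed

text \<open>Queue 1 is the bottleneck and the point is the minimiser along its line. That queue 2
  has at least the same slack keeps it weakly stable under the twist.\<close>

lemma bottleneck_critical:
  assumes s: "0 \<le> s" and m: "m1 = (r1 + s)\<^sup>2" "(r2 + s)\<^sup>2 \<le> m2"
  defines "x \<equiv> 1 + s / r1"
  shows "axis_stationary x (b * x + 1 - b)" "(b * x + 1 - b) * (l2 + m1 * a / x) \<le> m2"
proof -
  have xr: "x * r1 = r1 + s" unfolding x_def using r1 by (simp add: field_simps)
  have xp: "0 < x" unfolding x_def using r1 s by (simp add: add_pos_nonneg)
  have "(1 - a * b) * m1 = (l1 + l2 * b) * x\<^sup>2"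
    unfolding flow_sum_1 m(1) xr[symmetric] by (simp add: power_mult_distrib)
  then show "axis_stationary x (b * x + 1 - b)" by (simp add: axis_stationary_def)
  have "m1 * a / x = a * (r1 * (r1 + s))"
    unfolding m(1) xr[symmetric] using xp by (simp add: power2_eq_square)
  then have e1: "l2 + m1 * a / x = r2\<^sup>2 + a * r1 * s"
    using flow_r2 by (simp add: power2_eq_square algebra_simps)
  have e2: "b * x + 1 - b = 1 + b * s / r1" unfolding x_def by (simp add: algebra_simps)
  have "(1 + b * s / r1) * (r2\<^sup>2 + a * r1 * s) = r2\<^sup>2 + (a * r1\<^sup>2 + b * r2\<^sup>2) / r1 * s + a * b * s\<^sup>2"
    using r1 by (simp add: field_simps power2_eq_square)
  also have "\<dots> \<le> r2\<^sup>2 + 2 * r2 * s + 1 * s\<^sup>2"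
  proof (intro add_mono mult_right_mono)
    show "(a * r1\<^sup>2 + b * r2\<^sup>2) / r1 \<le> 2 * r2" using cross_terms r1 by (simp add: field_simps)
  qed (use ab s in auto)
  also have "\<dots> = (r2 + s)\<^sup>2" by (simp add: power2_eq_square algebra_simps)
  also have "\<dots> \<le> m2" by (rule m)
  finally show "(b * x + 1 - b) * (l2 + m1 * a / x) \<le> m2" unfolding e1 e2 .
qed

text \<open>The two exponential functions are good near one axis each, and each dominates there because
  \<open>u < x\<close> and \<open>y < v\<close>; hence so is their sum.\<close>
lemma ergodic_supersolution:
  assumes s: "0 \<le> s" and m: "(r1 + s)\<^sup>2 \<le> m1" "(r2 + s)\<^sup>2 \<le> m2" and eps: "0 < \<epsilon>"
  shows "\<exists>f N. (\<forall>m n. 0 < f m n) \<and> (\<forall>m n. N < m \<or> N < n \<longrightarrow> G f m n \<le> (- (1 - a * b) * s\<^sup>2 + \<epsilon>) * f m n)"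
proof (cases "s = 0")
  case True
  have "G (\<lambda>m n. 1) m n \<le> (- (1 - a * b) * s\<^sup>2 + \<epsilon>) * 1" for m n
    using eps True unfolding net_G_def by (cases m; cases n) simp_all
  then show ?thesis by (intro exI[of _ "\<lambda>m n. 1"]) simp
next
  case False
  then have s: "0 < s" using s by simp
  interpret S: two_queues_flow l2 l1 m2 m1 b a r2 r1 by (rule swapped_flow)
  define \<rho> where "\<rho> = - (1 - a * b) * s\<^sup>2 + \<epsilon>"
  \<comment> \<open>At \<open>\<eta> = 0\<close> the comparisons \<open>U \<le> X\<close> and
    \<open>Y \<le> V\<close> may be equalities. The shifts by \<open>1 + a\<close> and
    \<open>1 + b\<close> widen both gaps by \<open>\<eta> * (1 - a * b)\<close>, and a small
    \<open>\<eta>\<close> keeps the values of \<open>R\<close> below \<open>\<rho>\<close>.\<close>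
  define x v where "x \<eta> = 1 + s / r1 + \<eta> * (1 + a)" and "v \<eta> = 1 + s / r2 + \<eta> * (1 + b)" for \<eta>
  have x0: "0 < x 0" "0 < v 0" unfolding x_def v_def using s r1 r2 by (simp_all add: add_pos_pos)
  have "((\<lambda>\<eta>. R (x \<eta>) (b * x \<eta> + 1 - b)) \<longlongrightarrow> R (x 0) (b * x 0 + 1 - b)) (at_right 0)"
    unfolding net_R_def x_def using x0(1) line_pos[OF x0(1)] unfolding x_def
    by (intro tendsto_intros) (auto intro!: tendsto_eq_intros)
  moreover have "R (x 0) (b * x 0 + 1 - b) < \<rho>"
    using line_value(1)[OF r1 flow_sum_1 less_imp_le[OF s] m(1)] eps unfolding \<rho>_def x_def by simp
  ultimately have 1: "eventually (\<lambda>\<eta>. R (x \<eta>) (b * x \<eta> + 1 - b) < \<rho>) (at_right 0)" by (rule order_tendstoD(2))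
  have "((\<lambda>\<eta>. S.R (v \<eta>) (a * v \<eta> + 1 - a)) \<longlongrightarrow> S.R (v 0) (a * v 0 + 1 - a)) (at_right 0)"
    unfolding net_R_def v_def using x0(2) S.line_pos[OF x0(2)] unfolding v_def
    by (intro tendsto_intros) (auto intro!: tendsto_eq_intros)
  moreover have "S.R (v 0) (a * v 0 + 1 - a) < \<rho>"
    using S.line_value(1)[OF r2 S.flow_sum_1 less_imp_le[OF s] m(2)] eps unfolding \<rho>_def v_def by (simp add: mult.commute)
  ultimately have 2: "eventually (\<lambda>\<eta>. S.R (v \<eta>) (a * v \<eta> + 1 - a) < \<rho>) (at_right 0)" by (rule order_tendstoD(2))
  have "eventually (\<lambda>\<eta>. 0 < \<eta> \<and> R (x \<eta>) (b * x \<eta> + 1 - b) < \<rho> \<and> S.R (v \<eta>) (a * v \<eta> + 1 - a) < \<rho>) (at_right 0)"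
    using eventually_at_right_less[of "0::real"] 1 2 by (simp add: eventually_conj_iff)
  then obtain \<eta> where eta: "0 < \<eta>" "R (x \<eta>) (b * x \<eta> + 1 - b) < \<rho>" "S.R (v \<eta>) (a * v \<eta> + 1 - a) < \<rho>"
    by (rule eventually_happens'[rotated, THEN exE]) auto
  define X Y U V where "X = x \<eta>" and "Y = b * X + 1 - b" and "U = a * V + 1 - a" and "V = v \<eta>"
  have Xp: "0 < X" "0 < V" unfolding X_def V_def x_def v_def using s r1 r2 a b eta by (simp_all add: add_pos_pos add_pos_nonneg)
  have Yp: "0 < Y" "0 < U" unfolding Y_def U_def using line_pos[OF Xp(1)] S.line_pos[OF Xp(2)] .
  have R1: "R X Y < \<rho>" and R2: "R U V < \<rho>" using eta(2,3) unfolding X_def Y_def U_def V_def R_swap by simp_all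
  have UX: "U < X"
  proof -
    have "a * (s / r2) \<le> s / r1"
    proof -
      have "a * r1 * s \<le> r2 * s" using a_r1_le s by (intro mult_right_mono) auto
      then show ?thesis using r1 r2 by (simp add: field_simps)
    qed
    moreover have "0 < \<eta> * (1 - a * b)" using eta ab by simp
    moreover have "X - U = (s / r1 - a * (s / r2)) + \<eta> * (1 - a * b)"
      unfolding X_def U_def V_def x_def v_def by (simp add: algebra_simps)
    ultimately show ?thesis by linarith
  qed
  have YV: "Y < V"
  proof -
    have "b * (s / r1) \<le> s / r2"
    proof -
      have "b * r2 * s \<le> r1 * s" using S.a_r1_le s by (intro mult_right_mono) auto
      then show ?thesis using r1 r2 by (simp add: field_simps)
    qed
    moreover have "0 < \<eta> * (1 - a * b)" using eta ab by simp
    moreover have "V - Y = (s / r2 - b * (s / r1)) + \<eta> * (1 - a * b)"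
      unfolding Y_def X_def V_def x_def v_def by (simp add: algebra_simps)
    ultimately show ?thesis by linarith
  qed
  \<comment> \<open>\<open>C\<close> bounds the excess over \<open>\<rho>\<close> of each
    exponential on the axis where it fails, and \<open>d\<close> is the margin of the other one.
    Beyond \<open>N1\<close> and \<open>N2\<close> the geometric domination beats the factor
    \<open>C / d\<close>.\<close>
  define C where "C = \<bar>R X Y + m1 - \<rho>\<bar> + \<bar>R U V + m2 - \<rho>\<bar> + 1"
  define d where "d = min (\<rho> - R X Y) (\<rho> - R U V)"
  have d: "0 < d" "d \<le> \<rho> - R X Y" "d \<le> \<rho> - R U V" unfolding d_def using R1 R2 by auto
  have C: "0 < C" "R X Y + m1 - \<rho> \<le> C" "R U V + m2 - \<rho> \<le> C" unfolding C_def by linarith+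
  obtain N1 where N1: "(U / X) ^ N1 < d / C" using real_arch_pow_inv[of "d / C" "U / X"] d C UX Xp by auto
  obtain N2 where N2: "(Y / V) ^ N2 < d / C" using real_arch_pow_inv[of "d / C" "Y / V"] d C YV Xp by auto
  have dom1: "C * U ^ m \<le> d * X ^ m" if "N1 < m" for m
  proof -
    have "(U / X) ^ m \<le> (U / X) ^ N1" using that UX Yp Xp by (intro power_decreasing) auto
    then have "U ^ m / X ^ m \<le> d / C" using N1 by (simp add: power_divide)
    then show ?thesis using C Xp by (simp add: field_simps)
  qed
  have dom2: "C * Y ^ n \<le> d * V ^ n" if "N2 < n" for n
  proof -
    have "(Y / V) ^ n \<le> (Y / V) ^ N2" using that YV Yp Xp by (intro power_decreasing) auto
    then have "Y ^ n / V ^ n \<le> d / C" using N2 by (simp add: power_divide)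
    then show ?thesis using C Xp by (simp add: field_simps)
  qed
  define f where "f m n = X ^ m * Y ^ n + U ^ m * V ^ n" for m n
  have fp: "0 < f m n" for m n unfolding f_def using Xp Yp by (simp add: add_pos_pos)
  have G1: "G (\<lambda>m n. X ^ m * Y ^ n) m n \<le> (if m = 0 then R X Y + m1 else R X Y) * (X ^ m * Y ^ n)" for m n
  proof -
    have "b * X + 1 - b = Y" by (simp add: Y_def)
    moreover have "- m1 \<le> m1 * ((a * Y + 1 - a) / X - 1)"
    proof -
      have "0 \<le> m1 * ((a * Y + 1 - a) / X)" using m1 S.line_pos[OF Yp(1)] Xp by simp
      then show ?thesis by (simp add: right_diff_distrib)
    qed
    ultimately show ?thesis
      using Xp Yp by (subst G_product) (auto intro!: mult_right_mono)
  qed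
  have G2: "G (\<lambda>m n. U ^ m * V ^ n) m n \<le> (if n = 0 then R U V + m2 else R U V) * (U ^ m * V ^ n)" for m n
  proof -
    have "a * V + 1 - a = U" by (simp add: U_def)
    moreover have "- m2 \<le> m2 * ((b * U + 1 - b) / V - 1)"
    proof -
      have "0 \<le> m2 * ((b * U + 1 - b) / V)" using m2 line_pos[OF Yp(2)] Xp by simp
      then show ?thesis by (simp add: right_diff_distrib)
    qed
    ultimately show ?thesis
      using Xp Yp by (subst G_product) (auto intro!: mult_right_mono)
  qed
  have "G f m n \<le> \<rho> * f m n" if mn: "max N1 N2 < m \<or> max N1 N2 < n" for m n
  proof -
    have "G f m n = G (\<lambda>m n. X ^ m * Y ^ n) m n + G (\<lambda>m n. U ^ m * V ^ n) m n"
      unfolding f_def by (rule G_add)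
    also have "\<dots> \<le> (if m = 0 then R X Y + m1 else R X Y) * (X ^ m * Y ^ n) + (if n = 0 then R U V + m2 else R U V) * (U ^ m * V ^ n)"
      by (intro add_mono G1 G2)
    also have "\<dots> \<le> \<rho> * f m n"
    proof (cases "m = 0")
      case True
      then have n: "N2 < n" "n \<noteq> 0" using mn by auto
      have "(R X Y + m1 - \<rho>) * Y ^ n \<le> C * Y ^ n" using C Yp by (intro mult_right_mono) auto
      also have "\<dots> \<le> d * V ^ n" by (rule dom2[OF n(1)])
      also have "\<dots> \<le> (\<rho> - R U V) * V ^ n" using d Xp by (intro mult_right_mono) auto
      finally show ?thesis using True n unfolding f_def by (simp add: algebra_simps)
    next
      case m: False
      show ?thesis
      proof (cases "n = 0")
        case True
        then have N: "N1 < m" using mn by auto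
        have "(R U V + m2 - \<rho>) * U ^ m \<le> C * U ^ m" using C Yp by (intro mult_right_mono) auto
        also have "\<dots> \<le> d * X ^ m" by (rule dom1[OF N])
        also have "\<dots> \<le> (\<rho> - R X Y) * X ^ m" using d Xp by (intro mult_right_mono) auto
        finally show ?thesis using True m unfolding f_def by (simp add: algebra_simps)
      next
        case False
        have "R X Y * (X ^ m * Y ^ n) \<le> \<rho> * (X ^ m * Y ^ n)" "R U V * (U ^ m * V ^ n) \<le> \<rho> * (U ^ m * V ^ n)"
          using R1 R2 Xp Yp by (intro mult_right_mono; simp)+
        then show ?thesis using m False unfolding f_def by (simp add: algebra_simps)
      qed
    qed
    finally show ?thesis .
  qed
  then show ?thesis unfolding \<rho>_def[symmetric] using fp by blast
qed

lemma sum_single_le: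
  fixes f :: "'i \<Rightarrow> real"
  assumes "finite T" "\<And>z. 0 \<le> f z" shows "(\<Sum>z\<in>T. f z * (if z = w then 1 else 0)) \<le> f w"
  using assms by (simp add: if_distrib[of "(*) _"] cong: if_cong)

text \<open>The measure is the product form of the stationary law, without normalisation.
  Restricting the sum to \<open>T\<close> may drop inflow into \<open>(i, j)\<close> but keeps all
  outflow, because \<open>(i, j)\<close> lies in \<open>T\<close>; hence an inequality.\<close>

lemma product_form_subinvariant:
  assumes T: "finite T" "(i, j) \<in> T"
  defines "\<pi> \<equiv> \<lambda>z. (r1\<^sup>2 / m1) ^ fst z * (r2\<^sup>2 / m2) ^ snd z"
  shows "(\<Sum>z\<in>T. \<pi> z * G (\<lambda>m n. if m = i \<and> n = j then 1 else 0) (fst z) (snd z)) \<le> 0"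
proof -
  define e where "e w z = (if z = w then 1 else 0 :: real)" for w z :: "nat \<times> nat"
  define u v where "u = r1\<^sup>2 / m1" and "v = r2\<^sup>2 / m2"
  have uv: "0 < u" "0 < v" "m1 * u = r1\<^sup>2" "m2 * v = r2\<^sup>2" unfolding u_def v_def using r1 r2 m1 m2 by simp_all
  have p0: "0 \<le> \<pi> z" for z unfolding \<pi>_def using m1 m2 by simp
  have le: "(\<Sum>z\<in>T. \<pi> z * e w z) \<le> \<pi> w" for w unfolding e_def by (rule sum_single_le[OF T(1) p0])
  have eq: "(\<Sum>z\<in>T. \<pi> z * e (i, j) z) = \<pi> (i, j)"
    unfolding e_def using T by (simp add: if_distrib[of "(*) _"] cong: if_cong)
  \<comment> \<open>These switch off the transitions that are impossible at an empty queue, and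
    neutralise the truncated subtraction in \<open>i - 1\<close> and \<open>j - 1\<close>.\<close>
  define c1 c2 where "c1 = (if i = 0 then 0 else 1 :: real)" and "c2 = (if j = 0 then 0 else 1 :: real)"
  have c: "0 \<le> c1" "0 \<le> c2" unfolding c1_def c2_def by simp_all
  let ?g = "\<lambda>z. l1 * c1 * e (i - 1, j) z + l2 * c2 * e (i, j - 1) z + m1 * (1 - a) * e (Suc i, j) z + m1 * a * c2 * e (Suc i, j - 1) z
      + m2 * (1 - b) * e (i, Suc j) z + m2 * b * c1 * e (i - 1, Suc j) z - (l1 + l2 + m1 * c1 + m2 * c2) * e (i, j) z"
  have G: "G (\<lambda>m n. if m = i \<and> n = j then 1 else 0) (fst z) (snd z) = ?g z" for z
    unfolding net_G_def e_def c1_def c2_def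
    by (cases z; cases i; cases j; cases "fst z"; cases "snd z") (auto simp: algebra_simps)
  have "(\<Sum>z\<in>T. \<pi> z * G (\<lambda>m n. if m = i \<and> n = j then 1 else 0) (fst z) (snd z)) =
     l1 * c1 * (\<Sum>z\<in>T. \<pi> z * e (i - 1, j) z) + l2 * c2 * (\<Sum>z\<in>T. \<pi> z * e (i, j - 1) z)
     + m1 * (1 - a) * (\<Sum>z\<in>T. \<pi> z * e (Suc i, j) z) + m1 * a * c2 * (\<Sum>z\<in>T. \<pi> z * e (Suc i, j - 1) z)
     + m2 * (1 - b) * (\<Sum>z\<in>T. \<pi> z * e (i, Suc j) z) + m2 * b * c1 * (\<Sum>z\<in>T. \<pi> z * e (i - 1, Suc j) z)
     - (l1 + l2 + m1 * c1 + m2 * c2) * (\<Sum>z\<in>T. \<pi> z * e (i, j) z)"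
    unfolding G sum_distrib_left sum.distrib[symmetric] sum_subtractf[symmetric]
    by (intro sum.cong refl) (simp add: algebra_simps)
  also have "\<dots> \<le> l1 * c1 * \<pi> (i - 1, j) + l2 * c2 * \<pi> (i, j - 1) + m1 * (1 - a) * \<pi> (Suc i, j) + m1 * a * c2 * \<pi> (Suc i, j - 1)
     + m2 * (1 - b) * \<pi> (i, Suc j) + m2 * b * c1 * \<pi> (i - 1, Suc j) - (l1 + l2 + m1 * c1 + m2 * c2) * \<pi> (i, j)"
    unfolding eq using l1 l2 m1 m2 a b c by (intro add_mono diff_mono mult_left_mono le order_refl) auto
  also have "\<dots> = 0"
  proof -
    define q where "q = \<pi> (i, j)"
    have pi: "\<pi> (m, n) = u ^ m * v ^ n" for m n by (simp add: \<pi>_def u_def v_def)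
    have A: "m1 * \<pi> (Suc i, n) = r1\<^sup>2 * \<pi> (i, n)" "m2 * \<pi> (m, Suc j) = r2\<^sup>2 * \<pi> (m, j)" for m n
      unfolding pi uv(3,4)[symmetric] by simp_all
    have B: "c1 * (r1\<^sup>2 * \<pi> (i - 1, n)) = c1 * (m1 * \<pi> (i, n))" for n
      unfolding pi uv(3)[symmetric] c1_def by (cases i) simp_all
    have B2: "c2 * (r2\<^sup>2 * \<pi> (m, j - 1)) = c2 * (m2 * \<pi> (m, j))" for m
      unfolding pi uv(4)[symmetric] c2_def by (cases j) simp_all
    \<comment> \<open>Partial balance: inflow by arrivals at queue 1, external or routed, equals
      outflow by service at queue 1. \<open>t2\<close> is the same for queue 2, and
      \<open>t3\<close> matches exits from the network with external arrivals.\<close>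
    have "l1 * c1 * \<pi> (i - 1, j) + m2 * b * c1 * \<pi> (i - 1, Suc j) = c1 * ((l1 + r2\<^sup>2 * b) * \<pi> (i - 1, j))"
      using A(2)[of "i - 1"] by (simp add: algebra_simps)
    also have "\<dots> = m1 * c1 * q" unfolding flow_r1[symmetric] B q_def by simp
    finally have t1: "l1 * c1 * \<pi> (i - 1, j) + m2 * b * c1 * \<pi> (i - 1, Suc j) = m1 * c1 * q" .
    have "l2 * c2 * \<pi> (i, j - 1) + m1 * a * c2 * \<pi> (Suc i, j - 1) = c2 * ((l2 + r1\<^sup>2 * a) * \<pi> (i, j - 1))"
      using A(1)[of "j - 1"] by (simp add: algebra_simps)
    also have "\<dots> = m2 * c2 * q" unfolding flow_r2[symmetric] B2 q_def by simp
    finally have t2: "l2 * c2 * \<pi> (i, j - 1) + m1 * a * c2 * \<pi> (Suc i, j - 1) = m2 * c2 * q" .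
    have "m1 * (1 - a) * \<pi> (Suc i, j) + m2 * (1 - b) * \<pi> (i, Suc j) = (1 - a) * (m1 * \<pi> (Suc i, j)) + (1 - b) * (m2 * \<pi> (i, Suc j))" by simp
    also have "\<dots> = ((1 - a) * r1\<^sup>2 + (1 - b) * r2\<^sup>2) * q" unfolding A q_def by (simp add: algebra_simps)
    also have "(1 - a) * r1\<^sup>2 + (1 - b) * r2\<^sup>2 = l1 + l2" using flow_r1 flow_r2 by (simp add: algebra_simps)
    finally have t3: "m1 * (1 - a) * \<pi> (Suc i, j) + m2 * (1 - b) * \<pi> (i, Suc j) = (l1 + l2) * q" .
    show ?thesis using t1 t2 t3 unfolding q_def[symmetric] by (simp add: algebra_simps)
  qed
  finally show ?thesis .
qed

end

section \<open>The queue length process\<close>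

context two_queues_flow begin

text \<open>The bottleneck attains the value at a critical point. For the other line an upper bound
  is enough, since the infimum over \<open>i\<close> is decided by the bottleneck.\<close>

lemma ergodic_values:
  assumes s: "s = min (sqrt m1 - r1) (sqrt m2 - r2)" "0 \<le> s"
  shows "\<exists>x y. 0 < x \<and> 0 < y \<and> critical x y \<and> R x y = - (1 - a * b) * s\<^sup>2"
    and "\<exists>x y. 0 < x \<and> 0 < y \<and> y \<le> b * x + 1 - b \<and> R x y \<le> - (1 - a * b) * s\<^sup>2"
    and "\<exists>x y. 0 < x \<and> 0 < y \<and> x \<le> a * y + 1 - a \<and> R x y \<le> - (1 - a * b) * s\<^sup>2"
    and "(r1 + s)\<^sup>2 \<le> m1" "(r2 + s)\<^sup>2 \<le> m2"
proof -
  interpret S: two_queues_flow l2 l1 m2 m1 b a r2 r1 by (rule swapped_flow)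
  have "r1 + s \<le> sqrt m1" "r2 + s \<le> sqrt m2" using s(1) by simp_all
  then have "(r1 + s)\<^sup>2 \<le> (sqrt m1)\<^sup>2" "(r2 + s)\<^sup>2 \<le> (sqrt m2)\<^sup>2" using r1 r2 s(2) by (intro power_mono; simp)+
  then show m: "(r1 + s)\<^sup>2 \<le> m1" "(r2 + s)\<^sup>2 \<le> m2" using m1 m2 by simp_all
  have xp: "0 < 1 + s / r1" "0 < 1 + s / r2" using r1 r2 s(2) by (simp_all add: add_pos_nonneg)
  show "\<exists>x y. 0 < x \<and> 0 < y \<and> y \<le> b * x + 1 - b \<and> R x y \<le> - (1 - a * b) * s\<^sup>2"
    using line_value(1)[OF r1 flow_sum_1 s(2) m(1)] xp(1) line_pos[OF xp(1)]
    by (intro exI[of _ "1 + s / r1"] exI[of _ "b * (1 + s / r1) + 1 - b"]) simp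
  show "\<exists>x y. 0 < x \<and> 0 < y \<and> x \<le> a * y + 1 - a \<and> R x y \<le> - (1 - a * b) * s\<^sup>2"
    using S.line_value(1)[OF r2 S.flow_sum_1 s(2) m(2)] xp(2) S.line_pos[OF xp(2)] unfolding R_swap
    by (intro exI[of _ "a * (1 + s / r2) + 1 - a"] exI[of _ "1 + s / r2"]) (simp add: mult.commute)
  show "\<exists>x y. 0 < x \<and> 0 < y \<and> critical x y \<and> R x y = - (1 - a * b) * s\<^sup>2"
  proof (cases "sqrt m1 - r1 \<le> sqrt m2 - r2")
    case True
    then have "r1 + s = sqrt m1" using s(1) by simp
    then have e: "m1 = (r1 + s)\<^sup>2" using m1 by simp
    have "critical (1 + s / r1) (b * (1 + s / r1) + 1 - b)"
      by (rule axis_stationary_critical[OF xp(1)]) (rule bottleneck_critical[OF s(2) e m(2)])+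
    then show ?thesis using line_value(2)[OF r1 flow_sum_1 s(2) m(1) e] xp(1) line_pos[OF xp(1)] by blast
  next
    case False
    then have "r2 + s = sqrt m2" using s(1) by simp
    then have e: "m2 = (r2 + s)\<^sup>2" using m2 by simp
    have "S.critical (1 + s / r2) (a * (1 + s / r2) + 1 - a)"
      by (rule S.axis_stationary_critical[OF xp(2)]) (rule S.bottleneck_critical[OF s(2) e m(1)])+
    then have "critical (a * (1 + s / r2) + 1 - a) (1 + s / r2)" by (simp only: critical_swap)
    moreover have "R (a * (1 + s / r2) + 1 - a) (1 + s / r2) = - (1 - a * b) * s\<^sup>2"
      using S.line_value(2)[OF r2 S.flow_sum_1 s(2) m(2) e] unfolding R_swap by (simp only: mult.commute)
    ultimately show ?thesis using xp(2) S.line_pos[OF xp(2)] by blast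
  qed
qed

end

section \<open>States of the network as pairs, and its generator\<close>

definition state :: "nat \<Rightarrow> nat \<Rightarrow> nat ^ 2" where
  "state m n = (\<chi> i. if i = 1 then m else n)"

lemma state_nth [simp]: "state m n $ 1 = m" "state m n $ 2 = n"
  by (simp_all add: state_def)

lemma state_eta [simp]: "state (v $ 1) (v $ 2) = v"
  by (simp add: vec_eq_iff forall_2)

lemma state_eq_iff [simp]: "state m n = state m' n' \<longleftrightarrow> m = m' \<and> n = n'"
  by (auto simp: vec_eq_iff forall_2)

lemma eq_state_iff: "v = state m n \<longleftrightarrow> v $ 1 = m \<and> v $ 2 = n"
  by (auto simp: vec_eq_iff forall_2)

lemma bij_state: "bij (\<lambda>(m, n). state m n)"
  by (rule bij_betw_byWitness[where f' = "\<lambda>v. (v $ 1, v $ 2)"]) auto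

lemma has_sum_single_if:
  fixes c :: "'s \<Rightarrow> real"
  shows "((\<lambda>y. (if y = z then r else 0) * c y) has_sum r * c z) UNIV"
proof -
  have "((\<lambda>y. (if y = z then r else 0) * c y) has_sum r * c z) {z}"
    using has_sum_finite[of "{z}" "\<lambda>y. (if y = z then r else 0) * c y"] by simp
  then show ?thesis by (rule has_sum_cong_neutral[THEN iffD1, rotated -1]) auto
qed

text \<open>For a fixed source the rate is a sum of six point masses in the target, so the infinite
  sum collapses; transitions out of an empty queue have no target.\<close>

lemma generator_jackson_rate:
  assumes "jackson_network lam mu (p :: real^2^2)"
  shows "generator (jackson_rate lam mu p) f (state m n) =
    net_G (lam $ 1) (lam $ 2) (mu $ 1) (mu $ 2) (p $ 1 $ 2) (p $ 2 $ 1) (\<lambda>m n. f (state m n)) m n"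
proof -
  have diag: "p $ 1 $ 1 = 0" "p $ 2 $ 2 = 0" using assms by (simp_all add: jackson_network_def)
  have ex: "exit_prob p 1 = 1 - p $ 1 $ 2" "exit_prob p 2 = 1 - p $ 2 $ 1"
    unfolding exit_prob_def sum_2 diag by simp_all
  have U: "UNIV - {1::2} = {2}" "UNIV - {2::2} = {1}" by (auto simp: UNIV_2)
  let ?x = "state m n"
  define c where "c y = f y - f ?x" for y
  have up: "y = ?x + axis 1 1 \<longleftrightarrow> y = state (Suc m) n" "y = ?x + axis 2 1 \<longleftrightarrow> y = state m (Suc n)" for y
    unfolding eq_state_iff by (auto simp: vec_eq_iff forall_2 axis_def)
  have down1: "((\<lambda>y. (if y + axis 1 1 = ?x then r else 0) * c y) has_sum (case m of 0 \<Rightarrow> 0 | Suc k \<Rightarrow> r * c (state k n))) UNIV" for r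
  proof (cases m)
    case 0
    then have "y + axis 1 1 \<noteq> ?x" for y by (auto simp: vec_eq_iff forall_2 axis_def)
    then show ?thesis using 0 by (simp add: has_sum_0)
  next
    case (Suc k)
    then have "y + axis 1 1 = ?x \<longleftrightarrow> y = state k n" for y unfolding eq_state_iff by (auto simp: vec_eq_iff forall_2 axis_def)
    then show ?thesis using has_sum_single_if[of "state k n" r c] Suc by simp
  qed
  have down2: "((\<lambda>y. (if y + axis 2 1 = ?x then r else 0) * c y) has_sum (case n of 0 \<Rightarrow> 0 | Suc k \<Rightarrow> r * c (state m k))) UNIV" for r
  proof (cases n)
    case 0
    then have "y + axis 2 1 \<noteq> ?x" for y by (auto simp: vec_eq_iff forall_2 axis_def)
    then show ?thesis using 0 by (simp add: has_sum_0)
  next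
    case (Suc k)
    then have "y + axis 2 1 = ?x \<longleftrightarrow> y = state m k" for y unfolding eq_state_iff by (auto simp: vec_eq_iff forall_2 axis_def)
    then show ?thesis using has_sum_single_if[of "state m k" r c] Suc by simp
  qed
  have move1: "((\<lambda>y. (if y + axis 1 1 = ?x + axis 2 1 then r else 0) * c y) has_sum (case m of 0 \<Rightarrow> 0 | Suc k \<Rightarrow> r * c (state k (Suc n)))) UNIV" for r
  proof (cases m)
    case 0
    then have "y + axis 1 1 \<noteq> ?x + axis 2 1" for y by (auto simp: vec_eq_iff forall_2 axis_def)
    then show ?thesis using 0 by (simp add: has_sum_0)
  next
    case (Suc k)
    then have "y + axis 1 1 = ?x + axis 2 1 \<longleftrightarrow> y = state k (Suc n)" for y unfolding eq_state_iff by (auto simp: vec_eq_iff forall_2 axis_def)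
    then show ?thesis using has_sum_single_if[of "state k (Suc n)" r c] Suc by simp
  qed
  have move2: "((\<lambda>y. (if y + axis 2 1 = ?x + axis 1 1 then r else 0) * c y) has_sum (case n of 0 \<Rightarrow> 0 | Suc k \<Rightarrow> r * c (state (Suc m) k))) UNIV" for r
  proof (cases n)
    case 0
    then have "y + axis 2 1 \<noteq> ?x + axis 1 1" for y by (auto simp: vec_eq_iff forall_2 axis_def)
    then show ?thesis using 0 by (simp add: has_sum_0)
  next
    case (Suc k)
    then have "y + axis 2 1 = ?x + axis 1 1 \<longleftrightarrow> y = state (Suc m) k" for y unfolding eq_state_iff by (auto simp: vec_eq_iff forall_2 axis_def)
    then show ?thesis using has_sum_single_if[of "state (Suc m) k" r c] Suc by simp
  qed
  have "((\<lambda>y. (if y = state (Suc m) n then lam $ 1 else 0) * c y + (if y = state m (Suc n) then lam $ 2 else 0) * c y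
      + (if y + axis 1 1 = ?x then mu $ 1 * exit_prob p 1 else 0) * c y + (if y + axis 2 1 = ?x then mu $ 2 * exit_prob p 2 else 0) * c y
      + (if y + axis 1 1 = ?x + axis 2 1 then mu $ 1 * p $ 1 $ 2 else 0) * c y + (if y + axis 2 1 = ?x + axis 1 1 then mu $ 2 * p $ 2 $ 1 else 0) * c y) has_sum
      (lam $ 1 * c (state (Suc m) n) + lam $ 2 * c (state m (Suc n))
      + (case m of 0 \<Rightarrow> 0 | Suc k \<Rightarrow> mu $ 1 * exit_prob p 1 * c (state k n)) + (case n of 0 \<Rightarrow> 0 | Suc k \<Rightarrow> mu $ 2 * exit_prob p 2 * c (state m k))
      + (case m of 0 \<Rightarrow> 0 | Suc k \<Rightarrow> mu $ 1 * p $ 1 $ 2 * c (state k (Suc n))) + (case n of 0 \<Rightarrow> 0 | Suc k \<Rightarrow> mu $ 2 * p $ 2 $ 1 * c (state (Suc m) k)))) UNIV"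
    by (intro has_sum_add has_sum_single_if down1 down2 move1 move2)
  moreover have "jackson_rate lam mu p ?x y * c y = (if y = state (Suc m) n then lam $ 1 else 0) * c y + (if y = state m (Suc n) then lam $ 2 else 0) * c y
      + (if y + axis 1 1 = ?x then mu $ 1 * exit_prob p 1 else 0) * c y + (if y + axis 2 1 = ?x then mu $ 2 * exit_prob p 2 else 0) * c y
      + (if y + axis 1 1 = ?x + axis 2 1 then mu $ 1 * p $ 1 $ 2 else 0) * c y + (if y + axis 2 1 = ?x + axis 1 1 then mu $ 2 * p $ 2 $ 1 else 0) * c y" for y
    unfolding jackson_rate_def sum_2 U up[of y] by (simp only: distrib_right sum.insert[OF finite.emptyI] sum.empty empty_iff not_False_eq_True add_0_right add.assoc)
  ultimately have "generator (jackson_rate lam mu p) f ?x =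
      lam $ 1 * c (state (Suc m) n) + lam $ 2 * c (state m (Suc n))
      + (case m of 0 \<Rightarrow> 0 | Suc k \<Rightarrow> mu $ 1 * exit_prob p 1 * c (state k n)) + (case n of 0 \<Rightarrow> 0 | Suc k \<Rightarrow> mu $ 2 * exit_prob p 2 * c (state m k))
      + (case m of 0 \<Rightarrow> 0 | Suc k \<Rightarrow> mu $ 1 * p $ 1 $ 2 * c (state k (Suc n))) + (case n of 0 \<Rightarrow> 0 | Suc k \<Rightarrow> mu $ 2 * p $ 2 $ 1 * c (state (Suc m) k))"
    unfolding generator_def c_def[symmetric] by (simp add: infsumI)
  then show ?thesis unfolding net_G_def ex c_def
    by (cases m; cases n) (simp_all add: algebra_simps)
qed

text \<open>Jump rates are nonnegative. Hence cutting off a nonnegative function lowers the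
  generator where the function is kept, and taking a positive part raises it where the function is
  positive.\<close>

lemma (in two_queues) G_mono_at:
  assumes "H m n = F m n" "\<And>i j. H i j \<le> F i j"
  shows "G H m n \<le> G F m n"
  unfolding net_G_def using assms(1) l1 l2 m1 m2 a b
  by (cases m; cases n) (auto intro!: add_mono mult_left_mono assms(2))

section \<open>Spectral bounds and recurrence for the network chain\<close>

locale jackson_chain = rates_chain "jackson_rate lam mu p" P X +
  two_queues "lam $ 1" "lam $ 2" "mu $ 1" "mu $ 2" "p $ 1 $ 2" "p $ 2 $ 1"
  for lam mu :: "real^2" and p :: "real^2^2" and P :: "nat^2 \<Rightarrow> 'w measure" and X :: "real \<Rightarrow> 'w \<Rightarrow> nat^2" +
  assumes network: "jackson_network lam mu p"
begin

abbreviation "gen \<equiv> generator (jackson_rate lam mu p)"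

lemma gen_state: "gen f v = G (\<lambda>m n. f (state m n)) (v $ 1) (v $ 2)"
  using generator_jackson_rate[OF network, of f "v $ 1" "v $ 2"] by simp

definition level :: "nat \<Rightarrow> (nat^2) set" where
  "level N = {v. v $ 1 + v $ 2 \<le> N}"

lemma finite_box: "finite {v :: nat^2. v $ 1 \<le> M \<and> v $ 2 \<le> N}"
proof (rule finite_subset)
  show "{v :: nat^2. v $ 1 \<le> M \<and> v $ 2 \<le> N} \<subseteq> (\<lambda>(m, n). state m n) ` ({..M} \<times> {..N})"
    by (auto intro!: image_eqI[where x = "(_ $ 1, _ $ 2)"])
qed simp

lemma finite_level: "finite (level N)"
  by (rule finite_subset[OF _ finite_box[of N N]]) (auto simp: level_def)

lemma gen_truncated_le:
  assumes "v \<in> D" "\<And>w. 0 \<le> f w"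
  shows "gen (\<lambda>w. if w \<in> D then f w else 0) v \<le> gen f v"
  unfolding gen_state by (rule G_mono_at) (use assms in auto)

text \<open>Only external arrivals raise the total number of customers, so
  \<open>1 - (m + n) / (N + 1)\<close> decreases at rate at most the total arrival rate divided by
  \<open>N + 1\<close>. Its positive part loses no faster on the level.\<close>

lemma exhausting_level: "exhausting level"
proof (rule exhaustingI)
  define g where "g N v = max 0 (1 - real (v $ 1 + v $ 2) / real (Suc N))" for N and v :: "nat^2"
  show "finite (level N)" for N by (rule finite_level)
  show "eventually (\<lambda>N. x \<in> level N) sequentially" for x
    unfolding level_def by (auto intro: eventually_sequentiallyI[of "x $ 1 + x $ 2"])
  show "g N z = 0" if "z \<notin> level N" for N z
  proof -
    have "real (Suc N) \<le> real (z $ 1 + z $ 2)" using that unfolding level_def by (intro of_nat_mono) simp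
    then have "1 \<le> real (z $ 1 + z $ 2) / real (Suc N)" by (simp add: le_divide_eq)
    then show ?thesis by (simp add: g_def)
  qed
  show "g N z \<le> 1" for N z by (simp add: g_def)
  show "(\<lambda>N. g N z) \<longlonglongrightarrow> 1" for z
  proof -
    have "(\<lambda>N. real (z $ 1 + z $ 2) * inverse (real (Suc N))) \<longlonglongrightarrow> real (z $ 1 + z $ 2) * 0"
      by (intro tendsto_mult tendsto_const LIMSEQ_inverse_real_of_nat)
    then have "(\<lambda>N. max 0 (1 - real (z $ 1 + z $ 2) * inverse (real (Suc N)))) \<longlonglongrightarrow> max 0 (1 - real (z $ 1 + z $ 2) * 0)"
      by (intro tendsto_max tendsto_diff tendsto_const)
    then show ?thesis by (simp add: g_def divide_inverse)
  qed
  show "0 \<le> (lam $ 1 + lam $ 2) * inverse (real (Suc N))" for N using l1 l2 by simp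
  show "(\<lambda>N. (lam $ 1 + lam $ 2) * inverse (real (Suc N))) \<longlonglongrightarrow> 0"
    using tendsto_mult[OF tendsto_const LIMSEQ_inverse_real_of_nat, of "lam $ 1 + lam $ 2"] by simp
  show "- ((lam $ 1 + lam $ 2) * inverse (real (Suc N))) \<le> gen (g N) v" if v: "v \<in> level N" for N v
  proof -
    define i where "i = inverse (real (Suc N))"
    have i: "0 < i" by (simp add: i_def)
    let ?H = "\<lambda>m n. 1 - real (m + n) * i"
    have "- ((lam $ 1 + lam $ 2) * i) \<le> G ?H (v $ 1) (v $ 2)"
    proof -
      have "0 \<le> mu $ 1 * ((1 - p $ 1 $ 2) * i)" "0 \<le> mu $ 2 * ((1 - p $ 2 $ 1) * i)"
        using m1 m2 a b i by simp_all
      then show ?thesis unfolding net_G_def by (cases "v $ 1"; cases "v $ 2") (simp_all add: algebra_simps)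
    qed
    also have "\<dots> \<le> G (\<lambda>m n. g N (state m n)) (v $ 1) (v $ 2)"
    proof (rule G_mono_at)
      have "real (v $ 1 + v $ 2) * i \<le> 1"
        using v unfolding level_def i_def by (simp add: field_simps)
      then show "?H (v $ 1) (v $ 2) = g N (state (v $ 1) (v $ 2))" by (simp add: g_def i_def divide_inverse)
    qed (simp add: g_def i_def divide_inverse)
    finally show ?thesis unfolding gen_state i_def .
  qed
qed

lemma essential_le_supersolution:
  assumes f: "\<And>m n. 0 < f m n" and sup: "\<And>m n. N < m \<or> N < n \<Longrightarrow> G f m n \<le> \<rho> * f m n"
  shows "essential_spectral_radius_chain P X \<le> exp \<rho>"
proof (rule essential_spectral_radius_le[OF exhausting_level finite_box[of N N], of "\<lambda>v. f (v $ 1) (v $ 2)"])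
  show "0 < f (z $ 1) (z $ 2)" for z by (rule f)
  fix M z assume z: "z \<in> level M - {v. v $ 1 \<le> N \<and> v $ 2 \<le> N}"
  have "gen (\<lambda>w. if w \<in> level M - {v. v $ 1 \<le> N \<and> v $ 2 \<le> N} then f (w $ 1) (w $ 2) else 0) z \<le> gen (\<lambda>w. f (w $ 1) (w $ 2)) z"
    using z less_imp_le[OF f] by (intro gen_truncated_le)
  also have "\<dots> = G f (z $ 1) (z $ 2)" unfolding gen_state by simp
  also have "\<dots> \<le> \<rho> * f (z $ 1) (z $ 2)" using z by (intro sup) auto
  finally show "gen (\<lambda>w. if w \<in> level M - {v. v $ 1 \<le> N \<and> v $ 2 \<le> N} then f (w $ 1) (w $ 2) else 0) z \<le> \<rho> * f (z $ 1) (z $ 2)" .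
qed

lemma spectral_le_wedge:
  assumes xy: "0 < x" "0 < y" "x \<le> p $ 1 $ 2 * y + 1 - p $ 1 $ 2" "y \<le> p $ 2 $ 1 * x + 1 - p $ 2 $ 1"
  shows "spectral_radius_chain P X \<le> exp (R x y)"
    and "essential_spectral_radius_chain P X \<le> spectral_radius_chain P X"
proof -
  define f where "f v = x ^ (v $ 1) * y ^ (v $ 2)" for v :: "nat^2"
  have f: "0 < f v" for v using xy by (simp add: f_def)
  have sup: "gen (\<lambda>w. if w \<in> level N then f w else 0) v \<le> R x y * f v" if "v \<in> level N" for N v
  proof -
    have "gen (\<lambda>w. if w \<in> level N then f w else 0) v \<le> gen f v" using that less_imp_le[OF f] by (intro gen_truncated_le)
    also have "\<dots> = G (\<lambda>m n. x ^ m * y ^ n) (v $ 1) (v $ 2)" unfolding gen_state f_def by simp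
    also have "\<dots> \<le> R x y * f v" unfolding f_def by (rule G_product_wedge[OF xy])
    finally show ?thesis .
  qed
  show "spectral_radius_chain P X \<le> exp (R x y)"
    by (rule spectral_radius_le(1)[OF exhausting_level f sup])
  show "essential_spectral_radius_chain P X \<le> spectral_radius_chain P X"
    by (rule spectral_radius_le(2)[OF exhausting_level f sup])
qed

lemma essential_ge_critical:
  assumes xy: "0 < x" "0 < y" and cr: "critical x y"
  shows "exp (R x y) \<le> essential_spectral_radius_chain P X"
proof -
  have main: "exp (R x y - \<epsilon>) \<le> essential_spectral_radius_chain P X" if e: "0 < \<epsilon>" for \<epsilon>
  proof (rule essential_spectral_radius_ge)
    fix K :: "(nat^2) set" assume "finite K"
    then have "finite ((\<lambda>v. v $ 1 + v $ 2) ` K)" by (rule finite_imageI)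
    then obtain N where N: "\<forall>k\<in>(\<lambda>v. v $ 1 + v $ 2) ` K. k \<le> N"
      unfolding finite_nat_set_iff_bounded_le by (rule exE)
    obtain F where F: "test_function (R x y - \<epsilon>) N F" using critical_test_function[OF xy cr e] by blast
    define g where "g v = F (v $ 1) (v $ 2)" for v :: "nat^2"
    define S where "S = {v. 0 < g v}"
    have F0: "\<And>m n. 0 \<le> F m n" and fin: "finite {(m, n). 0 < F m n}" and ex: "\<exists>m n. 0 < F m n"
      and sub: "\<And>m n. 0 < F m n \<Longrightarrow> (N < m \<or> N < n) \<and> (R x y - \<epsilon>) * F m n \<le> G F m n"
      using F unfolding test_function_def by blast+
    have "S \<subseteq> (\<lambda>(m, n). state m n) ` {(m, n). 0 < F m n}"
    proof
      fix v assume "v \<in> S"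
      then show "v \<in> (\<lambda>(m, n). state m n) ` {(m, n). 0 < F m n}"
        unfolding S_def g_def by (intro image_eqI[where x = "(v $ 1, v $ 2)"]) auto
    qed
    then have 1: "finite S" using fin by (rule finite_subset[OF _ finite_imageI])
    have 2: "S \<noteq> {}"
    proof -
      obtain m n where "0 < F m n" using ex by blast
      then have "state m n \<in> S" by (simp add: S_def g_def)
      then show ?thesis by blast
    qed
    have 3: "S \<inter> K = {}"
    proof (rule equals0I)
      fix v assume v: "v \<in> S \<inter> K"
      then have "N < v $ 1 \<or> N < v $ 2" using sub unfolding S_def g_def by blast
      moreover have "v $ 1 + v $ 2 \<le> N" using v N by blast
      ultimately show False by linarith
    qed
    have 4: "g z = 0" if "z \<notin> S" for z using that F0[of "z $ 1" "z $ 2"] unfolding S_def g_def by simp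
    have 5: "(R x y - \<epsilon>) * g z \<le> gen g z" if "z \<in> S" for z
      using sub[of "z $ 1" "z $ 2"] that unfolding S_def gen_state g_def by simp
    show "\<exists>S g. finite S \<and> S \<noteq> {} \<and> S \<inter> K = {} \<and> (\<forall>z\<in>S. 0 < g z) \<and> (\<forall>z. z \<notin> S \<longrightarrow> g z = 0) \<and>
        (\<forall>z\<in>S. (R x y - \<epsilon>) * g z \<le> gen g z)"
    proof (intro exI[of _ S] exI[of _ g] conjI ballI allI impI)
      show "0 < g z" if "z \<in> S" for z using that by (simp add: S_def)
    qed (use 1 2 3 4 5 in blast)+
  qed
  have "((\<lambda>\<epsilon>. exp (R x y - \<epsilon>)) \<longlongrightarrow> exp (R x y - 0)) (at_right 0)" by (intro tendsto_intros)
  then have "exp (R x y - 0) \<le> essential_spectral_radius_chain P X"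
    by (rule tendsto_upperbound) (use main eventually_at_right_less[of "0::real"] in \<open>auto elim: eventually_mono\<close>)
  then show ?thesis by simp
qed

lemma gen_indicator: "gen (\<lambda>w. if w = z then 1 else 0) v = G (\<lambda>m n. if m = z $ 1 \<and> n = z $ 2 then 1 else 0) (v $ 1) (v $ 2)"
proof -
  have "state m n = z \<longleftrightarrow> m = z $ 1 \<and> n = z $ 2" for m n using eq_state_iff[of z m n] by auto
  then show ?thesis unfolding gen_state by simp
qed

lemma lam_pos: "0 < lam $ 1 + lam $ 2"
proof -
  have "lam $ 2 * p $ 2 $ 1 \<le> lam $ 2 * 1" using l2 b by (intro mult_left_mono) auto
  then show ?thesis using flow1 by simp
qed

lemma gen_indicator_self: "gen (\<lambda>w. if w = z then 1 else 0) z \<le> - (lam $ 1 + lam $ 2)"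
  unfolding gen_indicator net_G_def using m1 m2 a b
  by (cases "z $ 1"; cases "z $ 2") (auto simp: algebra_simps)

lemma gen_indicator_0: "gen (\<lambda>w. if w = 0 then 1 else 0) 0 = - (lam $ 1 + lam $ 2)"
  unfolding gen_indicator net_G_def by simp

text \<open>\<open>1 - x ^ m * y ^ n\<close> is subharmonic and has positive drift at the empty
  state. Subtracting \<open>(m + n) * i N\<close> makes the set where it is positive finite, at the
  price of a drift of at least \<open>- \<Lambda> * i N\<close>.\<close>

lemma not_positive_recurrent_transient:
  assumes "(1 - p $ 1 $ 2 * p $ 2 $ 1) * mu $ 1 < lam $ 1 + lam $ 2 * p $ 2 $ 1 \<or>
    (1 - p $ 1 $ 2 * p $ 2 $ 1) * mu $ 2 < lam $ 2 + lam $ 1 * p $ 1 $ 2"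
  shows "\<not> positive_recurrent P X"
proof -
  obtain x y where xy: "0 < x" "0 < y" "x \<le> p $ 1 $ 2 * y + 1 - p $ 1 $ 2" "y \<le> p $ 2 $ 1 * x + 1 - p $ 2 $ 1"
    and R0: "R x y \<le> 0" and eta: "0 < lam $ 1 * (1 - x) + lam $ 2 * (1 - y)"
    by (rule transient_weights[OF assms]) (rule that)
  define \<eta> where "\<eta> = lam $ 1 * (1 - x) + lam $ 2 * (1 - y)"
  define \<Lambda> where "\<Lambda> = lam $ 1 + lam $ 2"
  have L: "0 < \<Lambda>" unfolding \<Lambda>_def by (rule lam_pos)
  have eta_le: "\<eta> \<le> \<Lambda>"
  proof -
    have "lam $ 1 * (1 - x) \<le> lam $ 1 * 1" "lam $ 2 * (1 - y) \<le> lam $ 2 * 1" using l1 l2 xy by (intro mult_left_mono; simp)+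
    then show ?thesis unfolding \<eta>_def \<Lambda>_def by simp
  qed
  have eta0: "0 < \<eta>" unfolding \<eta>_def by (rule eta)
  \<comment> \<open>Starting the sequence at \<open>N0\<close> makes the linear correction at the
    empty state at most \<open>\<eta> / 2\<close> for all \<open>N\<close>.\<close>
  obtain N0 where N0: "2 * \<Lambda> / \<eta> < real N0" using reals_Archimedean2 by blast
  define i where "i N = inverse (real (Suc (N + N0)))" for N
  have i0: "0 < i N" for N by (simp add: i_def)
  have iN: "2 * \<Lambda> * i N \<le> \<eta>" for N
  proof -
    have "2 * \<Lambda> < \<eta> * real N0" using N0 eta0 by (simp add: field_simps)
    also have "\<dots> \<le> \<eta> * real (Suc (N + N0))" using eta0 by (intro mult_left_mono) auto
    finally show ?thesis unfolding i_def by (simp add: field_simps del: of_nat_Suc of_nat_add)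
  qed
  have ilim: "i \<longlonglongrightarrow> 0" unfolding i_def using LIMSEQ_ignore_initial_segment[OF LIMSEQ_inverse_real_of_nat, of N0] by simp
  define H where "H N m n = 1 - x ^ m * y ^ n - real (m + n) * i N" for N and m n :: nat
  define g where "g N v = max 0 (H N (v $ 1) (v $ 2))" for N and v :: "nat^2"
  define S where "S N = {v :: nat^2. 0 < H N (v $ 1) (v $ 2)}" for N
  have GH: "- (\<Lambda> * i N) \<le> G (H N) m n" for N m n
  proof -
    have "G (\<lambda>m n. x ^ m * y ^ n) m n \<le> R x y * (x ^ m * y ^ n)" by (rule G_product_wedge[OF xy])
    also have "\<dots> \<le> 0" using R0 xy by (simp add: mult_nonpos_nonneg)
    finally have "G (\<lambda>m n. x ^ m * y ^ n) m n \<le> 0" .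
    moreover have "0 \<le> mu $ 1 * ((1 - p $ 1 $ 2) * i N)" "0 \<le> mu $ 2 * ((1 - p $ 2 $ 1) * i N)"
      using m1 m2 a b i0[of N] by simp_all
    ultimately show ?thesis unfolding net_G_def H_def \<Lambda>_def by (cases m; cases n) (simp_all add: algebra_simps)
  qed
  have H1: "H N m n \<le> 1" for N m n
  proof -
    have "0 \<le> x ^ m * y ^ n" "0 \<le> real (m + n) * i N" using xy i0[of N] by simp_all
    then show ?thesis unfolding H_def by linarith
  qed
  show ?thesis
  \<comment> \<open>With \<open>c = \<eta> / (4 * \<Lambda>)\<close>, leaving the empty state costs
    \<open>\<eta> / 4\<close>, while the function after departure gains at least
    \<open>\<eta> / 2\<close>. The summand 1 in \<open>\<Lambda> + 1\<close> makes the drift bound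
    strict.\<close>
  proof (rule not_positive_recurrentI[of S 0 "\<eta> / (4 * \<Lambda>)" g "\<lambda>N. (\<Lambda> + 1) * i N"])
    fix N
    show "finite (S N)"
    proof (rule finite_subset[OF _ finite_level[of "N + N0"]], rule subsetI)
      fix v assume "v \<in> S N"
      then have h: "0 < H N (v $ 1) (v $ 2)" by (simp add: S_def)
      have "0 \<le> x ^ (v $ 1) * y ^ (v $ 2)" using xy by simp
      then have "real (v $ 1 + v $ 2) * i N < 1" using h unfolding H_def by linarith
      then have "real (v $ 1 + v $ 2) < real (Suc (N + N0))" unfolding i_def by (simp add: field_simps)
      then show "v \<in> level (N + N0)" unfolding level_def of_nat_less_iff by simp
    qed
    show "0 \<notin> S N" by (simp add: S_def H_def)
    show "g N z \<le> 1" for z unfolding g_def using H1 by simp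
    show "g N z = 0" if "z \<notin> S N" for z using that unfolding S_def g_def by simp
    show "0 \<le> g N z" for z unfolding g_def by simp
    show "0 \<le> (\<Lambda> + 1) * i N" using L i0[of N] by simp
    show "- ((\<Lambda> + 1) * i N) < gen (g N) v" if v: "v \<in> S N" for v
    proof -
      have "- ((\<Lambda> + 1) * i N) < - (\<Lambda> * i N)" using i0[of N] by (simp add: algebra_simps)
      also have "\<dots> \<le> G (H N) (v $ 1) (v $ 2)" by (rule GH)
      also have "\<dots> \<le> gen (g N) v" unfolding gen_state
        by (rule G_mono_at) (use v in \<open>auto simp: g_def S_def\<close>)
      finally show ?thesis .
    qed
    show "0 < \<eta> / (4 * \<Lambda>) * gen (\<lambda>w. if w = 0 then 1 else 0) 0 + gen (g N) 0"
    proof -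
      have "\<eta> - \<Lambda> * i N \<le> G (H N) 0 0"
        unfolding net_G_def H_def \<eta>_def \<Lambda>_def by (simp add: algebra_simps)
      also have "\<dots> \<le> gen (g N) 0" unfolding gen_state zero_index
        by (rule G_mono_at) (auto simp: g_def H_def)
      finally have "\<eta> - \<Lambda> * i N \<le> gen (g N) 0" .
      then have "\<eta> / 2 \<le> gen (g N) 0" using iN[of N] by simp
      moreover have "\<eta> / (4 * \<Lambda>) * gen (\<lambda>w. if w = 0 then 1 else 0) 0 = - (\<eta> / 4)"
        unfolding gen_indicator_0 \<Lambda>_def[symmetric] using L by simp
      ultimately show ?thesis using eta0 by simp
    qed
  next
    show "\<eta> / (4 * \<Lambda>) \<le> 1" "0 < \<eta> / (4 * \<Lambda>)" using eta0 eta_le L by simp_all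
    show "(\<lambda>N. (\<Lambda> + 1) * i N) \<longlonglongrightarrow> 0" using tendsto_mult[OF tendsto_const ilim, of "\<Lambda> + 1"] by simp
  qed
qed

end

lemma nn_integral_geometric:
  assumes "0 \<le> u" "u < (1::real)"
  shows "(\<integral>\<^sup>+m. ennreal (u ^ m) \<partial>count_space UNIV) = ennreal (1 / (1 - u))"
proof -
  have "(\<integral>\<^sup>+m. ennreal (u ^ m) \<partial>count_space UNIV) = (\<Sum>m. ennreal (u ^ m))" by (rule nn_integral_count_space_nat)
  also have "\<dots> = ennreal (\<Sum>m. u ^ m)" using assms by (intro suminf_ennreal2) (auto intro: summable_geometric)
  finally show ?thesis using assms by (simp add: suminf_geometric)
qed

locale jackson_chain_flow = jackson_chain lam mu p P X +
  two_queues_flow "lam $ 1" "lam $ 2" "mu $ 1" "mu $ 2" "p $ 1 $ 2" "p $ 2 $ 1" r1 r2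
  for lam mu :: "real^2" and p :: "real^2^2" and P :: "nat^2 \<Rightarrow> 'w measure" and X :: "real \<Rightarrow> 'w \<Rightarrow> nat^2" and r1 r2 :: real
begin

text \<open>Strict stability makes the product-form measure finite, its mass being a product of two
  geometric series.\<close>

lemma positive_recurrent_stable:
  assumes st: "r1\<^sup>2 < mu $ 1" "r2\<^sup>2 < mu $ 2"
  shows "positive_recurrent P X"
proof -
  define u v where "u = r1\<^sup>2 / mu $ 1" and "v = r2\<^sup>2 / mu $ 2"
  have uv: "0 < u" "u < 1" "0 < v" "v < 1" unfolding u_def v_def using st r1 r2 m1 m2 by simp_all
  define \<pi> where "\<pi> w = u ^ (w $ 1) * v ^ (w $ 2)" for w :: "nat^2"
  show ?thesis
  proof (rule positive_recurrentI[OF exhausting_level, of \<pi>])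
    show "0 < \<pi> w" for w using uv by (simp add: \<pi>_def)
    have "(\<integral>\<^sup>+w. ennreal (\<pi> w) \<partial>count_space UNIV) = (\<integral>\<^sup>+z. ennreal (\<pi> (case z of (m, n) \<Rightarrow> state m n)) \<partial>count_space UNIV)"
      by (rule nn_integral_bij_count_space[OF bij_state, symmetric])
    also have "\<dots> = (\<integral>\<^sup>+m. \<integral>\<^sup>+n. ennreal (\<pi> (state m n)) \<partial>count_space UNIV \<partial>count_space UNIV)"
      using nn_integral_fst_count_space[of "\<lambda>z. ennreal (\<pi> (case z of (m, n) \<Rightarrow> state m n))"] by simp
    also have "\<dots> = (\<integral>\<^sup>+m. ennreal (u ^ m) * ennreal (1 / (1 - v)) \<partial>count_space UNIV)"
      using uv by (simp add: \<pi>_def ennreal_mult nn_integral_cmult nn_integral_geometric[symmetric] less_imp_le)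
    also have "\<dots> = ennreal (1 / (1 - u)) * ennreal (1 / (1 - v))"
      using uv by (simp add: nn_integral_multc nn_integral_geometric less_imp_le)
    also have "\<dots> < \<infinity>" by (simp add: ennreal_mult_less_top)
    finally show "(\<integral>\<^sup>+w. ennreal (\<pi> w) \<partial>count_space UNIV) < \<infinity>" .
    show "gen (\<lambda>w. if w = x then 1 else 0) x < 0" for x using gen_indicator_self[of x] lam_pos by linarith
    fix N z assume z: "z \<in> level N"
    define T where "T = {(m, n). m + n \<le> N}"
    have T: "finite T" by (rule finite_subset[of _ "{..N} \<times> {..N}"]) (auto simp: T_def)
    have inj: "inj_on (\<lambda>(m, n). state m n) T" using bij_state by (auto simp: bij_def intro: inj_on_subset)
    have im: "level N = (\<lambda>(m, n). state m n) ` T"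
    proof (intro equalityI subsetI)
      fix w assume "w \<in> level N"
      then show "w \<in> (\<lambda>(m, n). state m n) ` T" unfolding level_def T_def by (intro image_eqI[where x = "(w $ 1, w $ 2)"]) auto
    qed (auto simp: level_def T_def)
    have "(\<Sum>y\<in>level N. \<pi> y * gen (\<lambda>w. if w = z then 1 else 0) y) =
        (\<Sum>w\<in>T. (u ^ fst w * v ^ snd w) * G (\<lambda>m n. if m = z $ 1 \<and> n = z $ 2 then 1 else 0) (fst w) (snd w))"
      unfolding im sum.reindex[OF inj] by (intro sum.cong refl) (auto simp: \<pi>_def gen_indicator)
    also have "\<dots> \<le> 0" unfolding u_def v_def
      by (rule product_form_subinvariant[OF T]) (use z in \<open>simp add: T_def level_def\<close>)
    finally show "(\<Sum>y\<in>level N. \<pi> y * gen (\<lambda>w. if w = z then 1 else 0) y) \<le> 0" .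
  qed
qed

end

section \<open>Consequences of Assumption (J)\<close>

lemma spectral_radius_matrix_2:
  fixes p :: "real^2^2"
  assumes diag: "p $ 1 $ 1 = 0" "p $ 2 $ 2 = 0" and nn: "0 \<le> p $ 1 $ 2" "0 \<le> p $ 2 $ 1"
    and rad: "spectral_radius_matrix p < 1"
  shows "p $ 1 $ 2 * p $ 2 $ 1 < 1"
proof (cases "p $ 1 $ 2 = 0")
  case False
  define a b where "a = p $ 1 $ 2" and "b = p $ 2 $ 1"
  have ab: "0 < a" "0 \<le> b" using nn False by (simp_all add: a_def b_def)
  let ?S = "{cmod c | c v. v \<noteq> 0 \<and> (\<chi> i j. complex_of_real (p $ i $ j)) *v v = c *s v}"
  have eqs: "(\<chi> i j. complex_of_real (p $ i $ j)) *v v = c *s v \<longleftrightarrow> of_real a * v $ 2 = c * v $ 1 \<and> of_real b * v $ 1 = c * v $ 2"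
    for c v by (simp add: vec_eq_iff forall_2 matrix_vector_mult_def sum_2 diag a_def b_def)
  \<comment> \<open>The Perron eigenvalue, with eigenvector \<open>(a, c)\<close>;
    \<open>a > 0\<close> keeps the vector nonzero.\<close>
  define c where "c = sqrt (a * b)"
  have c2: "c * c = a * b" and c0: "0 \<le> c" using ab by (simp_all add: c_def)
  define v :: "complex^2" where "v = (\<chi> i. if i = 1 then of_real a else of_real c)"
  have v: "v $ 1 = of_real a" "v $ 2 = of_real c" by (simp_all add: v_def)
  have "v \<noteq> 0" using v(1) ab by auto
  moreover have "(\<chi> i j. complex_of_real (p $ i $ j)) *v v = complex_of_real c *s v"
    unfolding eqs v of_real_mult[symmetric] c2 by (simp add: mult.commute)
  ultimately have mem: "c \<in> ?S"
    by (intro CollectI exI[of _ "complex_of_real c"] exI[of _ v]) (simp add: c0)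
  \<comment> \<open>Without an upper bound the real supremum would say nothing about its
    elements.\<close>
  have "bdd_above ?S"
  proof (rule bdd_aboveI)
    fix r assume "r \<in> ?S"
    then obtain e w where r: "r = cmod e" and w: "w \<noteq> 0"
      and ew: "(\<chi> i j. complex_of_real (p $ i $ j)) *v w = e *s w"
      by (elim CollectE exE conjE) (rule that, assumption+)
    have e: "of_real a * w $ 2 = e * w $ 1" "of_real b * w $ 1 = e * w $ 2" using ew unfolding eqs by simp_all
    show "r \<le> a + b"
    proof (rule ccontr)
      assume n: "\<not> r \<le> a + b"
      then have r0: "a < r" "b < r" using ab by simp_all
      have 1: "a * cmod (w $ 2) = r * cmod (w $ 1)"
        using arg_cong[OF e(1), of cmod] ab unfolding r norm_mult by simp
      have 2: "b * cmod (w $ 1) = r * cmod (w $ 2)"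
        using arg_cong[OF e(2), of cmod] ab unfolding r norm_mult by simp
      have "cmod (w $ 1) \<noteq> 0 \<or> cmod (w $ 2) \<noteq> 0" using w by (auto simp: vec_eq_iff forall_2)
      moreover have "r * (cmod (w $ 1) + cmod (w $ 2)) \<le> (max a b) * (cmod (w $ 1) + cmod (w $ 2))"
      proof -
        have "a * cmod (w $ 2) \<le> max a b * cmod (w $ 2)" "b * cmod (w $ 1) \<le> max a b * cmod (w $ 1)"
          by (intro mult_right_mono; simp)+
        then show ?thesis using 1 2 by (simp add: distrib_left)
      qed
      moreover have "max a b < r" using r0 by simp
      ultimately show False
        by (metis add_pos_nonneg add_nonneg_pos mult_le_cancel_right_pos norm_ge_zero not_le zero_less_norm_iff norm_zero)
    qed
  qed
  from cSup_upper[OF mem this] rad have "c < 1" unfolding spectral_radius_matrix_def by simp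
  then have "c * c < 1 * 1" using ab by (intro mult_strict_mono') (auto simp: c_def)
  then show ?thesis using c2 by (simp add: a_def b_def)
qed simp

lemma routing_steps_Suc:
  "routing_steps p (Suc n) j i = exit_prob p j * (((**) (routing_matrix p) ^^ n) (mat 1)) $ None $ Some i
     + (\<Sum>k\<in>UNIV. p $ j $ k * routing_steps p n k i)"
  unfolding routing_steps_def
  by (simp add: matrix_matrix_mult_def routing_matrix_def UNIV_option_conv sum.reindex)

lemma routing_outside: "(((**) (routing_matrix p) ^^ n) (mat 1)) $ None $ Some i = 0"
proof (induction n)
  case 0 show ?case by (simp add: mat_def)
next
  case (Suc n)
  then show ?case by (simp add: matrix_matrix_mult_def routing_matrix_def UNIV_option_conv sum.reindex)
qed

text \<open>No queue routes to \<open>i\<close> and the outside state is absorbing, so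
  \<open>i\<close> can be occupied only by starting there.\<close>

lemma routing_steps_zero:
  assumes "\<And>k. p $ k $ i = 0" "j \<noteq> i"
  shows "routing_steps p n j i = 0"
  using assms(2)
proof (induction n arbitrary: j)
  case 0 then show ?case by (simp add: routing_steps_def mat_def)
next
  case (Suc n)
  have "p $ j $ k * routing_steps p n k i = 0" for k
    using Suc.IH[of k] assms(1)[of j] by (cases "k = i") auto
  then have "(\<Sum>k\<in>UNIV. p $ j $ k * routing_steps p n k i) = 0" by (intro sum.neutral ballI)
  then show ?case by (simp add: routing_steps_Suc routing_outside)
qed

text \<open>If the inflow vanishes, queue \<open>i\<close> has no external arrivals, and either the
  other queue has none or it never routes to \<open>i\<close>. In both cases no external customer
  can reach \<open>i\<close>.\<close>

lemma assumption_J_inflow: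
  fixes lam :: "real^2" and p :: "real^2^2"
  assumes net: "jackson_network lam mu p" and J: "assumption_J lam p"
  shows "0 < lam $ 1 + lam $ 2 * p $ 2 $ 1" "0 < lam $ 2 + lam $ 1 * p $ 1 $ 2"
proof -
  have nn: "\<And>i. 0 \<le> lam $ i" "\<And>i j. 0 \<le> p $ i $ j" "\<And>i. p $ i $ i = 0"
    using net by (auto simp: jackson_network_def)
  have main: "0 < lam $ i + lam $ j * p $ j $ i" if ij: "i \<noteq> j" for i j :: 2
  proof (rule ccontr)
    assume "\<not> ?thesis"
    moreover have "0 \<le> lam $ j * p $ j $ i" using nn by simp
    ultimately have z: "lam $ i = 0" "lam $ j * p $ j $ i = 0" using nn(1)[of i] by linarith+
    have all: "k = i \<or> k = j" for k using ij exhaust_2[of i] exhaust_2[of j] exhaust_2[of k] by metis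
    obtain n k where k: "0 < lam $ k * routing_steps p n k i"
      using J unfolding assumption_J_def by blast
    then have "k \<noteq> i" using z by auto
    then have kj: "k = j" using all by blast
    then have "lam $ j \<noteq> 0" using k by auto
    then have "p $ j $ i = 0" using z by simp
    then have "p $ k $ i = 0" for k using all[of k] nn(3)[of i] by auto
    then have "routing_steps p n k i = 0" using \<open>k \<noteq> i\<close> by (intro routing_steps_zero)
    then show False using k by simp
  qed
  show "0 < lam $ 1 + lam $ 2 * p $ 2 $ 1" "0 < lam $ 2 + lam $ 1 * p $ 1 $ 2"
    using main[of 1 2] main[of 2 1] by simp_all
qed

lemma jackson_two_queues:
  fixes lam mu :: "real^2" and p :: "real^2^2"
  assumes net: "jackson_network lam mu p" and J: "assumption_J lam p"
  shows "two_queues (lam $ 1) (lam $ 2) (mu $ 1) (mu $ 2) (p $ 1 $ 2) (p $ 2 $ 1)"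
proof
  show "0 \<le> lam $ 1" "0 \<le> lam $ 2" "0 < mu $ 1" "0 < mu $ 2" "0 \<le> p $ 1 $ 2" "0 \<le> p $ 2 $ 1"
    using net by (auto simp: jackson_network_def)
  have "exit_prob p 1 \<ge> 0" "exit_prob p 2 \<ge> 0" using net by (auto simp: jackson_network_def)
  then show "p $ 1 $ 2 \<le> 1" "p $ 2 $ 1 \<le> 1" using net by (auto simp: jackson_network_def exit_prob_def sum_2)
  show "p $ 1 $ 2 * p $ 2 $ 1 < 1"
    using net J by (intro spectral_radius_matrix_2) (auto simp: jackson_network_def assumption_J_def)
  show "0 < lam $ 1 + lam $ 2 * p $ 2 $ 1" "0 < lam $ 2 + lam $ 1 * p $ 1 $ 2"
    using assumption_J_inflow[OF net J] .
qed

section \<open>The functions R, B and L in exponential coordinates\<close>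

context
  fixes lam mu :: "real^2" and p :: "real^2^2"
  assumes net: "jackson_network lam mu p"
begin

abbreviation (input) "net_R_of \<equiv> net_R (lam $ 1) (lam $ 2) (mu $ 1) (mu $ 2) (p $ 1 $ 2) (p $ 2 $ 1)"

lemma diag_exit: "p $ 1 $ 1 = 0" "p $ 2 $ 2 = 0" "exit_prob p 1 = 1 - p $ 1 $ 2" "exit_prob p 2 = 1 - p $ 2 $ 1"
  using net by (auto simp: jackson_network_def exit_prob_def sum_2)

lemma jackson_R_eq: "jackson_R lam mu p \<alpha> = net_R_of (exp (\<alpha> $ 1)) (exp (\<alpha> $ 2))"
proof -
  have U: "UNIV - {1::2} = {2}" "UNIV - {2::2} = {1}" by (auto simp: UNIV_2)
  show ?thesis unfolding jackson_R_def net_R_def sum_2 U diag_exit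
    by (simp add: exp_diff exp_minus add_divide_distrib diff_divide_distrib divide_inverse algebra_simps)
qed

lemma jackson_B_iff:
  "\<alpha> \<in> jackson_B p \<Lambda> \<longleftrightarrow>
    (1 \<notin> \<Lambda> \<longrightarrow> exp (\<alpha> $ 1) \<le> p $ 1 $ 2 * exp (\<alpha> $ 2) + 1 - p $ 1 $ 2) \<and>
    (2 \<notin> \<Lambda> \<longrightarrow> exp (\<alpha> $ 2) \<le> p $ 2 $ 1 * exp (\<alpha> $ 1) + 1 - p $ 2 $ 1)"
proof -
  have pos: "0 < c * exp t + 1 - c" if "0 \<le> c" "c \<le> 1" for c t :: real
  proof (cases "c = 1")
    case False
    have "0 \<le> c * exp t" using that by simp
    moreover have "c < 1" using that False by simp
    ultimately show ?thesis by linarith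
  qed simp
  have c: "0 \<le> p $ 1 $ 2" "p $ 1 $ 2 \<le> 1" "0 \<le> p $ 2 $ 1" "p $ 2 $ 1 \<le> 1"
  proof -
    show "0 \<le> p $ 1 $ 2" "0 \<le> p $ 2 $ 1" using net by (auto simp: jackson_network_def)
    have "0 \<le> exit_prob p 1" "0 \<le> exit_prob p 2" using net by (auto simp: jackson_network_def)
    then show "p $ 1 $ 2 \<le> 1" "p $ 2 $ 1 \<le> 1" by (simp_all add: diag_exit)
  qed
  have le_ln: "s \<le> ln w \<longleftrightarrow> exp s \<le> w" if "0 < w" for s w :: real
    using that by (metis exp_le_cancel_iff exp_ln)
  have "\<alpha> $ 1 \<le> ln ((\<Sum>j\<in>UNIV. p $ 1 $ j * exp (\<alpha> $ j)) + exit_prob p 1) \<longleftrightarrow> exp (\<alpha> $ 1) \<le> p $ 1 $ 2 * exp (\<alpha> $ 2) + 1 - p $ 1 $ 2"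
    using le_ln[OF pos[OF c(1,2)], of "\<alpha> $ 1" "\<alpha> $ 2"] by (simp add: sum_2 diag_exit add_diff_eq)
  moreover have "\<alpha> $ 2 \<le> ln ((\<Sum>j\<in>UNIV. p $ 2 $ j * exp (\<alpha> $ j)) + exit_prob p 2) \<longleftrightarrow> exp (\<alpha> $ 2) \<le> p $ 2 $ 1 * exp (\<alpha> $ 1) + 1 - p $ 2 $ 1"
    using le_ln[OF pos[OF c(3,4)], of "\<alpha> $ 2" "\<alpha> $ 1"] by (simp add: sum_2 diag_exit add_diff_eq)
  ultimately show ?thesis unfolding jackson_B_def forall_2 mem_Collect_eq by simp
qed

lemma jackson_L_le:
  assumes "\<And>x y. 0 < x \<Longrightarrow> 0 < y \<Longrightarrow> (1 \<notin> \<Lambda> \<Longrightarrow> x \<le> p $ 1 $ 2 * y + 1 - p $ 1 $ 2) \<Longrightarrow>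
     (2 \<notin> \<Lambda> \<Longrightarrow> y \<le> p $ 2 $ 1 * x + 1 - p $ 2 $ 1) \<Longrightarrow> c \<le> net_R_of x y"
  shows "jackson_L lam mu p \<Lambda> 0 \<le> ereal (- c)"
  unfolding jackson_L_def
proof (rule SUP_least)
  fix \<alpha> assume "\<alpha> \<in> jackson_B p \<Lambda>"
  then have "c \<le> net_R_of (exp (\<alpha> $ 1)) (exp (\<alpha> $ 2))" unfolding jackson_B_iff by (intro assms) auto
  then show "ereal (\<alpha> \<bullet> 0 - jackson_R lam mu p \<alpha>) \<le> ereal (- c)" by (simp add: jackson_R_eq)
qed

lemma jackson_L_ge:
  assumes xy: "0 < x" "0 < y" "1 \<notin> \<Lambda> \<Longrightarrow> x \<le> p $ 1 $ 2 * y + 1 - p $ 1 $ 2" "2 \<notin> \<Lambda> \<Longrightarrow> y \<le> p $ 2 $ 1 * x + 1 - p $ 2 $ 1"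
    and c: "net_R_of x y \<le> c"
  shows "ereal (- c) \<le> jackson_L lam mu p \<Lambda> 0"
proof -
  define \<alpha> :: "real^2" where "\<alpha> = (\<chi> i. if i = 1 then ln x else ln y)"
  have e: "exp (\<alpha> $ 1) = x" "exp (\<alpha> $ 2) = y" using xy by (simp_all add: \<alpha>_def)
  have "\<alpha> \<in> jackson_B p \<Lambda>" unfolding jackson_B_iff e using xy by blast
  then have "ereal (\<alpha> \<bullet> 0 - jackson_R lam mu p \<alpha>) \<le> jackson_L lam mu p \<Lambda> 0"
    unfolding jackson_L_def by (rule SUP_upper)
  moreover have "ereal (- c) \<le> ereal (\<alpha> \<bullet> 0 - jackson_R lam mu p \<alpha>)" using c by (simp add: jackson_R_eq e)
  ultimately show ?thesis by (rule order_trans[rotated])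
qed

text \<open>\<open>jackson_L\<close> for \<open>{1}\<close> constrains queue 2 only, and vice versa.
  If \<open>c\<close> is a lower bound for \<open>R\<close> under one constraint and is reached or
  undercut under both, the smaller of the two suprema is \<open>- c\<close>.\<close>

lemma INF_jackson_L_eq:
  assumes low: "(\<forall>x y. 0 < x \<longrightarrow> 0 < y \<longrightarrow> y \<le> p $ 2 $ 1 * x + 1 - p $ 2 $ 1 \<longrightarrow> c \<le> net_R_of x y) \<or>
      (\<forall>x y. 0 < x \<longrightarrow> 0 < y \<longrightarrow> x \<le> p $ 1 $ 2 * y + 1 - p $ 1 $ 2 \<longrightarrow> c \<le> net_R_of x y)"
    and up: "\<exists>x y. 0 < x \<and> 0 < y \<and> y \<le> p $ 2 $ 1 * x + 1 - p $ 2 $ 1 \<and> net_R_of x y \<le> c"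
      "\<exists>x y. 0 < x \<and> 0 < y \<and> x \<le> p $ 1 $ 2 * y + 1 - p $ 1 $ 2 \<and> net_R_of x y \<le> c"
  shows "- (INF i\<in>{1, 2}. jackson_L lam mu p {i} 0) = ereal c"
proof -
  have "jackson_L lam mu p {1} 0 \<le> ereal (- c) \<or> jackson_L lam mu p {2} 0 \<le> ereal (- c)"
    using low
  proof
    assume "\<forall>x y. 0 < x \<longrightarrow> 0 < y \<longrightarrow> y \<le> p $ 2 $ 1 * x + 1 - p $ 2 $ 1 \<longrightarrow> c \<le> net_R_of x y"
    then have "jackson_L lam mu p {1} 0 \<le> ereal (- c)" by (intro jackson_L_le) auto
    then show ?thesis ..
  next
    assume "\<forall>x y. 0 < x \<longrightarrow> 0 < y \<longrightarrow> x \<le> p $ 1 $ 2 * y + 1 - p $ 1 $ 2 \<longrightarrow> c \<le> net_R_of x y"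
    then have "jackson_L lam mu p {2} 0 \<le> ereal (- c)" by (intro jackson_L_le) auto
    then show ?thesis ..
  qed
  then have "(INF i\<in>{1, 2}. jackson_L lam mu p {i} 0) \<le> ereal (- c)" by (auto simp: min_le_iff_disj)
  moreover have "ereal (- c) \<le> jackson_L lam mu p {1} 0" "ereal (- c) \<le> jackson_L lam mu p {2} 0"
    using up jackson_L_ge[of _ _ "{1}" c] jackson_L_ge[of _ _ "{2}" c] by auto
  then have "ereal (- c) \<le> (INF i\<in>{1, 2}. jackson_L lam mu p {i} 0)" by auto
  ultimately have "(INF i\<in>{1, 2}. jackson_L lam mu p {i} 0) = ereal (- c)" by (rule order_antisym)
  then show ?thesis by simp
qed

end

theorem proposition7p2:
  fixes lam mu nu :: "real^2" and p :: "real^2^2"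
    and P :: "nat^2 \<Rightarrow> 'w measure" and X :: "real \<Rightarrow> 'w \<Rightarrow> nat^2"
  assumes "jackson_network lam mu p"
    and "assumption_J lam p"
    and "traffic_equations lam p nu"
    and "markov_chain_with_rates (jackson_rate lam mu p) P X"
  shows "(positive_recurrent P X \<longrightarrow>
            ereal (ln (essential_spectral_radius_chain P X))
              = - (INF i\<in>{1, 2}. jackson_L lam mu p {i} 0) \<and>
            - (INF i\<in>{1, 2}. jackson_L lam mu p {i} 0)
              = ereal (- (1 - p $ 1 $ 2 * p $ 2 $ 1) *
                  min ((sqrt (mu $ 1) - sqrt (nu $ 1))\<^sup>2) ((sqrt (mu $ 2) - sqrt (nu $ 2))\<^sup>2))) \<and>
         (\<not> positive_recurrent P X \<longrightarrow>
            ereal (ln (essential_spectral_radius_chain P X))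
              = - (INF i\<in>{1, 2}. jackson_L lam mu p {i} 0) \<and>
            - (INF i\<in>{1, 2}. jackson_L lam mu p {i} 0)
              = ereal (ln (spectral_radius_chain P X)) \<and>
            ereal (ln (spectral_radius_chain P X)) = - jackson_L lam mu p {} 0)"
proof -
  note net = assms(1)
  note tq = jackson_two_queues[OF assms(1,2)]
  define a b where "a = p $ 1 $ 2" and "b = p $ 2 $ 1"
  have t: "\<forall>i. nu $ i = lam $ i + (\<Sum>j\<in>UNIV. nu $ j * p $ j $ i)"
    using assms(3) unfolding traffic_equations_def .
  have traffic: "nu $ 1 = lam $ 1 + nu $ 2 * b" "nu $ 2 = lam $ 2 + nu $ 1 * a"
    using spec[OF t, of 1] spec[OF t, of 2] unfolding sum_2 diag_exit(1,2)[OF net] a_def b_def by argo+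
  have ab1: "a * b < 1" using two_queues.ab[OF tq] by (simp add: a_def b_def)
  have sum1: "(1 - a * b) * nu $ 1 = lam $ 1 + lam $ 2 * b"
  proof -
    have "nu $ 1 = lam $ 1 + (lam $ 2 + nu $ 1 * a) * b" by (rule traffic(1)[unfolded traffic(2)])
    then show ?thesis by (simp add: algebra_simps)
  qed
  have sum2: "(1 - a * b) * nu $ 2 = lam $ 2 + lam $ 1 * a"
  proof -
    have "nu $ 2 = lam $ 2 + (lam $ 1 + nu $ 2 * b) * a" by (rule traffic(2)[unfolded traffic(1)])
    then show ?thesis by (simp add: algebra_simps)
  qed
  have nu: "0 < nu $ 1" "0 < nu $ 2"
    using two_queues.flow1[OF tq] two_queues.flow2[OF tq] ab1 unfolding a_def[symmetric] b_def[symmetric] sum1[symmetric] sum2[symmetric]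
    by (simp_all add: zero_less_mult_iff)
  have nu_sq: "(sqrt (nu $ 1))\<^sup>2 = nu $ 1" "(sqrt (nu $ 2))\<^sup>2 = nu $ 2" using nu by simp_all
  interpret jackson_chain_flow lam mu p P X "sqrt (nu $ 1)" "sqrt (nu $ 2)"
  proof (intro jackson_chain_flow.intro jackson_chain.intro rates_chain.intro jackson_chain_axioms.intro
      two_queues_flow.intro two_queues_flow_axioms.intro tq assms)
    show "0 < sqrt (nu $ 1)" "0 < sqrt (nu $ 2)" using nu by simp_all
    show "(sqrt (nu $ 1))\<^sup>2 = lam $ 1 + (sqrt (nu $ 2))\<^sup>2 * p $ 2 $ 1"
      "(sqrt (nu $ 2))\<^sup>2 = lam $ 2 + (sqrt (nu $ 1))\<^sup>2 * p $ 1 $ 2"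
      unfolding nu_sq by (rule traffic[unfolded a_def b_def])+
  qed
  have ne_iff: "(1 - a * b) * mu $ 1 < lam $ 1 + lam $ 2 * b \<longleftrightarrow> mu $ 1 < nu $ 1"
    "(1 - a * b) * mu $ 2 < lam $ 2 + lam $ 1 * a \<longleftrightarrow> mu $ 2 < nu $ 2"
    "(1 - a * b) * mu $ 1 \<le> lam $ 1 + lam $ 2 * b \<longleftrightarrow> mu $ 1 \<le> nu $ 1"
    "(1 - a * b) * mu $ 2 \<le> lam $ 2 + lam $ 1 * a \<longleftrightarrow> mu $ 2 \<le> nu $ 2"
    unfolding sum1[symmetric] sum2[symmetric] using ab1 by simp_all
  show ?thesis
  proof (intro conjI impI)
    assume pr: "positive_recurrent P X"
    \<comment> \<open>Positive recurrence gives weak inequalities only; exact balance appears here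
      as \<open>s = 0\<close>.\<close>
    have st: "nu $ 1 \<le> mu $ 1" "nu $ 2 \<le> mu $ 2"
      using not_positive_recurrent_transient pr unfolding a_def[symmetric] b_def[symmetric] ne_iff by force+
    define s where "s = min (sqrt (mu $ 1) - sqrt (nu $ 1)) (sqrt (mu $ 2) - sqrt (nu $ 2))"
    have s0: "0 \<le> s" using st by (simp add: s_def)
    define \<rho> where "\<rho> = - (1 - p $ 1 $ 2 * p $ 2 $ 1) * s\<^sup>2"
    note ev = ergodic_values[OF s_def s0, folded \<rho>_def]
    obtain x y where val: "net_R (lam $ 1) (lam $ 2) (mu $ 1) (mu $ 2) (p $ 1 $ 2) (p $ 2 $ 1) x y = \<rho>"
      and cr: "critical x y" and pos: "0 < x" "0 < y"
      using ev(1) by (elim exE conjE) (rule that, assumption+)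
    note xy = pos cr val
    have L: "- (INF i\<in>{1, 2}. jackson_L lam mu p {i} 0) = ereal \<rho>"
      by (rule INF_jackson_L_eq[OF net _ ev(2,3)]) (rule critical_minimal[OF xy(1,2,3), unfolded xy(4)])
    have ge: "exp \<rho> \<le> essential_spectral_radius_chain P X"
      using essential_ge_critical[OF xy(1,2,3)] by (simp only: xy(4))
    have le_eps: "essential_spectral_radius_chain P X \<le> exp (\<rho> + \<epsilon>)" if e: "0 < \<epsilon>" for \<epsilon>
    proof -
      obtain f N where f: "\<forall>m n. 0 < f m n" "\<forall>m n. N < m \<or> N < n \<longrightarrow>
          net_G (lam $ 1) (lam $ 2) (mu $ 1) (mu $ 2) (p $ 1 $ 2) (p $ 2 $ 1) f m n \<le> (\<rho> + \<epsilon>) * f m n"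
        using ergodic_supersolution[OF s0 ev(4,5) e] unfolding \<rho>_def by blast
      show ?thesis by (rule essential_le_supersolution[of f N]) (use f in blast)+
    qed
    have "((\<lambda>\<epsilon>. exp (\<rho> + \<epsilon>)) \<longlongrightarrow> exp (\<rho> + 0)) (at_right 0)" by (intro tendsto_intros)
    then have "essential_spectral_radius_chain P X \<le> exp (\<rho> + 0)"
      by (rule tendsto_lowerbound) (use le_eps eventually_at_right_less[of "0::real"] in \<open>auto elim: eventually_mono\<close>)
    then have "essential_spectral_radius_chain P X = exp \<rho>" using ge by simp
    then have "ereal (ln (essential_spectral_radius_chain P X)) = ereal \<rho>" by simp
    then show "ereal (ln (essential_spectral_radius_chain P X)) = - (INF i\<in>{1, 2}. jackson_L lam mu p {i} 0)"
      by (simp only: L)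
    have "s\<^sup>2 = min ((sqrt (mu $ 1) - sqrt (nu $ 1))\<^sup>2) ((sqrt (mu $ 2) - sqrt (nu $ 2))\<^sup>2)"
    proof -
      have n: "0 \<le> sqrt (mu $ 1) - sqrt (nu $ 1)" "0 \<le> sqrt (mu $ 2) - sqrt (nu $ 2)" using st by simp_all
      show ?thesis unfolding s_def min_def using power_mono_iff[OF n, of 2] by auto
    qed
    then show "- (INF i\<in>{1, 2}. jackson_L lam mu p {i} 0) = ereal (- (1 - p $ 1 $ 2 * p $ 2 $ 1) *
        min ((sqrt (mu $ 1) - sqrt (nu $ 1))\<^sup>2) ((sqrt (mu $ 2) - sqrt (nu $ 2))\<^sup>2))"
      unfolding L \<rho>_def by simp
  next
    assume npr: "\<not> positive_recurrent P X"
    \<comment> \<open>What remains is at least one queue whose service rate does not exceed its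
      traffic, balanced or overloaded.\<close>
    have "\<not> (nu $ 1 < mu $ 1 \<and> nu $ 2 < mu $ 2)" using npr positive_recurrent_stable unfolding nu_sq by blast
    then have "mu $ 1 \<le> nu $ 1 \<or> mu $ 2 \<le> nu $ 2" by auto
    then have ne: "(1 - p $ 1 $ 2 * p $ 2 $ 1) * mu $ 1 \<le> lam $ 1 + lam $ 2 * p $ 2 $ 1 \<or>
        (1 - p $ 1 $ 2 * p $ 2 $ 1) * mu $ 2 \<le> lam $ 2 + lam $ 1 * p $ 1 $ 2"
      unfolding a_def[symmetric] b_def[symmetric] ne_iff .
    obtain x y where xy: "0 < x" "0 < y" "x \<le> p $ 1 $ 2 * y + 1 - p $ 1 $ 2" "y \<le> p $ 2 $ 1 * x + 1 - p $ 2 $ 1" "critical x y"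
      by (rule nonergodic_critical[OF ne]) (rule that)
    define \<rho> where "\<rho> = net_R (lam $ 1) (lam $ 2) (mu $ 1) (mu $ 2) (p $ 1 $ 2) (p $ 2 $ 1) x y"
    note min = critical_minimal[OF xy(1,2,5), folded \<rho>_def]
    have L: "- (INF i\<in>{1, 2}. jackson_L lam mu p {i} 0) = ereal \<rho>"
      by (rule INF_jackson_L_eq[OF net min]) (intro exI[of _ x] exI[of _ y], use xy \<rho>_def in simp)+
    have "jackson_L lam mu p {} 0 = ereal (- \<rho>)"
    proof (rule order_antisym)
      show "jackson_L lam mu p {} 0 \<le> ereal (- \<rho>)" by (rule jackson_L_le[OF net]) (use min in blast)
      show "ereal (- \<rho>) \<le> jackson_L lam mu p {} 0" by (rule jackson_L_ge[OF net xy(1-4)]) (simp add: \<rho>_def)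
    qed
    then have L0: "- jackson_L lam mu p {} 0 = ereal \<rho>" by simp
    have "exp \<rho> \<le> essential_spectral_radius_chain P X" unfolding \<rho>_def by (rule essential_ge_critical[OF xy(1,2,5)])
    moreover have "spectral_radius_chain P X \<le> exp \<rho>" "essential_spectral_radius_chain P X \<le> spectral_radius_chain P X"
      unfolding \<rho>_def by (rule spectral_le_wedge[OF xy(1-4)])+
    \<comment> \<open>The bounds form a closed chain: \<open>exp \<rho>\<close>, the essential
      radius, the spectral radius and again \<open>exp \<rho>\<close>.\<close>
    ultimately have "essential_spectral_radius_chain P X = exp \<rho>" "spectral_radius_chain P X = exp \<rho>" by simp_all
    then have e: "ereal (ln (essential_spectral_radius_chain P X)) = ereal \<rho>" "ereal (ln (spectral_radius_chain P X)) = ereal \<rho>" by simp_all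
    show "ereal (ln (essential_spectral_radius_chain P X)) = - (INF i\<in>{1, 2}. jackson_L lam mu p {i} 0)"
      by (simp only: L e)
    show "- (INF i\<in>{1, 2}. jackson_L lam mu p {i} 0) = ereal (ln (spectral_radius_chain P X))"
      by (simp only: L e)
    show "ereal (ln (spectral_radius_chain P X)) = - jackson_L lam mu p {} 0"
      by (simp only: L0 e)
  qed
qed

end
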